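(* Suppose that $h_n\to0$ and $T=nh_n\to\infty$ as $n\to\infty$, and that $n/\alpha_n\to0$ as $n\to\infty$. Suppose further that there exists $\vartheta_0\in\Theta$ such that, for every $\epsilon>0$, $$\sup_{\vartheta\in\bar\Theta:\,|\vartheta-\vartheta_0|>\epsilon}Ph^{\vartheta}<Ph^{\vartheta_0}.$$ Let $$\hat\vartheta_n=\arg\max_{\vartheta\in\bar\Theta}\mathbb{P}_{\alpha_n}h^{\vartheta},\qquad \mathbb{P}_{\alpha_n}h^{\vartheta}=\frac1{\alpha_n}\sum_{k=1}^{\alpha_n}h^{\vartheta}(\hat X^{i_{(k)},n}).$$ Then $\hat\vartheta_n$ is weakly consistent for $\vartheta_0$, i.e. $\hat\vartheta_n\to\vartheta_0$ in probability as $n\to\infty$.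
   Context: Risk process. On a stochastic basis $(\Omega,\mathcal F,\mathbb P;\mathbb F)$, $X=(X_t)_{t\ge0}$ is the Lévy process started at $X_0=u$, $X_t=u+ct+\sigma W_t-S_t$, where $u,\sigma\ge0$, $c>0$, $W$ is a Wiener process, and $S$ is a pure-jump Lévy process independent of $W$ which is a subordinator (non-decreasing paths in $[0,\infty)$) with Lévy measure $\nu$ satisfying $\nu((-\infty,0))=0$, $\int_{(0,\infty)}(1\wedge x)\nu(dx)<\infty$ and $\int_{(0,\infty)}x^2\nu(dx)<\infty$. The net profit condition $c>\mathbb E[S_1]$ holds. $\mathbb D_\infty=D[0,\infty)$ is the space of càdlàg functions on $[0,\infty)$ with the Borel field generated by the Skorokhod topology. $P=\mathbb P\circ X^{-1}$ is the law of $X$, and $Pf=\mathbb E[f(X)]$. Dividend functional. $\Theta=(u,\bar\vartheta)$ with $\bar\vartheta$ a known positive number, and $\bar\Theta$ is its closure. A discount rate $r>0$ is fixed. For a path $x\in\mathbb D_\infty$ with $x_0=u$ and a barrier $\vartheta$, put $\xi_0^\vartheta(x)=0$ and $\xi_t^\vartheta(x)=(\sup_{0\le s<t}x_s-\vartheta)\vee0$ for $t>0$; $U_t^\vartheta(x)=x_t-\xi_t^\vartheta(x)$; $\tau^\vartheta(x)=\inf\{t>0: U_t^\vartheta(x)<0\}$; and $$h^\vartheta(x)=\int_0^{\tau^\vartheta(x)}e^{-rt}\,d\xi_t^\vartheta(x),$$ the Stieltjes integral being read as $\int_0^\infty\mathbf 1_{\{\tau^\vartheta(x)>t\}}e^{-rt}d\xi_t^\vartheta(x)$.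 Sampling and quasi-processes. For each $n$, the path is observed at $t_k=kh_n$, $k=0,1,\dots,n$, with mesh $h_n>0$ and terminal time $T=t_n=nh_n$. Set $\Delta_kX=X_{t_k}-X_{t_{k-1}}$. $\Lambda_n$ is the set of all $n!$ permutations of $(1,\dots,n)$. For $i\in\Lambda_n$ the quasi-process is $\hat X^{i,n}_t=u+\sum_{k=1}^n\Delta_{i(k)}X\cdot\mathbf 1_{[t_k,\infty)}(t)$, $t\ge0$. For a quasi-process path with no ruin up to $t_n$, $\tau^\vartheta$ is defined to be $t_n$. Permutation sets. $\alpha_n\le n!$ is a given positive integer, and $A_n=\{i_{(1)},\dots,i_{(\alpha_n)}\}$ is an i.i.d. sample drawn uniformly from $\Lambda_n$, independently of $X$. $\mathbb P_{\alpha_n}=\frac1{\alpha_n}\sum_{k=1}^{\alpha_n}\delta_{\hat X^{i_{(k)},n}}$. *)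

theory Defs
  imports "HOL-Probability.Probability"
begin

definition cadlag :: "(real \<Rightarrow> real) \<Rightarrow> bool" where
  "cadlag x \<longleftrightarrow>
     (\<forall>t\<ge>0. (x \<longlongrightarrow> x t) (at_right t)) \<and> (\<forall>t>0. \<exists>l. (x \<longlongrightarrow> l) (at_left t))"

definition jump :: "(real \<Rightarrow> real) \<Rightarrow> real \<Rightarrow> real" where
  "jump x t = x t - Lim (at_left t) x"

text \<open>The Lebesgue--Stieltjes measure of a monotone function \<open>f\<close>: \<open>[a, b]\<close> has mass
  \<open>f (b+) - f (a-)\<close>.  Since \<^const>\<open>interval_measure\<close> is the Stieltjes measure only for
  right-continuous functions, it is applied to the right-continuous version of \<open>f\<close>.\<close>

definition stieltjes_measure :: "(real \<Rightarrow> real) \<Rightarrow> real measure" where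
  "stieltjes_measure f = interval_measure (\<lambda>t. Lim (at_right t) f)"

text \<open>The cumulative dividend path is left-continuous in \<open>t\<close>; it is extended by \<open>0\<close> to
  negative times.\<close>

definition dividend :: "real \<Rightarrow> (real \<Rightarrow> real) \<Rightarrow> real \<Rightarrow> real" where
  "dividend \<theta> x t = (if t \<le> 0 then 0 else max ((SUP s\<in>{0..<t}. x s) - \<theta>) 0)"

definition surplus :: "real \<Rightarrow> (real \<Rightarrow> real) \<Rightarrow> real \<Rightarrow> real" where
  "surplus \<theta> x t = x t - dividend \<theta> x t"

definition ruin_time :: "real \<Rightarrow> (real \<Rightarrow> real) \<Rightarrow> ereal" where
  "ruin_time \<theta> x = (INF t\<in>{t. 0 < t \<and> surplus \<theta> x t < 0}. ereal t)"

definition ruin_time_upto :: "real \<Rightarrow> real \<Rightarrow> (real \<Rightarrow> real) \<Rightarrow> ereal" where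
  "ruin_time_upto T \<theta> x =
     (if \<exists>t. 0 < t \<and> t \<le> T \<and> surplus \<theta> x t < 0 then ruin_time \<theta> x else ereal T)"

definition discounted_dividends ::
    "real \<Rightarrow> real \<Rightarrow> (real \<Rightarrow> real) \<Rightarrow> ereal \<Rightarrow> real" where
  "discounted_dividends r \<theta> x \<tau> =
     (LINT t:{0..}|stieltjes_measure (dividend \<theta> x). indicator {t. ereal t < \<tau>} t * exp (- r * t))"

definition h_path :: "real \<Rightarrow> real \<Rightarrow> (real \<Rightarrow> real) \<Rightarrow> real" where
  "h_path r \<theta> x = discounted_dividends r \<theta> x (ruin_time \<theta> x)"

text \<open>The same functional on quasi-process paths, for which the ruin time is set to the terminal
  time \<open>T\<close> if there is no ruin up to \<open>T\<close>.\<close>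

definition h_quasi :: "real \<Rightarrow> real \<Rightarrow> real \<Rightarrow> (real \<Rightarrow> real) \<Rightarrow> real" where
  "h_quasi T r \<theta> x = discounted_dividends r \<theta> x (ruin_time_upto T \<theta> x)"

text \<open>A process is a function \<open>Y t \<omega>\<close> of time and outcome; only times \<open>t \<ge> 0\<close> are relevant.
  Its path is viewed as an element of the product space: on cadlag functions the Borel field of the
  Skorokhod topology is the one generated by the coordinates.\<close>

definition path_of :: "(real \<Rightarrow> 'a \<Rightarrow> real) \<Rightarrow> 'a \<Rightarrow> real \<Rightarrow> real" where
  "path_of Y \<omega> = (\<lambda>t\<in>{0..}. Y t \<omega>)"

locale stochastic_basis = prob_space M for M :: "'a measure" +
  fixes F :: "real \<Rightarrow> 'a measure"
  assumes subalgebra_F: "\<And>t. 0 \<le> t \<Longrightarrow> subalgebra M (F t)"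
    and mono_F: "\<And>s t. 0 \<le> s \<Longrightarrow> s \<le> t \<Longrightarrow> sets (F s) \<subseteq> sets (F t)"
begin

definition levy_process :: "(real \<Rightarrow> 'a \<Rightarrow> real) \<Rightarrow> bool" where
  "levy_process Y \<longleftrightarrow>
     (\<forall>t\<ge>0. Y t \<in> borel_measurable (F t)) \<and>
     (\<forall>\<omega>\<in>space M. cadlag (\<lambda>t. Y t \<omega>)) \<and>
     (AE \<omega> in M. Y 0 \<omega> = 0) \<and>
     (\<forall>s t. 0 \<le> s \<and> s \<le> t \<longrightarrow>
        indep_set (sets (F s)) (sets (vimage_algebra (space M) (\<lambda>\<omega>. Y t \<omega> - Y s \<omega>) borel)) \<and>
        distr M borel (\<lambda>\<omega>. Y t \<omega> - Y s \<omega>) = distr M borel (Y (t - s)))"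

definition wiener_process :: "(real \<Rightarrow> 'a \<Rightarrow> real) \<Rightarrow> bool" where
  "wiener_process W \<longleftrightarrow>
     levy_process W \<and>
     (\<forall>\<omega>\<in>space M. continuous_on {0..} (\<lambda>t. W t \<omega>)) \<and>
     (\<forall>s t. 0 \<le> s \<and> s < t \<longrightarrow>
        distributed M lborel (\<lambda>\<omega>. W t \<omega> - W s \<omega>) (normal_density 0 (sqrt (t - s))))"

text \<open>The Levy measure of a Borel set is the expected number of jumps with size in that set
  during a time interval of length 1.\<close>

definition has_levy_measure :: "(real \<Rightarrow> 'a \<Rightarrow> real) \<Rightarrow> real measure \<Rightarrow> bool" where
  "has_levy_measure Y \<nu> \<longleftrightarrow>
     sets \<nu> = sets borel \<and>
     (\<forall>A\<in>sets borel. emeasure \<nu> A =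
        (\<integral>\<^sup>+\<omega>. emeasure (count_space UNIV)
            {s. 0 < s \<and> s \<le> 1 \<and> jump (\<lambda>t. Y t \<omega>) s \<noteq> 0 \<and> jump (\<lambda>t. Y t \<omega>) s \<in> A} \<partial>M))"

definition subordinator :: "(real \<Rightarrow> 'a \<Rightarrow> real) \<Rightarrow> bool" where
  "subordinator S \<longleftrightarrow>
     levy_process S \<and>
     (\<forall>\<omega>\<in>space M. mono_on {0..} (\<lambda>t. S t \<omega>) \<and> (\<forall>t\<ge>0. 0 \<le> S t \<omega>))"

definition pure_jump :: "(real \<Rightarrow> 'a \<Rightarrow> real) \<Rightarrow> bool" where
  "pure_jump Y \<longleftrightarrow> (AE \<omega> in M. \<forall>t\<ge>0. (jump (\<lambda>t. Y t \<omega>) has_sum Y t \<omega>) {0<..t})"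

end

locale risk_model = stochastic_basis M F for M :: "'a measure" and F +
  fixes u c \<sigma> :: real and W S :: "real \<Rightarrow> 'a \<Rightarrow> real" and \<nu> :: "real measure"
  assumes u_nonneg: "0 \<le> u" and \<sigma>_nonneg: "0 \<le> \<sigma>" and c_pos: "0 < c"
    and wiener_W: "wiener_process W"
    and subordinator_S: "subordinator S" and pure_jump_S: "pure_jump S"
    and indep_W_S:
      "indep_var (Pi\<^sub>M {0..} (\<lambda>_. borel)) (path_of W) (Pi\<^sub>M {0..} (\<lambda>_. borel)) (path_of S)"
    and levy_measure_S: "has_levy_measure S \<nu>"
    and \<nu>_negative: "emeasure \<nu> {..<0} = 0"
    and \<nu>_small_jumps: "(\<integral>\<^sup>+x\<in>{0<..}. ennreal (min 1 x) \<partial>\<nu>) < \<infinity>"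
    and \<nu>_second_moment: "(\<integral>\<^sup>+x\<in>{0<..}. ennreal (x\<^sup>2) \<partial>\<nu>) < \<infinity>"
    and net_profit: "(\<integral>\<^sup>+\<omega>. ennreal (S 1 \<omega>) \<partial>M) < ennreal c"

definition risk_process ::
    "real \<Rightarrow> real \<Rightarrow> real \<Rightarrow> (real \<Rightarrow> 'a \<Rightarrow> real) \<Rightarrow> (real \<Rightarrow> 'a \<Rightarrow> real) \<Rightarrow> real \<Rightarrow> 'a \<Rightarrow> real" where
  "risk_process u c \<sigma> W S t \<omega> = u + c * t + \<sigma> * W t \<omega> - S t \<omega>"

definition quasi_process ::
    "real \<Rightarrow> nat \<Rightarrow> real \<Rightarrow> (real \<Rightarrow> real) \<Rightarrow> (nat \<Rightarrow> nat) \<Rightarrow> real \<Rightarrow> real" where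
  "quasi_process u n \<delta> x i t =
     u + (\<Sum>k=1..n. (x (real (i k) * \<delta>) - x (real (i k - 1) * \<delta>)) * indicator {real k * \<delta>..} t)"

definition perms :: "nat \<Rightarrow> (nat \<Rightarrow> nat) set" where
  "perms n = {i. i permutes {1..n}}"

definition (in prob_space) uniform_perm_sample ::
    "(real \<Rightarrow> 'a \<Rightarrow> real) \<Rightarrow> nat \<Rightarrow> nat \<Rightarrow> (nat \<Rightarrow> 'a \<Rightarrow> nat \<Rightarrow> nat) \<Rightarrow> bool" where
  "uniform_perm_sample X n a I \<longleftrightarrow>
     indep_vars (\<lambda>_. count_space (perms n)) I {1..a} \<and>
     (\<forall>k\<in>{1..a}. distr M (count_space (perms n)) (I k) = uniform_count_measure (perms n)) \<and>
     indep_set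
       (sets (vimage_algebra (space M) (path_of X) (Pi\<^sub>M {0..} (\<lambda>_. borel))))
       (sets (vimage_algebra (space M) (\<lambda>\<omega>. \<lambda>k\<in>{1..a}. I k \<omega>)
          (Pi\<^sub>M {1..a} (\<lambda>_. count_space (perms n)))))"

end

theory Submission
  imports Defs "HOL-Real_Asymp.Real_Asymp"
begin

text \<open>Write \<open>e\<close> for an independent exponential time of rate \<open>r\<close>. By Fubini the discounted dividends of a
  path are the expectation over \<open>e\<close> of the dividends paid up to \<open>min e \<tau>\<close>, where \<open>\<tau>\<close> is the ruin time.
  For a discretised path this stopped dividend converges to that of the path at almost every \<open>e\<close>,
  since ruin on the grid comes no earlier than true ruin and, as the risk process has no upward
  jumps, nothing is paid in the short time until it is detected. Together with an \<open>L\<^sup>2\<close> bound this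
  gives convergence of the means.

  For a fixed barrier the functional, truncated at a finite time and a finite value, depends on
  \<open>m\<close> out of \<open>n\<close> i.i.d. increments with \<open>m / n \<rightarrow> 0\<close>, and its average over all permutations is a
  U-statistic, so by Hoeffding's block argument its variance vanishes; sampling \<open>\<alpha>\<^sub>n \<rightarrow> \<infinity>\<close>
  permutations adds a variance of order \<open>1 / \<alpha>\<^sub>n\<close>. No continuity of the functional is needed here.

  Finally, raising the barrier from \<open>a\<close> to \<open>b\<close> lowers the discounted dividends of any path by at most
  \<open>b - a\<close>. Hence the values at finitely many barriers bound the empirical criterion from above
  uniformly away from \<open>\<theta>\<^sub>0\<close>, which suffices for the consistency of the maximiser.\<close>

section \<open>Stieltjes integrals against an exponential killing time\<close>

text \<open>The obstacle is ruin: an arbitrarily small change of the path or of the barrier can move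
  the ruin time by a large amount, so no modulus of continuity in \<theta> is at hand. What survives
  is one-sided. A higher barrier may avoid ruin and let the dividends jump up, but it never loses
  more than its own rise; hence every barrier is compared with a nearby larger one. Since only upper
  bounds are wanted away from the maximiser, this half of a continuity estimate is enough. The
  comparison points can then be kept in the interval above \<open>u\<close>, so they are positive,
  and positivity is what excludes ruin caused by a lump payment at time 0.

  The permuted walk enters the limit through exchangeability: the increments of X are i.i.d., so
  each permuted walk has the law of the sampled path itself, and the pathwise limit identifies the
  common mean. The orders of choice are: the cap K from the second moment, then the horizon from the
  discount factor, then n. With the horizon T fixed, m is about T / \<open>h n\<close>, so m / n is
  about T / (n * \<open>h n\<close>).\<close>

lemma dividend_nonneg: "0 \<le> dividend \<theta> x t"
  by (simp add: dividend_def)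

lemma dividend_nonpos_time: "t \<le> 0 \<Longrightarrow> dividend \<theta> x t = 0"
  by (simp add: dividend_def)

lemma dividend_mono:
  assumes bdd: "\<And>t. bdd_above (x ` {0..<t})" and "s \<le> t"
  shows "dividend \<theta> x s \<le> dividend \<theta> x t"
proof (cases "s \<le> 0")
  case True
  then show ?thesis by (simp add: dividend_nonpos_time dividend_nonneg)
next
  case False
  then have "(SUP v\<in>{0..<s}. x v) \<le> (SUP v\<in>{0..<t}. x v)"
    using assms by (intro cSUP_subset_mono) auto
  then show ?thesis using False assms(2) by (auto simp: dividend_def)
qed

text \<open>A time q < v at which the path nearly attains its supremum lies in
  \<open>{0..<s}\<close> for every s > q. This left continuity is what gives an interval open at
  \<open>v\<close> the mass \<open>dividend \<theta> x v\<close>.\<close>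

lemma dividend_left_approx:
  assumes bdd: "\<And>t. bdd_above (x ` {0..<t})" and e: "0 < e"
  obtains w where "w < v" "\<And>s. w < s \<Longrightarrow> s \<le> v \<Longrightarrow> dividend \<theta> x v - e < dividend \<theta> x s"
proof (cases "v \<le> 0")
  case True
  then show ?thesis using e that[of "v - 1"] by (simp add: dividend_nonpos_time)
next
  case False
  have "(SUP s\<in>{0..<v}. x s) - e < (SUP s\<in>{0..<v}. x s)" using e by simp
  then obtain q where q: "q \<in> {0..<v}" "(SUP s\<in>{0..<v}. x s) - e < x q"
    using False by (subst (asm) less_cSUP_iff[OF _ bdd]) auto
  show ?thesis
  proof (rule that[of q])
    fix s assume s: "q < s" "s \<le> v"
    then have "x q \<le> (SUP v\<in>{0..<s}. x v)"
      using q by (intro cSUP_upper[OF _ bdd]) auto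
    then show "dividend \<theta> x v - e < dividend \<theta> x s"
      using q s False e by (auto simp: dividend_def)
  qed (use q in auto)
qed

section \<open>Right-continuous version and Stieltjes measure of a monotone function\<close>

context
  fixes f :: "real \<Rightarrow> real"
  assumes mono_f: "\<And>s t. s \<le> t \<Longrightarrow> f s \<le> f t"
begin

lemma mono_tendsto_at_right: "(f \<longlongrightarrow> (INF s\<in>{t<..}. f s)) (at_right t)"
proof (rule decreasing_tendsto)
  have bdd: "bdd_below (f ` {t<..})" using mono_f by (intro bdd_belowI[of _ "f t"]) auto
  show "\<forall>\<^sub>F s in at_right t. (INF s\<in>{t<..}. f s) \<le> f s"
    unfolding eventually_at_right_field by (auto intro!: exI[of _ "t+1"] cINF_lower bdd)
  fix e assume "(INF s\<in>{t<..}. f s) < e"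
  then obtain s where s: "s > t" "f s < e" by (subst (asm) cINF_less_iff[OF _ bdd]) auto
  then show "\<forall>\<^sub>F s in at_right t. f s < e"
    unfolding eventually_at_right_field using mono_f by (meson le_less_trans less_imp_le)
qed

lemma Lim_at_right_mono: "Lim (at_right t) f = (INF s\<in>{t<..}. f s)"
  by (rule tendsto_Lim) (simp_all add: mono_tendsto_at_right)

lemma Lim_at_right_lower: "f t \<le> Lim (at_right t) f"
  unfolding Lim_at_right_mono by (rule cINF_greatest) (auto intro: mono_f)

lemma Lim_at_right_upper: "t < s \<Longrightarrow> Lim (at_right t) f \<le> f s"
  unfolding Lim_at_right_mono
  by (rule cINF_lower) (auto intro!: bdd_belowI[of _ "f t"] mono_f)

lemma Lim_at_right_monotone: "s \<le> t \<Longrightarrow> Lim (at_right s) f \<le> Lim (at_right t) f"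
  by (cases "s = t") (auto intro: order_trans[OF Lim_at_right_upper Lim_at_right_lower])

lemma Lim_at_right_right_continuous: "continuous (at_right a) (\<lambda>t. Lim (at_right t) f)"
  unfolding continuous_within
proof (rule decreasing_tendsto)
  show "\<forall>\<^sub>F s in at_right a. Lim (at_right a) f \<le> Lim (at_right s) f"
    unfolding eventually_at_right_field by (auto intro!: exI[of _ "a+1"] Lim_at_right_monotone)
  fix e assume "Lim (at_right a) f < e"
  then obtain b where b: "b > a" "f b < e"
    unfolding Lim_at_right_mono
    by (subst (asm) cINF_less_iff) (auto intro!: bdd_belowI[of _ "f a"] mono_f)
  then show "\<forall>\<^sub>F s in at_right a. Lim (at_right s) f < e"
    unfolding eventually_at_right_field using Lim_at_right_upper by (meson le_less_trans)
qed

lemma sets_stieltjes_measure[simp, measurable_cong]: "sets (stieltjes_measure f) = sets borel"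
  by (simp add: stieltjes_measure_def)

lemma sigma_finite_stieltjes_measure: "sigma_finite_measure (stieltjes_measure f)"
  unfolding stieltjes_measure_def
  by (rule sigma_finite_interval_measure)
    (auto intro: Lim_at_right_monotone Lim_at_right_right_continuous)

lemma emeasure_stieltjes_measure_Ioc:
  "a \<le> b \<Longrightarrow> emeasure (stieltjes_measure f) {a<..b} = Lim (at_right b) f - Lim (at_right a) f"
  unfolding stieltjes_measure_def
  by (rule emeasure_interval_measure_Ioc)
    (auto intro: Lim_at_right_monotone Lim_at_right_right_continuous)

text \<open>Left continuity turns the limit of the right limits along \<open>w n\<close> into
  \<open>f v\<close>. The endpoint -1 stands for any negative time: the right limit is still 0
  there, so a lump at time 0 is counted.\<close>

lemma emeasure_stieltjes_measure_left_open:
  assumes left: "\<And>e. 0 < e \<Longrightarrow> \<exists>w<v. \<forall>s. w < s \<longrightarrow> s \<le> v \<longrightarrow> f v - e < f s"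
    and zero: "\<And>t. t \<le> 0 \<Longrightarrow> f t = 0" and v: "-1 < v"
  shows "emeasure (stieltjes_measure f) {-1<..<v} = f v"
proof -
  let ?\<mu> = "emeasure (stieltjes_measure f)"
  obtain w :: "nat \<Rightarrow> real" where w: "incseq w" "\<And>n. w n < v" "w \<longlonglongrightarrow> v"
    and w1: "\<And>n. -1 < w n"
  proof (rule that)
    show "incseq (\<lambda>n. v - (v + 1) / (real n + 2))"
      using v by (intro incseq_SucI diff_left_mono divide_left_mono) auto
    show "(\<lambda>n. v - (v + 1) / (real n + 2)) \<longlonglongrightarrow> v" by real_asymp
    show "v - (v + 1) / (real n + 2) < v" for n
      using v by (simp add: add_nonneg_pos)
    have "(v + 1) / (real n + 2) < v + 1" for n
      using v by (simp add: divide_less_eq_1_pos mult_less_cancel_left1 pos_divide_less_eq)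
    then show "-1 < v - (v + 1) / (real n + 2)" for n
      by (smt (verit))
  qed
  have un: "{-1<..<v} = (\<Union>n. {-1<..w n})"
  proof (intro set_eqI iffI)
    fix t assume t: "t \<in> {-1<..<v}"
    then have "\<forall>\<^sub>F n in sequentially. t < w n" using w(3) by (auto dest: order_tendstoD)
    then obtain n where "t < w n" by (auto simp: eventually_sequentially)
    then show "t \<in> (\<Union>n. {-1<..w n})" using t by (auto intro!: exI[of _ n])
  qed (use w(2) in \<open>auto intro: le_less_trans\<close>)
  have L1: "Lim (at_right (-1)) f = 0"
    using Lim_at_right_lower[of "-1"] Lim_at_right_upper[of "-1" 0] zero[of "-1"] zero[of 0] by simp
  have "(\<lambda>n. ?\<mu> {-1<..w n}) \<longlonglongrightarrow> ?\<mu> {-1<..<v}"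
    unfolding un
  proof (rule Lim_emeasure_incseq)
    show "incseq (\<lambda>n. {-1<..w n})"
      using incseqD[OF w(1)] by (intro incseq_SucI subsetI) (meson greaterThanAtMost_iff le_SucI order_refl order_trans)
  qed auto
  moreover have "(\<lambda>n. ?\<mu> {-1<..w n}) \<longlonglongrightarrow> ennreal (f v)"
  proof -
    have "(\<lambda>n. Lim (at_right (w n)) f) \<longlonglongrightarrow> f v"
    proof (rule increasing_tendsto)
      show "\<forall>\<^sub>F n in sequentially. Lim (at_right (w n)) f \<le> f v"
        using w(2) Lim_at_right_upper by auto
      fix y assume "y < f v"
      with left[of "f v - y"] obtain q where q: "q < v" "\<And>s. q < s \<Longrightarrow> s \<le> v \<Longrightarrow> y < f s" by auto
      have "\<forall>\<^sub>F n in sequentially. q < w n" using q w(3) by (auto dest: order_tendstoD)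
      then show "\<forall>\<^sub>F n in sequentially. y < Lim (at_right (w n)) f"
        by eventually_elim (meson w(2) q(2) Lim_at_right_lower less_imp_le less_le_trans)
    qed
    moreover have "?\<mu> {-1<..w n} = ennreal (Lim (at_right (w n)) f)" for n
      using w1[of n] by (simp add: emeasure_stieltjes_measure_Ioc L1)
    ultimately show ?thesis by (simp add: tendsto_ennrealI)
  qed
  ultimately show ?thesis by (rule LIMSEQ_unique)
qed

end

lemma emeasure_stieltjes_dividend:
  assumes bdd: "\<And>t. bdd_above (x ` {0..<t})"
  shows "emeasure (stieltjes_measure (dividend \<theta> x)) {0..<v} = dividend \<theta> x v"
proof (cases "v \<le> 0")
  case True
  then show ?thesis by (simp add: dividend_nonpos_time)
next
  case False
  let ?\<mu> = "emeasure (stieltjes_measure (dividend \<theta> x))"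
  note mono = dividend_mono[where x=x and \<theta>=\<theta>, OF bdd]
  have *: "?\<mu> {-1<..<v} = dividend \<theta> x v" if "0 \<le> v" for v
    using that
    by (intro emeasure_stieltjes_measure_left_open mono)
      (auto simp: dividend_nonpos_time intro: dividend_left_approx[where x=x and \<theta>=\<theta> and v=v, OF bdd])
  \<comment> \<open>Negative times carry no mass, while an atom at 0, the lump paid when the path
    starts above the barrier, stays in \<open>{0..<v}\<close>.\<close>
  have un: "{-1<..<v} = {-1<..<0} \<union> {0..<v}" using False by auto
  have "?\<mu> {-1<..<v}
      = ?\<mu> {-1<..<0} + ?\<mu> {0..<v}"
    unfolding un by (intro plus_emeasure[symmetric]) (auto simp: sets_stieltjes_measure[OF mono])
  then show ?thesis using *[of v] *[of 0] False by (simp add: dividend_nonpos_time)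
qed

section \<open>The law of an exponential killing time\<close>

abbreviation exp_measure :: "real \<Rightarrow> real measure" where
  "exp_measure r \<equiv> density lborel (exponential_density r)"

lemma emeasure_exp_measure_greaterThan:
  assumes "0 < r" "0 \<le> t"
  shows "emeasure (exp_measure r) {t<..} = exp (- r * t)"
proof -
  interpret E: prob_space "exp_measure r" using assms(1) by (rule prob_space_exponential_density)
  have "emeasure (exp_measure r) {..t} = ennreal (1 - exp (- t * r))"
    using assms emeasure_erlang_density[of r 0 t] by (simp add: erlang_CDF_0)
  then have "measure (exp_measure r) {..t} = 1 - exp (- t * r)"
    using assms by (simp add: measure_def)
  moreover have "{t<..} = space (exp_measure r) - {..t}" by auto
  ultimately have "measure (exp_measure r) {t<..} = exp (- t * r)"
    by (simp only: E.prob_compl sets_density sets_lborel atMost_borel)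
  then show ?thesis by (simp add: E.emeasure_eq_measure mult.commute)
qed

lemma AE_exp_measure_positive:
  assumes "0 < r" shows "AE s in exp_measure r. 0 < s"
  using assms AE_lborel_singleton[of 0]
  by (auto simp: AE_density exponential_density_def elim!: eventually_mono)

lemma AE_exp_measure_neq:
  assumes "0 < r" shows "AE s in exp_measure r. ereal s \<noteq> \<tau>"
proof (cases \<tau>)
  case (real t)
  then show ?thesis using AE_lborel_singleton[of t]
    by (auto simp: AE_density elim!: eventually_mono)
qed auto

lemma nn_integral_exp_indicator:
  assumes "0 < r" "0 \<le> t"
  shows "(\<integral>\<^sup>+s. indicator {t<..} s \<partial>exp_measure r) = exp (- r * t)"
  using emeasure_exp_measure_greaterThan[OF assms] by (subst nn_integral_indicator) auto

text \<open>For 0 \<le> \<tau> the minimum is a finite number even if \<tau> is infinite, so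
  \<open>real_of_ereal\<close> does not fall back on its default value.\<close>

definition stopped_dividend :: "real \<Rightarrow> (real \<Rightarrow> real) \<Rightarrow> ereal \<Rightarrow> real \<Rightarrow> real" where
  "stopped_dividend \<theta> x \<tau> s = dividend \<theta> x (real_of_ereal (min (ereal s) \<tau>))"

lemma borel_measurable_mono_real:
  fixes f :: "real \<Rightarrow> real" assumes "\<And>s t. s \<le> t \<Longrightarrow> f s \<le> f t" shows "f \<in> borel_measurable borel"
  using assms by (intro borel_measurable_mono) (auto simp: mono_def)

text \<open>Fubini with \<open>exp (- r t) = P (t < e)\<close> for an exponential time \<open>e\<close>.\<close>

lemma discounted_dividends_eq:
  assumes r: "0 < r" and bdd: "\<And>t. bdd_above (x ` {0..<t})" and \<tau>: "0 \<le> \<tau>"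
  shows "discounted_dividends r \<theta> x \<tau> =
    enn2real (\<integral>\<^sup>+s. ennreal (stopped_dividend \<theta> x \<tau> s) \<partial>exp_measure r)"
proof -
  define \<mu> where "\<mu> = stieltjes_measure (dividend \<theta> x)"
  \<comment> \<open>Slicing \<open>A\<close> at \<open>t\<close> gives the half-line
    \<open>{t<..}\<close>, whose exponential mass is the discount factor; slicing at
    \<open>s\<close> gives the half-open interval from 0 to the smaller of \<open>s\<close> and
    \<tau>, whose Stieltjes mass is the stopped dividend.\<close>
  define A where "A = {(t :: real, s). 0 \<le> t \<and> ereal t < \<tau> \<and> t < s}"
  note mono = dividend_mono[where x=x and \<theta>=\<theta>, OF bdd]
  have [measurable_cong, simp]: "sets \<mu> = sets borel" using mono by (simp add: \<mu>_def sets_stieltjes_measure)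
  interpret \<mu>: sigma_finite_measure \<mu> unfolding \<mu>_def by (rule sigma_finite_stieltjes_measure) (rule mono)
  interpret E: prob_space "exp_measure r" using r by (rule prob_space_exponential_density)
  interpret P: pair_sigma_finite \<mu> "exp_measure r" ..
  have "discounted_dividends r \<theta> x \<tau> =
      (LINT t|\<mu>. indicator {0..} t * (indicator {t. ereal t < \<tau>} t * exp (- r * t)))"
    by (simp add: discounted_dividends_def set_lebesgue_integral_def \<mu>_def)
  also have "\<dots> = enn2real (\<integral>\<^sup>+t. ennreal (indicator {0..} t * (indicator {t. ereal t < \<tau>} t * exp (- r * t))) \<partial>\<mu>)"
    by (rule integral_eq_nn_integral) (auto)
  also have "(\<integral>\<^sup>+t. ennreal (indicator {0..} t * (indicator {t. ereal t < \<tau>} t * exp (- r * t))) \<partial>\<mu>)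
     = (\<integral>\<^sup>+t. (\<integral>\<^sup>+s. indicator A (t,s) \<partial>exp_measure r) \<partial>\<mu>)"
  proof (rule nn_integral_cong)
    fix t
    show "ennreal (indicator {0..} t * (indicator {t. ereal t < \<tau>} t * exp (- r * t)))
      = (\<integral>\<^sup>+s. indicator A (t,s) \<partial>exp_measure r)"
    proof (cases "0 \<le> t \<and> ereal t < \<tau>")
      case True
      then have "(\<integral>\<^sup>+s. indicator A (t,s) \<partial>exp_measure r) =
        (\<integral>\<^sup>+s. indicator {t<..} s \<partial>exp_measure r)"
        by (intro nn_integral_cong) (auto simp: indicator_def A_def)
      then show ?thesis using True nn_integral_exp_indicator[OF r, of t] by simp
    next
      case False
      then have "(\<integral>\<^sup>+s. indicator A (t,s) \<partial>exp_measure r) = (\<integral>\<^sup>+s. 0 \<partial>exp_measure r)"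
        by (intro nn_integral_cong) (auto simp: indicator_def A_def)
      then show ?thesis using False by auto
    qed
  qed
  also have "\<dots> = (\<integral>\<^sup>+s. (\<integral>\<^sup>+t. indicator A (t,s) \<partial>\<mu>) \<partial>exp_measure r)"
  proof (rule P.Fubini'[symmetric])
    have [measurable]: "Measurable.pred borel (\<lambda>t::real. ereal t < \<tau>)" by measurable
    have "{z \<in> space (borel \<Otimes>\<^sub>M borel :: (real \<times> real) measure). 0 \<le> fst z \<and> ereal (fst z) < \<tau> \<and> fst z < snd z}
        \<in> sets (borel \<Otimes>\<^sub>M borel)"
      by measurable
    moreover have "sets (\<mu> \<Otimes>\<^sub>M exp_measure r) = sets (borel \<Otimes>\<^sub>M borel)"
      by (intro sets_pair_measure_cong) auto
    moreover have "{z \<in> space (borel \<Otimes>\<^sub>M borel :: (real \<times> real) measure). 0 \<le> fst z \<and> ereal (fst z) < \<tau> \<and> fst z < snd z}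
      = A"
      by (auto simp: space_pair_measure A_def)
    ultimately show "(\<lambda>(t, s). indicator A (t,s) :: ennreal) \<in> borel_measurable (\<mu> \<Otimes>\<^sub>M exp_measure r)"
      unfolding case_prod_eta by (intro borel_measurable_indicator) simp
  qed
  also have "\<dots> = (\<integral>\<^sup>+s. ennreal (stopped_dividend \<theta> x \<tau> s) \<partial>exp_measure r)"
  proof (rule nn_integral_cong)
    fix s
    define v where "v = real_of_ereal (min (ereal s) \<tau>)"
    have v: "ereal v = min (ereal s) \<tau>" 
      unfolding v_def using \<tau> by (cases \<tau>) (auto simp: min_def)
    have "(\<integral>\<^sup>+t. indicator A (t,s) \<partial>\<mu>) = (\<integral>\<^sup>+t. indicator {0..<v} t \<partial>\<mu>)"
    proof (rule nn_integral_cong)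
      fix t
      have "t < v \<longleftrightarrow> ereal t < \<tau> \<and> t < s" unfolding less_ereal.simps(1)[symmetric, of t v] v by auto
      then show "indicator A (t,s) = (indicator {0..<v} t :: ennreal)"
        by (auto simp: indicator_def A_def)
    qed
    also have "\<dots> = emeasure \<mu> {0..<v}" by (rule nn_integral_indicator) simp
    also have "\<dots> = ennreal (dividend \<theta> x v)" unfolding \<mu>_def by (rule emeasure_stieltjes_dividend[OF bdd])
    finally show "(\<integral>\<^sup>+t. indicator A (t,s) \<partial>\<mu>) = ennreal (stopped_dividend \<theta> x \<tau> s)"
      by (simp add: stopped_dividend_def v_def)
  qed
  finally show ?thesis .
qed

section \<open>Barrier strategies on a grid\<close>

primrec running_max :: "(nat \<Rightarrow> real) \<Rightarrow> nat \<Rightarrow> real" where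
  "running_max p 0 = p 0"
| "running_max p (Suc k) = max (running_max p k) (p (Suc k))"

text \<open>The index shift mirrors the supremum over times strictly before t: the dividend at index
  k sees only the values up to k - 1.\<close>

definition grid_dividend :: "real \<Rightarrow> (nat \<Rightarrow> real) \<Rightarrow> nat \<Rightarrow> real" where
  "grid_dividend \<theta> p k = (case k of 0 \<Rightarrow> 0 | Suc j \<Rightarrow> max (running_max p j - \<theta>) 0)"

text \<open>Index 0 is exempt because ruin is looked for at positive times only. Index k is exempt
  because the left-continuous dividend due at the ruin time itself is still paid.\<close>

definition solvent_before :: "real \<Rightarrow> (nat \<Rightarrow> real) \<Rightarrow> nat \<Rightarrow> bool" where
  "solvent_before \<theta> p k \<longleftrightarrow> (\<forall>i\<in>{1..<k}. grid_dividend \<theta> p i \<le> p i)"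

primrec grid_payout :: "real \<Rightarrow> (nat \<Rightarrow> real) \<Rightarrow> nat \<Rightarrow> real" where
  "grid_payout \<theta> p 0 = 0"
| "grid_payout \<theta> p (Suc k) =
     (if solvent_before \<theta> p (Suc k) then grid_dividend \<theta> p (Suc k) else grid_payout \<theta> p k)"

lemma running_max_ge: "j \<le> k \<Longrightarrow> p j \<le> running_max p k"
  by (induction k) (auto simp: le_Suc_eq le_max_iff_disj)

lemma running_max_le: "(\<And>j. j \<le> k \<Longrightarrow> p j \<le> b) \<Longrightarrow> running_max p k \<le> b"
  by (induction k) auto

lemma running_max_mono: "j \<le> k \<Longrightarrow> running_max p j \<le> running_max p k"
  by (induction k) (auto simp: le_Suc_eq le_max_iff_disj)

lemma running_max_cong: "(\<And>j. j \<le> k \<Longrightarrow> p j = q j) \<Longrightarrow> running_max p k = running_max q k"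
  by (induction k) auto

lemma grid_dividend_0[simp]: "grid_dividend \<theta> p 0 = 0"
  and grid_dividend_Suc: "grid_dividend \<theta> p (Suc k) = max (running_max p k - \<theta>) 0"
  by (simp_all add: grid_dividend_def)

lemma grid_dividend_nonneg: "0 \<le> grid_dividend \<theta> p k"
  by (cases k) (auto simp: grid_dividend_Suc)

lemma grid_dividend_mono: "j \<le> k \<Longrightarrow> grid_dividend \<theta> p j \<le> grid_dividend \<theta> p k"
  using running_max_mono[of "j - 1" "k - 1" p]
  by (cases j; cases k) (auto simp: grid_dividend_Suc)

lemma grid_dividend_cong: "(\<And>j. j < k \<Longrightarrow> p j = q j) \<Longrightarrow> grid_dividend \<theta> p k = grid_dividend \<theta> q k"
  by (cases k) (auto simp: grid_dividend_Suc less_Suc_eq_le cong: running_max_cong)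

lemma grid_dividend_antimono_barrier: "a \<le> b \<Longrightarrow> grid_dividend b p k \<le> grid_dividend a p k"
  by (cases k) (auto simp: grid_dividend_Suc)

lemma grid_dividend_barrier_diff: "a \<le> b \<Longrightarrow> grid_dividend a p k \<le> grid_dividend b p k + (b - a)"
  by (cases k) (auto simp: grid_dividend_Suc)

lemma grid_payout_le: "grid_payout \<theta> p k \<le> grid_dividend \<theta> p k"
proof (induction k)
  case (Suc k)
  then show ?case using grid_dividend_mono[of k "Suc k" \<theta> p] by simp
qed simp

lemma grid_payout_nonneg: "0 \<le> grid_payout \<theta> p k"
  by (induction k) (auto simp: grid_dividend_nonneg)

lemma solvent_before_antimono: "solvent_before \<theta> p k \<Longrightarrow> j \<le> k \<Longrightarrow> solvent_before \<theta> p j"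
  by (auto simp: solvent_before_def)

lemma grid_payout_ge:
  "solvent_before \<theta> p j \<Longrightarrow> j \<le> k \<Longrightarrow> grid_dividend \<theta> p j \<le> grid_payout \<theta> p k"
  by (induction k) (auto simp: le_Suc_eq intro: order_trans grid_dividend_mono)

lemma grid_payout_eq:
  "solvent_before \<theta> p k \<Longrightarrow> grid_payout \<theta> p k = grid_dividend \<theta> p k"
  by (intro antisym grid_payout_le grid_payout_ge) auto

text \<open>The index \<open>j\<close> need not be the first one with a negative surplus: an earlier
  one would have frozen the payout already.\<close>

lemma grid_payout_after_ruin:
  "p j < grid_dividend \<theta> p j \<Longrightarrow> 1 \<le> j \<Longrightarrow> j \<le> k \<Longrightarrow> grid_payout \<theta> p k = grid_payout \<theta> p j"
proof (induction k)
  case (Suc k)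
  then have "j \<noteq> Suc k \<Longrightarrow> \<not> solvent_before \<theta> p (Suc k)"
    by (auto simp: solvent_before_def not_le intro!: bexI[of _ j])
  then show ?case using Suc by (cases "j = Suc k") auto
qed simp

lemma grid_payout_mono: "j \<le> k \<Longrightarrow> grid_payout \<theta> p j \<le> grid_payout \<theta> p k"
proof (induction k)
  case (Suc k)
  have "grid_payout \<theta> p k \<le> grid_payout \<theta> p (Suc k)"
    using grid_payout_le[of \<theta> p k] grid_dividend_mono[of k "Suc k" \<theta> p] by auto
  then show ?case using Suc by (auto simp: le_Suc_eq simp del: grid_payout.simps)
qed simp

text \<open>Predictability of the strategy. It makes the functional stopped after m steps a function
  of the first m increments, hence a kernel of order m.\<close>

lemma grid_payout_cong:
  "(\<And>j. j < k \<Longrightarrow> p j = q j) \<Longrightarrow> grid_payout \<theta> p k = grid_payout \<theta> q k"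
proof (induction k)
  case (Suc k)
  have "grid_dividend \<theta> p i = grid_dividend \<theta> q i" if "i \<le> Suc k" for i
    using Suc.prems that by (intro grid_dividend_cong) auto
  then show ?case using Suc by (auto simp: solvent_before_def)
qed simp

text \<open>Raising the barrier delays ruin, and lowers the dividends paid up to any time by at most the
  increase of the barrier; hence \<open>\<theta>\<close> plus the dividends is monotone in \<open>\<theta>\<close>.\<close>

lemma grid_payout_barrier_diff:
  assumes "a \<le> b"
  shows "grid_payout a p k \<le> grid_payout b p k + (b - a)"
proof (induction k)
  case (Suc k)
  show ?case
  proof (cases "solvent_before a p (Suc k)")
    case True
    then have "solvent_before b p (Suc k)"
      using grid_dividend_antimono_barrier[OF assms, of p] by (auto simp: solvent_before_def intro: order_trans)
    then show ?thesis using True grid_dividend_barrier_diff[OF assms] by simp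
  next
    \<comment> \<open>Once barrier a has led to ruin, its payout is frozen, while that of barrier b
      can only grow.\<close>
    case False
    then show ?thesis
      using Suc grid_payout_mono[of k "Suc k" b p] by (simp del: grid_payout.simps(2) add: grid_payout.simps(2)[of a])
  qed
qed (use assms in simp)

text \<open>Rounding up fits the left-continuous dividend: the dividend of a step path at time s is
  \<open>grid_dividend\<close> at this index.\<close>

definition grid_index :: "real \<Rightarrow> real \<Rightarrow> nat" where
  "grid_index \<delta> s = nat \<lceil>s / \<delta>\<rceil>"

lemma grid_index_le_iff:
  "0 < \<delta> \<Longrightarrow> grid_index \<delta> s \<le> k \<longleftrightarrow> s \<le> real k * \<delta>"
  by (simp add: grid_index_def nat_le_iff ceiling_le_iff pos_divide_le_eq)

lemma grid_index_grid[simp]: "0 < \<delta> \<Longrightarrow> grid_index \<delta> (real k * \<delta>) = k"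
  by (simp add: grid_index_def)

lemma grid_index_measurable[measurable]: "grid_index \<delta> \<in> borel \<rightarrow>\<^sub>M count_space UNIV"
  unfolding grid_index_def by measurable

lemma le_nat_floor_iff:
  "0 < \<delta> \<Longrightarrow> 0 \<le> s \<Longrightarrow> k \<le> nat \<lfloor>s / \<delta>\<rfloor> \<longleftrightarrow> real k * \<delta> \<le> s"
  by (simp add: le_nat_iff le_floor_iff pos_le_divide_eq)

text \<open>As an integral against a probability measure it inherits monotonicity, linearity and the
  value of constants. The familiar sum of discounted payments is its Abel-summed form
  \<open>discounted_eq_sum\<close>.\<close>

definition discounted :: "real \<Rightarrow> real \<Rightarrow> nat \<Rightarrow> (nat \<Rightarrow> real) \<Rightarrow> real" where
  "discounted r \<delta> n f = (LINT s|exp_measure r. f (min n (grid_index \<delta> s)))"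

context
  fixes r \<delta> :: real
  assumes r: "0 < r" and \<delta>: "0 < \<delta>"
begin

interpretation E: prob_space "exp_measure r" using r by (rule prob_space_exponential_density)

lemma discounted_integrable: "integrable (exp_measure r) (\<lambda>s. f (min n (grid_index \<delta> s)) :: real)"
proof (rule E.integrable_const_bound)
  show "AE s in exp_measure r. norm (f (min n (grid_index \<delta> s))) \<le> (\<Sum>k\<le>n. norm (f k))"
    by (intro AE_I2 member_le_sum[of _ _ "\<lambda>k. norm (f k)"]) auto
qed measurable

lemma discounted_mono: "(\<And>k. k \<le> n \<Longrightarrow> f k \<le> g k) \<Longrightarrow> discounted r \<delta> n f \<le> discounted r \<delta> n g"
  unfolding discounted_def by (intro integral_mono discounted_integrable) auto

lemma discounted_const[simp]: "discounted r \<delta> n (\<lambda>_. a) = a"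
  using E.prob_space by (simp add: discounted_def)

lemma discounted_nonneg: "(\<And>k. k \<le> n \<Longrightarrow> 0 \<le> f k) \<Longrightarrow> 0 \<le> discounted r \<delta> n f"
  using discounted_mono[of n "\<lambda>_. 0" f] by simp

lemma discounted_add: "discounted r \<delta> n (\<lambda>k. f k + g k) = discounted r \<delta> n f + discounted r \<delta> n g"
  unfolding discounted_def by (intro Bochner_Integration.integral_add discounted_integrable)

lemma discounted_cmult: "discounted r \<delta> n (\<lambda>k. a * f k) = a * discounted r \<delta> n f"
  unfolding discounted_def by simp

lemma measure_exp_greaterThan: "0 \<le> t \<Longrightarrow> measure (exp_measure r) {t<..} = exp (- r * t)"
  using emeasure_exp_measure_greaterThan[OF r, of t] by (simp add: measure_def)

text \<open>Allowing one more step changes the integrand only if the killing time exceeds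
  \<open>n * \<delta>\<close>, which has probability exp (- r n \<delta>). The finite sum makes
  measurability in the path and exchange with expectations elementary.\<close>

lemma discounted_eq_sum:
  "discounted r \<delta> n f = f 0 + (\<Sum>k<n. exp (- r * (real k * \<delta>)) * (f (Suc k) - f k))"
proof (induction n)
  case 0
  then show ?case using E.prob_space by (simp add: discounted_def)
next
  case (Suc n)
  have eq: "f (min (Suc n) (grid_index \<delta> s)) = f (min n (grid_index \<delta> s)) + indicator {real n * \<delta><..} s * (f (Suc n) - f n)" for s
    using grid_index_le_iff[OF \<delta>, of s n]
    by (cases "grid_index \<delta> s \<le> n") (auto simp: min.absorb1 min.absorb2)
  have "discounted r \<delta> (Suc n) f = discounted r \<delta> n f + (LINT s|exp_measure r. indicator {real n * \<delta><..} s * (f (Suc n) - f n))"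
    unfolding discounted_def eq
    by (intro Bochner_Integration.integral_add discounted_integrable integrable_mult_left integrable_real_indicator)
      (auto simp: E.emeasure_eq_measure)
  also have "(LINT s|exp_measure r. indicator {real n * \<delta><..} s * (f (Suc n) - f n)) = exp (- r * (real n * \<delta>)) * (f (Suc n) - f n)"
    using \<delta> by (simp add: measure_exp_greaterThan)
  finally show ?case using Suc by simp
qed

text \<open>The two integrands agree unless the killing time exceeds \<open>m * \<delta>\<close>,
  and there they differ by at most \<open>K\<close>.\<close>

lemma discounted_truncate:
  assumes "m \<le> n" and f: "\<And>k. 0 \<le> f k" "\<And>k. f k \<le> K"
  shows "\<bar>discounted r \<delta> n f - discounted r \<delta> m f\<bar> \<le> K * exp (- r * (real m * \<delta>))"
proof -
  have "\<bar>discounted r \<delta> n f - discounted r \<delta> m f\<bar>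
      = \<bar>LINT s|exp_measure r. f (min n (grid_index \<delta> s)) - f (min m (grid_index \<delta> s))\<bar>"
    unfolding discounted_def by (simp add: discounted_integrable)
  also have "\<dots> \<le> (LINT s|exp_measure r. \<bar>f (min n (grid_index \<delta> s)) - f (min m (grid_index \<delta> s))\<bar>)"
    by (rule integral_abs_bound)
  also have "\<dots> \<le> (LINT s|exp_measure r. indicator {real m * \<delta><..} s * K)"
  proof (rule integral_mono)
    fix s
    have [simp]: "\<bar>f i - f j\<bar> \<le> K" for i j using f(1)[of i] f(2)[of i] f(1)[of j] f(2)[of j] by (simp add: abs_le_iff)
    then show "\<bar>f (min n (grid_index \<delta> s)) - f (min m (grid_index \<delta> s))\<bar> \<le> indicator {real m * \<delta><..} s * K"
    proof (cases "s \<le> real m * \<delta>")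
      case True
      then have "grid_index \<delta> s \<le> m" by (simp only: grid_index_le_iff[OF \<delta>])
      then show ?thesis using True \<open>m \<le> n\<close> by (simp add: min.absorb2)
    qed simp
  qed (auto intro!: discounted_integrable integrable_mult_left integrable_real_indicator simp: E.emeasure_eq_measure)
  also have "\<dots> = K * exp (- r * (real m * \<delta>))"
    using \<delta> by (simp add: measure_exp_greaterThan)
  finally show ?thesis .
qed

end

section \<open>Quasi-process paths\<close>

definition walk :: "real \<Rightarrow> (nat \<Rightarrow> real) \<Rightarrow> nat \<Rightarrow> real" where
  "walk u d k = u + (\<Sum>j=1..k. d j)"

lemma quasi_process_eq_walk:
  assumes \<delta>: "0 < \<delta>" and t: "0 \<le> t"
  shows "quasi_process u n \<delta> x i t =
    walk u (\<lambda>j. x (real (i j) * \<delta>) - x (real (i j - 1) * \<delta>)) (min n (nat \<lfloor>t / \<delta>\<rfloor>))"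
proof -
  have "(\<Sum>k=1..n. (x (real (i k) * \<delta>) - x (real (i k - 1) * \<delta>)) * indicator {real k * \<delta>..} t) =
    (\<Sum>k\<in>{k\<in>{1..n}. k \<le> nat \<lfloor>t / \<delta>\<rfloor>}. x (real (i k) * \<delta>) - x (real (i k - 1) * \<delta>))"
    unfolding le_nat_floor_iff[OF \<delta> t]
    by (simp add: indicator_def if_distrib sum.If_cases Int_def cong: if_cong)
  moreover have "{k\<in>{1..n}. k \<le> nat \<lfloor>t / \<delta>\<rfloor>} = {1..min n (nat \<lfloor>t / \<delta>\<rfloor>)}" by auto
  ultimately show ?thesis by (simp add: quasi_process_def walk_def)
qed

section \<open>Step paths and their grid values\<close>

context
  fixes \<delta> :: real and n :: nat and p :: "nat \<Rightarrow> real" and z :: "real \<Rightarrow> real" and \<theta> :: real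
  assumes \<delta>: "0 < \<delta>" and z: "\<And>t. 0 \<le> t \<Longrightarrow> z t = p (min n (nat \<lfloor>t / \<delta>\<rfloor>))"
    and \<theta>: "0 \<le> \<theta>" and p0: "0 \<le> p 0"
begin

lemma step_path_bdd_above: "bdd_above (z ` {0..<t})"
proof (rule bdd_above_mono[OF bdd_above_finite])
  show "finite (p ` {..n})" by simp
  show "z ` {0..<t} \<subseteq> p ` {..n}" using z by auto
qed

text \<open>The cap is \<open>Suc n\<close>, not \<open>n\<close>: immediately after the last grid
  time the supremum also sees \<open>p n\<close>.\<close>

lemma step_path_dividend:
  assumes t: "0 < t"
  shows "dividend \<theta> z t = grid_dividend \<theta> p (min (Suc n) (grid_index \<delta> t))"
proof -
  define k where "k = min n (grid_index \<delta> t - 1)"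
  have c: "1 \<le> grid_index \<delta> t" using grid_index_le_iff[OF \<delta>, of t 0] t by linarith
  then have k: "min (Suc n) (grid_index \<delta> t) = Suc k" unfolding k_def by simp
  have "(SUP s\<in>{0..<t}. z s) = running_max p k"
  proof (rule antisym)
    show "(SUP s\<in>{0..<t}. z s) \<le> running_max p k"
    proof (rule cSUP_least)
      fix s assume s: "s \<in> {0..<t}"
      have "real (nat \<lfloor>s / \<delta>\<rfloor>) * \<delta> < t" using le_nat_floor_iff[OF \<delta>, of s "nat \<lfloor>s / \<delta>\<rfloor>"] s by simp
      then have "nat \<lfloor>s / \<delta>\<rfloor> < grid_index \<delta> t" using grid_index_le_iff[OF \<delta>, of t "nat \<lfloor>s / \<delta>\<rfloor>"] by linarith
      then show "z s \<le> running_max p k" using s z by (auto simp: k_def intro!: running_max_ge)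
    qed (use t in auto)
    show "running_max p k \<le> (SUP s\<in>{0..<t}. z s)"
    proof (rule running_max_le)
      fix j assume j: "j \<le> k"
      then have "real j * \<delta> < t"
        using grid_index_le_iff[OF \<delta>, of t j] c unfolding k_def by linarith
      moreover have "z (real j * \<delta>) = p j" using z[of "real j * \<delta>"] \<delta> j by (simp add: k_def)
      ultimately show "p j \<le> (SUP s\<in>{0..<t}. z s)"
        using \<delta> by (metis step_path_bdd_above atLeastLessThan_iff cSUP_upper less_imp_le mult_nonneg_nonneg of_nat_0_le_iff)
    qed
  qed
  then show ?thesis using t k by (simp add: dividend_def grid_dividend_Suc)
qed

lemma step_path_surplus_grid:
  "1 \<le> k \<Longrightarrow> k \<le> n \<Longrightarrow> surplus \<theta> z (real k * \<delta>) = p k - grid_dividend \<theta> p k"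
  using \<delta> z[of "real k * \<delta>"] step_path_dividend[of "real k * \<delta>"] by (simp add: surplus_def)

text \<open>Right after grid time j the dividend also sees \<open>p j\<close>, but a payment
  triggered by \<open>p j\<close> itself would leave the surplus \<theta>, which is nonnegative. So
  a ruin off the grid was already visible at the preceding grid time; for j = 0 it is excluded by
  \<open>0 \<le> p 0\<close>.\<close>

lemma step_path_ruin_grid:
  assumes t: "0 < t" "t \<le> real n * \<delta>" and ruin: "surplus \<theta> z t < 0"
  obtains k where "1 \<le> k" "k \<le> n" "real k * \<delta> \<le> t" "p k < grid_dividend \<theta> p k"
proof -
  define j where "j = nat \<lfloor>t / \<delta>\<rfloor>"
  have j: "real j * \<delta> \<le> t" using le_nat_floor_iff[OF \<delta>, of t j] t by (simp add: j_def)
  have j2: "t < real (Suc j) * \<delta>" using le_nat_floor_iff[OF \<delta>, of t "Suc j"] t by (simp add: j_def)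
  have "real j * \<delta> \<le> real n * \<delta>" using j t by linarith
  then have jn: "j \<le> n" using \<delta> by simp
  have zt: "z t = p j" using z[of t] t jn by (simp add: j_def)
  show ?thesis
  proof (cases "t = real j * \<delta>")
    case True
    then have "1 \<le> j" using t \<delta> by (cases j) auto
    then show ?thesis using that[of j] ruin True jn step_path_surplus_grid[of j] by auto
  next
    case False
    then have "grid_index \<delta> t = Suc j"
      using grid_index_le_iff[OF \<delta>, of t j] grid_index_le_iff[OF \<delta>, of t "Suc j"] j j2 by linarith
    then have *: "p j < grid_dividend \<theta> p (Suc j)"
      using ruin step_path_dividend[OF t(1)] jn by (simp add: surplus_def zt)
    then obtain i where i: "j = Suc i" using p0 \<theta> by (cases j) (auto simp: grid_dividend_Suc)
    have "p j < grid_dividend \<theta> p j" using * \<theta> by (auto simp: i grid_dividend_Suc)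
    then show ?thesis using that[of j] i j jn by simp
  qed
qed

text \<open>With ruin reduced to grid times, the dividend stopped at an independent time s is the
  payout at the rounded index. The convention that sets the ruin time to the terminal time is what
  caps this index at \<open>n\<close>.\<close>

lemma h_quasi_step_path:
  assumes r: "0 < r"
  shows "h_quasi (real n * \<delta>) r \<theta> z = discounted r \<delta> n (grid_payout \<theta> p)"
proof -
  interpret E: prob_space "exp_measure r" using r by (rule prob_space_exponential_density)
  let ?R = "{t. 0 < t \<and> surplus \<theta> z t < 0}"
  define \<tau> where "\<tau> = ruin_time_upto (real n * \<delta>) \<theta> z"
  have *: "0 \<le> \<tau> \<and> (\<forall>s>0. stopped_dividend \<theta> z \<tau> s = grid_payout \<theta> p (min n (grid_index \<delta> s)))"
  proof (cases "\<exists>t. 0 < t \<and> t \<le> real n * \<delta> \<and> surplus \<theta> z t < 0")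
    case True
    then obtain t where t: "0 < t" "t \<le> real n * \<delta>" "surplus \<theta> z t < 0" by auto
    define P where "P k \<longleftrightarrow> 1 \<le> k \<and> p k < grid_dividend \<theta> p k" for k
    define \<kappa> where "\<kappa> = Least P"
    from t obtain k where k: "P k" "k \<le> n" unfolding P_def by (rule step_path_ruin_grid) auto
    have \<kappa>: "P \<kappa>" "\<kappa> \<le> n" "\<And>j. P j \<Longrightarrow> \<kappa> \<le> j"
      using k LeastI[of P k] Least_le[of P k] Least_le[of P] unfolding \<kappa>_def by (blast intro: order_trans)+
    then have solv: "solvent_before \<theta> p \<kappa>" by (force simp: solvent_before_def P_def)
    have "\<tau> = ereal (real \<kappa> * \<delta>)"
    proof -
      have "\<tau> = (INF t\<in>?R. ereal t)"
        using True by (simp add: \<tau>_def ruin_time_upto_def ruin_time_def)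
      also have "\<dots> = ereal (real \<kappa> * \<delta>)"
      proof (rule antisym)
        show "(INF t\<in>?R. ereal t) \<le> ereal (real \<kappa> * \<delta>)"
          using \<kappa> \<delta> step_path_surplus_grid[of \<kappa>] by (intro INF_lower) (auto simp: P_def)
        show "ereal (real \<kappa> * \<delta>) \<le> (INF t\<in>?R. ereal t)"
        proof (rule INF_greatest)
          fix t assume t: "t \<in> ?R"
          show "ereal (real \<kappa> * \<delta>) \<le> ereal t"
          proof (cases "t \<le> real n * \<delta>")
            case True
            with t obtain k where "P k" "real k * \<delta> \<le> t"
              unfolding P_def by (auto elim: step_path_ruin_grid)
            moreover have "real \<kappa> * \<delta> \<le> real k * \<delta>" using \<kappa>(3)[OF \<open>P k\<close>] \<delta> by simp
            ultimately show ?thesis by simp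
          next
            \<comment> \<open>The infimum runs over all times; those beyond the last grid time lie
              above \<open>real \<kappa> * \<delta>\<close> because \<kappa> \<le> n.\<close>
            case False
            have "real \<kappa> * \<delta> \<le> real n * \<delta>" using \<kappa>(2) \<delta> by simp
            then show ?thesis using False by simp
          qed
        qed
      qed
      finally show ?thesis .
    qed
    moreover have "stopped_dividend \<theta> z (ereal (real \<kappa> * \<delta>)) s = grid_payout \<theta> p (min n (grid_index \<delta> s))"
      if s: "0 < s" for s
    proof (cases "s \<le> real \<kappa> * \<delta>")
      case True
      then have "grid_index \<delta> s \<le> \<kappa>" by (simp add: grid_index_le_iff[OF \<delta>])
      then show ?thesis using True s \<kappa>(2) step_path_dividend[OF s]
          grid_payout_eq[OF solvent_before_antimono[OF solv]]
        by (simp add: stopped_dividend_def min.absorb2)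
    next
      case False
      then have "\<not> grid_index \<delta> s \<le> \<kappa>" by (simp add: grid_index_le_iff[OF \<delta>])
      then have "grid_payout \<theta> p (min n (grid_index \<delta> s)) = grid_dividend \<theta> p \<kappa>"
        using \<kappa>(1,2) grid_payout_after_ruin[of p \<kappa> \<theta>] grid_payout_eq[OF solv]
        by (simp add: P_def min_def)
      moreover have "dividend \<theta> z (real \<kappa> * \<delta>) = grid_dividend \<theta> p \<kappa>"
        using step_path_dividend[of "real \<kappa> * \<delta>"] \<kappa>(1,2) \<delta> by (simp add: P_def)
      ultimately show ?thesis using False by (simp add: stopped_dividend_def min_def)
    qed
    ultimately show ?thesis using \<delta> by simp
  next
    case False
    then have \<tau>: "\<tau> = ereal (real n * \<delta>)" unfolding \<tau>_def ruin_time_upto_def by (rule if_not_P)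
    have "solvent_before \<theta> p (Suc n)"
    proof (unfold solvent_before_def, rule ballI)
      fix i assume i: "i \<in> {1..<Suc n}"
      then have "0 < real i * \<delta>" "real i * \<delta> \<le> real n * \<delta>" using \<delta> by auto
      then have "\<not> surplus \<theta> z (real i * \<delta>) < 0" using False by blast
      then show "grid_dividend \<theta> p i \<le> p i" using step_path_surplus_grid[of i] i by auto
    qed
    then have eq: "grid_payout \<theta> p k = grid_dividend \<theta> p k" if "k \<le> n" for k
      using that by (intro grid_payout_eq) (auto intro: solvent_before_antimono)
    have "stopped_dividend \<theta> z \<tau> s = grid_payout \<theta> p (min n (grid_index \<delta> s))" if s: "0 < s" for s
    proof (cases "s \<le> real n * \<delta>")
      case True
      then have "grid_index \<delta> s \<le> n" by (simp add: grid_index_le_iff[OF \<delta>])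
      then show ?thesis using True step_path_dividend[OF s] by (simp add: eq \<tau> stopped_dividend_def min_def)
    next
      case False
      then have "n \<le> grid_index \<delta> s" using grid_index_le_iff[OF \<delta>, of s n] by linarith
      moreover have "dividend \<theta> z (real n * \<delta>) = grid_dividend \<theta> p n"
        using step_path_dividend[of "real n * \<delta>"] \<delta>
        by (cases "n = 0") (simp_all add: dividend_nonpos_time)
      ultimately show ?thesis using False by (simp add: eq \<tau> stopped_dividend_def min_def)
    qed
    then show ?thesis using \<tau> \<delta> by simp
  qed
  have "h_quasi (real n * \<delta>) r \<theta> z = enn2real (\<integral>\<^sup>+s. ennreal (stopped_dividend \<theta> z \<tau> s) \<partial>exp_measure r)"
    unfolding h_quasi_def \<tau>_def[symmetric] using * by (intro discounted_dividends_eq r step_path_bdd_above) auto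
  also have "(\<integral>\<^sup>+s. ennreal (stopped_dividend \<theta> z \<tau> s) \<partial>exp_measure r) =
      (\<integral>\<^sup>+s. ennreal (grid_payout \<theta> p (min n (grid_index \<delta> s))) \<partial>exp_measure r)"
    using AE_exp_measure_positive[OF r] * by (intro nn_integral_cong_AE) auto
  also have "enn2real \<dots> = discounted r \<delta> n (grid_payout \<theta> p)"
    unfolding discounted_def
    by (intro integral_eq_nn_integral[symmetric] borel_measurable_integrable discounted_integrable[OF r \<delta>])
      (auto simp: grid_payout_nonneg)
  finally show ?thesis .
qed

end

lemma h_quasi_quasi_process:
  assumes "0 < \<delta>" "0 < r" "0 \<le> \<theta>" "0 \<le> u"
  shows "h_quasi (real n * \<delta>) r \<theta> (quasi_process u n \<delta> x i) =
    discounted r \<delta> n (grid_payout \<theta> (walk u (\<lambda>j. x (real (i j) * \<delta>) - x (real (i j - 1) * \<delta>))))"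
  using assms by (intro h_quasi_step_path quasi_process_eq_walk) (auto simp: walk_def)

section \<open>Convergence of the discretised strategies along a path\<close>

lemma grid_index_lower: "0 < \<delta> \<Longrightarrow> s \<le> real (grid_index \<delta> s) * \<delta>"
  using grid_index_le_iff[of \<delta> s "grid_index \<delta> s"] by simp

lemma grid_index_upper: "0 < \<delta> \<Longrightarrow> 0 \<le> s \<Longrightarrow> real (grid_index \<delta> s) * \<delta> < s + \<delta>"
  using grid_index_le_iff[of \<delta> s "grid_index \<delta> s - 1"]
  by (cases "grid_index \<delta> s") (auto simp: algebra_simps)

lemma ruin_time_nonneg: "0 \<le> ruin_time \<theta> x"
  unfolding ruin_time_def by (rule INF_greatest) auto

lemma not_ruined_before: "0 < t \<Longrightarrow> ereal t < ruin_time \<theta> x \<Longrightarrow> dividend \<theta> x t \<le> x t"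
  unfolding ruin_time_def using INF_lower[of t "{t. 0 < t \<and> surplus \<theta> x t < 0}" ereal]
  by (force simp: surplus_def not_le[symmetric])

section \<open>Paths without upward jumps, sampled on refining grids\<close>

context
  fixes x :: "real \<Rightarrow> real" and \<theta> :: real
  assumes right_continuous: "\<And>t. 0 \<le> t \<Longrightarrow> (x \<longlongrightarrow> x t) (at_right t)"
    and bdd: "\<And>t. bdd_above (x ` {0..<t})"
    and no_up_jump: "\<And>t. 0 < t \<Longrightarrow> x t \<le> (SUP s\<in>{0..<t}. x s)"
    and \<theta>_pos: "0 < \<theta>"
begin

lemma right_continuousE:
  assumes "0 \<le> t" "0 < e"
  obtains d where "0 < d" "\<And>s. t \<le> s \<Longrightarrow> s < t + d \<Longrightarrow> \<bar>x s - x t\<bar> < e"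
proof -
  from tendstoD[OF right_continuous[OF assms(1)] assms(2)]
  obtain b where b: "t < b" "\<And>s. t < s \<Longrightarrow> s < b \<Longrightarrow> \<bar>x s - x t\<bar> < e"
    unfolding eventually_at_right_field dist_real_def by blast
  show ?thesis
  proof (rule that[of "b - t"])
    fix s assume "t \<le> s" "s < t + (b - t)"
    then show "\<bar>x s - x t\<bar> < e" using b assms(2) by (cases "s = t") auto
  qed (use b in simp)
qed

text \<open>Absence of upward jumps makes the running supremum continuous, so a ruin slightly after
  \<open>\<tau>\<close> happens before additional dividends are paid.\<close>

lemma ruin_soon_after:
  assumes \<tau>: "ruin_time \<theta> x = ereal \<tau>" and e: "0 < e" and s: "\<tau> < s"
  obtains v where "0 < v" "\<tau> \<le> v" "v < s" "x v < dividend \<theta> x v" "dividend \<theta> x v \<le> dividend \<theta> x \<tau> + e"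
proof -
  have \<tau>0: "0 \<le> \<tau>" using ruin_time_nonneg[of \<theta> x] \<tau> by simp
  \<comment> \<open>The bound \<theta> / 2 serves the case of ruin at time 0, the bound e the size
    of the extra dividend.\<close>
  define e' where "e' = min e (\<theta> / 2)"
  have e': "0 < e'" "e' \<le> e" "e' \<le> \<theta> / 2" using e \<theta>_pos by (auto simp: e'_def)
  obtain d where d: "0 < d" "\<And>t. \<tau> \<le> t \<Longrightarrow> t < \<tau> + d \<Longrightarrow> \<bar>x t - x \<tau>\<bar> < e'"
    using right_continuousE[OF \<tau>0 e'(1)] by blast
  define b where "b = min s (\<tau> + d)"
  have "(INF t\<in>{t. 0 < t \<and> surplus \<theta> x t < 0}. ereal t) < ereal b"
    using \<tau> s d by (simp add: ruin_time_def b_def)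
  then obtain v where v: "0 < v" "surplus \<theta> x v < 0" "v < b"
    by (auto simp: INF_less_iff)
  then have "v < s" "v < \<tau> + d" by (simp_all add: b_def)
  note v = v(1,2) this
  then have "ruin_time \<theta> x \<le> ereal v" unfolding ruin_time_def by (intro INF_lower) auto
  then have \<tau>v: "\<tau> \<le> v" by (simp add: \<tau>)
  have xv: "x v < dividend \<theta> x v" using v by (simp add: surplus_def)
  have sup: "(SUP t\<in>{0..<v}. x t) \<le> y + e'"
    if y: "\<And>t. 0 \<le> t \<Longrightarrow> t \<le> \<tau> \<Longrightarrow> x t \<le> y" for y
  proof (rule cSUP_least)
    fix t assume t: "t \<in> {0..<v}"
    show "x t \<le> y + e'"
    proof (cases "t \<le> \<tau>")
      case True
      then show ?thesis using y[of t] t e' by simp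
    next
      case False
      then show ?thesis using d(2)[of t] t v y[of \<tau>] \<tau>0 by (simp add: abs_less_iff)
    qed
  qed (use v in auto)
  have "dividend \<theta> x v \<le> dividend \<theta> x \<tau> + e"
  proof (cases "\<tau> = 0")
    case False
    then have "0 < \<tau>" using \<tau>0 by simp
    have "(SUP t\<in>{0..<v}. x t) \<le> (SUP t\<in>{0..<\<tau>}. x t) + e'"
    proof (rule sup)
      fix t assume "0 \<le> t" "t \<le> \<tau>"
      then show "x t \<le> (SUP t\<in>{0..<\<tau>}. x t)"
        using no_up_jump[OF \<open>0 < \<tau>\<close>] cSUP_upper[OF _ bdd, of t \<tau>] by (cases "t = \<tau>") auto
    qed
    then show ?thesis using \<open>0 < \<tau>\<close> v(1) e' by (auto simp: dividend_def)
  next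
    case True
    have sup0: "(SUP t\<in>{0..<v}. x t) \<le> x 0 + e'"
    proof (rule sup)
      fix t assume "0 \<le> t" "t \<le> \<tau>"
      then show "x t \<le> x 0" using True by simp
    qed
    have x0: "x 0 - e' < x v" using d(2)[of v] True v by (simp add: abs_less_iff)
    \<comment> \<open>Ruin at time 0 is impossible from a start above the barrier: the lump payment
      leaves a surplus near \<theta>, and with \<open>e' \<le> \<theta> / 2\<close> the path cannot
      fall below 0 before time \<open>v\<close>.\<close>
    have "x 0 \<le> \<theta>"
    proof (rule ccontr)
      assume "\<not> x 0 \<le> \<theta>"
      then have "dividend \<theta> x v \<le> x 0 + e' - \<theta>" using sup0 v(1) e' by (auto simp: dividend_def)
      then show False using xv x0 e' by (simp add: field_simps)
    qed
    then show ?thesis using sup0 e' v(1) e True by (auto simp: dividend_def)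
  qed
  then show ?thesis using that v \<tau>v xv by blast
qed

context
  fixes \<delta> :: "nat \<Rightarrow> real"
  assumes \<delta>_pos: "\<forall>\<^sub>F n in sequentially. 0 < \<delta> n" and \<delta>_0: "\<delta> \<longlonglongrightarrow> 0"
begin

private abbreviation "sampled n \<equiv> \<lambda>k. x (real k * \<delta> n)"

lemma eventually_mesh: "0 < d \<Longrightarrow> \<forall>\<^sub>F n in sequentially. 0 < \<delta> n \<and> \<delta> n < d"
  using \<delta>_pos order_tendstoD(2)[OF \<delta>_0] by (auto intro: eventually_conj)

text \<open>The rounded times approach \<open>v\<close> from the right, so right continuity suffices
  and jumps at \<open>v\<close> do no harm.\<close>

lemma grid_value_tendsto:
  assumes v: "0 \<le> v"
  shows "(\<lambda>n. x (real (grid_index (\<delta> n) v) * \<delta> n)) \<longlonglongrightarrow> x v"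
proof (rule tendstoI)
  fix e :: real assume "0 < e"
  with v obtain d where d: "0 < d" "\<And>s. v \<le> s \<Longrightarrow> s < v + d \<Longrightarrow> \<bar>x s - x v\<bar> < e"
    by (rule right_continuousE) blast
  from eventually_mesh[OF d(1)]
  show "\<forall>\<^sub>F n in sequentially. dist (x (real (grid_index (\<delta> n) v) * \<delta> n)) (x v) < e"
  proof eventually_elim
    case (elim n)
    then show ?case
      using grid_index_lower[of "\<delta> n" v] grid_index_upper[of "\<delta> n" v] v
      by (auto simp: dist_real_def intro!: d(2))
  qed
qed

lemma grid_dividend_le_dividend:
  assumes "0 < d" "0 < v" "\<And>i. i < k \<Longrightarrow> real i * d < v"
  shows "grid_dividend \<theta> (\<lambda>k. x (real k * d)) k \<le> dividend \<theta> x v"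
proof (cases k)
  case (Suc j)
  have "running_max (\<lambda>k. x (real k * d)) j \<le> (SUP t\<in>{0..<v}. x t)"
    using assms Suc by (intro running_max_le cSUP_upper bdd) auto
  then show ?thesis using assms by (auto simp: Suc grid_dividend_Suc dividend_def)
qed (simp add: dividend_nonneg)

lemma grid_dividend_le_dividend_index:
  "0 < d \<Longrightarrow> 0 < v \<Longrightarrow> grid_dividend \<theta> (\<lambda>k. x (real k * d)) (grid_index d v) \<le> dividend \<theta> x v"
  using grid_index_le_iff[of d v] by (intro grid_dividend_le_dividend) (auto simp: not_le[symmetric])

text \<open>The grid takes its maximum over fewer times, so it never overstates the dividend.
  Conversely a nearly maximal time q < v is followed by a grid time before \<open>v\<close> at which
  the value is almost the same.\<close>

lemma grid_dividend_tendsto: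
  assumes v: "0 < v"
  shows "(\<lambda>n. grid_dividend \<theta> (sampled n) (grid_index (\<delta> n) v)) \<longlonglongrightarrow> dividend \<theta> x v"
proof (rule increasing_tendsto)
  show "\<forall>\<^sub>F n in sequentially. grid_dividend \<theta> (sampled n) (grid_index (\<delta> n) v) \<le> dividend \<theta> x v"
    using \<delta>_pos by eventually_elim (rule grid_dividend_le_dividend_index[OF _ v])
  fix y assume y: "y < dividend \<theta> x v"
  show "\<forall>\<^sub>F n in sequentially. y < grid_dividend \<theta> (sampled n) (grid_index (\<delta> n) v)"
  proof (cases "y < 0")
    case True
    then show ?thesis by (simp add: less_le_trans[OF _ grid_dividend_nonneg])
  next
    case False
    then have "y + \<theta> < (SUP s\<in>{0..<v}. x s)" using y v by (auto simp: dividend_def split: if_splits)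
    then obtain q where q: "0 \<le> q" "q < v" "y + \<theta> < x q"
      using v by (subst (asm) less_cSUP_iff[OF _ bdd]) auto
    have "\<forall>\<^sub>F n in sequentially. y + \<theta> < sampled n (grid_index (\<delta> n) q)"
      using order_tendstoD(1)[OF grid_value_tendsto[OF q(1)] q(3)] .
    moreover have "\<forall>\<^sub>F n in sequentially. 0 < \<delta> n \<and> \<delta> n < v - q"
      using eventually_mesh[of "v - q"] q by simp
    ultimately show ?thesis
    proof eventually_elim
      case (elim n)
      define j where "j = grid_index (\<delta> n) q"
      have "real j * \<delta> n < v" using grid_index_upper[of "\<delta> n" q] q elim by (auto simp: j_def)
      then have "j < grid_index (\<delta> n) v" using grid_index_le_iff[of "\<delta> n" v j] elim by auto
      then obtain i where i: "grid_index (\<delta> n) v = Suc i" "j \<le> i" by (cases "grid_index (\<delta> n) v") auto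
      have "y + \<theta> < running_max (sampled n) i"
        using elim(1) running_max_ge[OF i(2), of "sampled n"] by (simp add: j_def)
      then show ?case by (simp add: i grid_dividend_Suc)
    qed
  qed
qed

lemma grid_payout_tendsto:
  assumes horizon: "filterlim (\<lambda>n. real n * \<delta> n) at_top sequentially"
    and s: "0 < s" "ereal s \<noteq> ruin_time \<theta> x"
  shows "(\<lambda>n. grid_payout \<theta> (sampled n) (min n (grid_index (\<delta> n) s)))
    \<longlonglongrightarrow> stopped_dividend \<theta> x (ruin_time \<theta> x) s"
proof -
  define y where "y n = grid_payout \<theta> (sampled n) (min n (grid_index (\<delta> n) s))" for n
  define v where "v = real_of_ereal (min (ereal s) (ruin_time \<theta> x))"
  have v: "ereal v = min (ereal s) (ruin_time \<theta> x)" "0 \<le> v" "v \<le> s"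
    unfolding v_def using ruin_time_nonneg[of \<theta> x] s(1)
    by (cases "ruin_time \<theta> x"; auto simp: min_def)+
  have index_le: "\<forall>\<^sub>F n in sequentially. grid_index (\<delta> n) s \<le> n"
    using filterlim_at_top_dense[THEN iffD1, OF horizon, rule_format, of s] \<delta>_pos
    by eventually_elim (simp add: grid_index_le_iff)
  have y_eq: "\<forall>\<^sub>F n in sequentially. y n = grid_payout \<theta> (sampled n) (grid_index (\<delta> n) s)"
    using index_le by eventually_elim (simp add: y_def min.absorb2)
  have "y \<longlonglongrightarrow> dividend \<theta> x v"
  proof (rule order_tendstoI)
    fix a assume a: "a < dividend \<theta> x v"
    show "\<forall>\<^sub>F n in sequentially. a < y n"
    proof (cases "v = 0")
      case True
      then have "a < y n" for n
        using a grid_payout_nonneg unfolding y_def by (simp add: dividend_nonpos_time less_le_trans)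
      then show ?thesis by simp
    next
      case False
      then have "0 < v" using v by simp
      from order_tendstoD(1)[OF grid_dividend_tendsto[OF this] a] y_eq \<delta>_pos
      show ?thesis
      proof eventually_elim
        case (elim n)
        \<comment> \<open>Grid times before \<open>v\<close> precede the ruin of the path, where the
          path covers its own dividend and hence the smaller one computed on the grid.\<close>
        have "solvent_before \<theta> (sampled n) (grid_index (\<delta> n) v)"
        proof (unfold solvent_before_def, rule ballI)
          fix i assume i: "i \<in> {1..<grid_index (\<delta> n) v}"
          then have pos: "0 < real i * \<delta> n" using elim by simp
          have "real i * \<delta> n < v" using i grid_index_le_iff[of "\<delta> n" v i] elim by auto
          then have "ereal (real i * \<delta> n) < ruin_time \<theta> x"
            using v(1) by (metis less_ereal.simps(1) min_less_iff_conj)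
          then have "dividend \<theta> x (real i * \<delta> n) \<le> sampled n i" using not_ruined_before[OF pos] by simp
          moreover have "grid_dividend \<theta> (sampled n) i \<le> dividend \<theta> x (real i * \<delta> n)"
            using pos elim by (intro grid_dividend_le_dividend) auto
          ultimately show "grid_dividend \<theta> (sampled n) i \<le> sampled n i" by simp
        qed
        moreover have "grid_index (\<delta> n) v \<le> grid_index (\<delta> n) s"
          using grid_index_lower[of "\<delta> n" s] v(3) elim by (simp add: grid_index_le_iff)
        ultimately show ?case
          using grid_payout_ge[of \<theta> "sampled n"] elim(1) unfolding elim(2) by (meson less_le_trans)
      qed
    qed
  next
    fix a assume a: "dividend \<theta> x v < a"
    show "\<forall>\<^sub>F n in sequentially. y n < a"
    proof (cases "ereal s < ruin_time \<theta> x")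
      case True
      then have "v = s" using v(1) by (simp add: min_absorb1)
      with a have "\<forall>\<^sub>F n in sequentially.
          grid_dividend \<theta> (sampled n) (grid_index (\<delta> n) s) < a"
        by (intro order_tendstoD(2)[OF grid_dividend_tendsto[OF s(1)]]) simp
      with y_eq show ?thesis
        by eventually_elim (simp add: le_less_trans[OF grid_payout_le])
    next
      case False
      then have \<tau>: "ruin_time \<theta> x = ereal v" "v < s" using v(1) s(2)
        by (auto simp: min_def split: if_splits) (metis less_ereal.simps(1) not_less order_less_le)+
      define e where "e = (a - dividend \<theta> x v) / 2"
      have e: "0 < e" "dividend \<theta> x v + e < a" using a by (auto simp: e_def field_simps)
      obtain q where q: "0 < q" "v \<le> q" "q < s" "x q < dividend \<theta> x q" "dividend \<theta> x q \<le> dividend \<theta> x v + e"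
        using ruin_soon_after[OF \<tau>(1) e(1) \<tau>(2)] .
      \<comment> \<open>The surplus at \<open>q\<close> is strictly negative and is the limit of the
        grid surpluses, so eventually the grid sees ruin at the index of \<open>q\<close>. From
        there on the payout is frozen at no more than the dividend at \<open>q\<close>.\<close>
      have "(\<lambda>n. sampled n (grid_index (\<delta> n) q)
          - grid_dividend \<theta> (sampled n) (grid_index (\<delta> n) q)) \<longlonglongrightarrow> x q - dividend \<theta> x q"
        using q by (intro tendsto_diff grid_value_tendsto grid_dividend_tendsto) auto
      then have "\<forall>\<^sub>F n in sequentially. sampled n (grid_index (\<delta> n) q)
          - grid_dividend \<theta> (sampled n) (grid_index (\<delta> n) q) < 0"
        by (rule order_tendstoD(2)) (use q(4) in linarith)
      with y_eq \<delta>_pos show ?thesis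
      proof eventually_elim
        case (elim n)
        let ?k = "grid_index (\<delta> n) q"
        have le: "?k \<le> grid_index (\<delta> n) s"
          using grid_index_lower[of "\<delta> n" s] q(3) elim by (simp add: grid_index_le_iff)
        have "1 \<le> ?k" using grid_index_le_iff[of "\<delta> n" q 0] elim q(1) by simp
        then have "y n = grid_payout \<theta> (sampled n) ?k"
          unfolding elim(1) using elim(3) le by (intro grid_payout_after_ruin) auto
        also have "\<dots> \<le> grid_dividend \<theta> (sampled n) ?k" by (rule grid_payout_le)
        also have "\<dots> \<le> dividend \<theta> x q" using elim q(1) by (intro grid_dividend_le_dividend_index) auto
        finally show ?case using q(5) e(2) by simp
      qed
    qed
  qed
  then show ?thesis unfolding y_def v_def stopped_dividend_def .
qed

end

end

section \<open>Averages over permutations of independent increments\<close>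

text \<open>Each singleton \<open>{\<iota> j}\<close> serves as a block of the independent family,
  and injectivity makes the blocks disjoint.\<close>

lemma (in prob_space) indep_vars_select:
  assumes indep: "indep_vars (\<lambda>_. N) D J" and inj: "inj_on \<iota> J'" and sub: "\<iota> ` J' \<subseteq> J"
  shows "indep_vars (\<lambda>_. N) (\<lambda>k. D (\<iota> k)) J'"
proof -
  have "indep_vars (\<lambda>j. PiM {\<iota> j} (\<lambda>_. N)) (\<lambda>j \<omega>. restrict (\<lambda>i. D i \<omega>) {\<iota> j}) J'"
    using inj sub by (intro indep_vars_restrict[OF indep]) (auto simp: disjoint_family_on_def inj_on_def)
  from indep_vars_compose2[OF this, of "\<lambda>j f. f (\<iota> j)" "\<lambda>_. N"]
  show ?thesis by (simp cong: indep_vars_cong)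
qed

text \<open>Exchanges the first m indices with the m indices after c. It is an involution when the
  two blocks are disjoint, and for c = 0 it is the identity. Composed with a permutation it moves
  the arguments of a kernel of order m to another block.\<close>

definition block_swap :: "nat \<Rightarrow> nat \<Rightarrow> nat \<Rightarrow> nat" where
  "block_swap m c k =
     (if k \<in> {1..m} then k + c else if k \<in> {c + 1..c + m} then k - c else k)"

lemma block_swap_block_swap: "c = 0 \<or> m \<le> c \<Longrightarrow> block_swap m c (block_swap m c k) = k"
  by (auto simp: block_swap_def)

lemma block_swap_permutes:
  assumes "c = 0 \<or> m \<le> c" "c + m \<le> n"
  shows "block_swap m c permutes {1..n}"
proof (rule bij_imp_permutes)
  show "bij_betw (block_swap m c) {1..n} {1..n}"
    using assms by (intro bij_betw_byWitness[where f'="block_swap m c"])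
      (auto simp: block_swap_block_swap, auto simp: block_swap_def)
qed (use assms in \<open>auto simp: block_swap_def\<close>)

text \<open>In the language of U-statistics, \<open>G\<close> is a kernel of order \<open>m\<close>
  and \<iota> picks its arguments. The restriction to \<open>{1..m}\<close> places them in the
  product space.\<close>

definition apply_selected ::
    "(nat \<Rightarrow> 'a \<Rightarrow> real) \<Rightarrow> nat \<Rightarrow> ((nat \<Rightarrow> real) \<Rightarrow> real) \<Rightarrow> (nat \<Rightarrow> nat) \<Rightarrow> 'a \<Rightarrow> real" where
  "apply_selected D m G \<iota> \<omega> = G (\<lambda>k\<in>{1..m}. D (\<iota> k) \<omega>)"

context prob_space
begin

section \<open>Kernels of i.i.d. variables and Hoeffding's blocks\<close>

context
  fixes D :: "nat \<Rightarrow> 'a \<Rightarrow> real" and n m :: nat and \<mu> :: "real measure"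
  assumes indep_D: "indep_vars (\<lambda>_. borel) D {1..n}"
    and ident_D: "\<And>k. k \<in> {1..n} \<Longrightarrow> distr M borel (D k) = \<mu>"
    and m: "1 \<le> m" "m \<le> n"
begin

lemma D_measurable: "k \<in> {1..n} \<Longrightarrow> random_variable borel (D k)"
  using indep_D by (auto simp: indep_vars_def)

lemma selected_vector_measurable:
  "\<iota> ` {1..m} \<subseteq> {1..n} \<Longrightarrow> (\<lambda>\<omega>. \<lambda>k\<in>{1..m}. D (\<iota> k) \<omega>) \<in> M \<rightarrow>\<^sub>M PiM {1..m} (\<lambda>_. borel)"
  by (intro measurable_restrict D_measurable) (rule subsetD, assumption, rule imageI)

lemma distr_selected_vector:
  assumes "inj_on \<iota> {1..m}" "\<iota> ` {1..m} \<subseteq> {1..n}"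
  shows "distr M (PiM {1..m} (\<lambda>_. borel)) (\<lambda>\<omega>. \<lambda>k\<in>{1..m}. D (\<iota> k) \<omega>) = PiM {1..m} (\<lambda>_. \<mu>)"
proof -
  have "indep_vars (\<lambda>_. borel) (\<lambda>k. D (\<iota> k)) {1..m}"
    by (rule indep_vars_select[OF indep_D assms])
  then have "distr M (PiM {1..m} (\<lambda>_. borel)) (\<lambda>\<omega>. \<lambda>k\<in>{1..m}. D (\<iota> k) \<omega>)
      = PiM {1..m} (\<lambda>k. distr M borel (D (\<iota> k)))"
    using m assms(2) by (subst (asm) indep_vars_iff_distr_eq_PiM') (simp, rule D_measurable, blast)
  also have "\<dots> = PiM {1..m} (\<lambda>_. \<mu>)"
    using assms(2) by (intro PiM_cong refl ident_D) blast
  finally show ?thesis .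
qed

text \<open>Any m distinct variables have the same product law. Through this lemma a permuted walk
  has the same mean functional as the unpermuted one.\<close>

lemma integral_selected_cong:
  fixes G :: "(nat \<Rightarrow> real) \<Rightarrow> real"
  assumes \<iota>: "inj_on \<iota> {1..m}" "\<iota> ` {1..m} \<subseteq> {1..n}" and \<kappa>: "inj_on \<kappa> {1..m}" "\<kappa> ` {1..m} \<subseteq> {1..n}"
    and G: "G \<in> borel_measurable (PiM {1..m} (\<lambda>_. borel))"
  shows "expectation (apply_selected D m G \<iota>) = expectation (apply_selected D m G \<kappa>)"
    and "integrable M (apply_selected D m G \<iota>) \<longleftrightarrow> integrable M (apply_selected D m G \<kappa>)"
proof -
  have "expectation (apply_selected D m G \<iota>) = integral\<^sup>L (PiM {1..m} (\<lambda>_. \<mu>)) G \<and>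
      (integrable M (apply_selected D m G \<iota>) \<longleftrightarrow> integrable (PiM {1..m} (\<lambda>_. \<mu>)) G)"
    if "inj_on \<iota> {1..m}" "\<iota> ` {1..m} \<subseteq> {1..n}" for \<iota>
    unfolding apply_selected_def[abs_def] distr_selected_vector[OF that, symmetric]
    using selected_vector_measurable[OF that(2)] G
    by (simp add: integral_distr integrable_distr_eq)
  from this[OF \<iota>] this[OF \<kappa>]
  show "expectation (apply_selected D m G \<iota>) = expectation (apply_selected D m G \<kappa>)"
    and "integrable M (apply_selected D m G \<iota>) \<longleftrightarrow> integrable M (apply_selected D m G \<kappa>)"
    by simp_all
qed

context
  fixes G :: "(nat \<Rightarrow> real) \<Rightarrow> real" and K :: real
  assumes G_meas: "G \<in> borel_measurable (PiM {1..m} (\<lambda>_. borel))"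
    and G_nonneg: "\<And>d. 0 \<le> G d" and G_le: "\<And>d. G d \<le> K"
begin

private abbreviation selected :: "(nat \<Rightarrow> nat) \<Rightarrow> 'a \<Rightarrow> real" where
  "selected \<equiv> apply_selected D m G"

lemma selected_measurable: "\<iota> ` {1..m} \<subseteq> {1..n} \<Longrightarrow> selected \<iota> \<in> borel_measurable M"
  unfolding apply_selected_def by (rule measurable_compose[OF selected_vector_measurable G_meas])

lemma selected_bounded: "\<bar>selected \<iota> \<omega>\<bar> \<le> K"
  using G_nonneg G_le by (simp add: apply_selected_def)

lemma selected_integrable: "\<iota> ` {1..m} \<subseteq> {1..n} \<Longrightarrow> integrable M (selected \<iota>)"
  by (rule integrable_const_bound[where B=K]) (auto simp: selected_bounded selected_measurable)

lemma indep_selected: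
  assumes "\<iota> ` {1..m} \<subseteq> {1..n}" "\<kappa> ` {1..m} \<subseteq> {1..n}" "\<iota> ` {1..m} \<inter> \<kappa> ` {1..m} = {}"
  shows "indep_var borel (selected \<iota>) borel (selected \<kappa>)"
proof -
  have meas: "(\<lambda>f. G (\<lambda>k\<in>{1..m}. f (\<iota> k))) \<in> borel_measurable (PiM (\<iota> ` {1..m}) (\<lambda>_. borel))" for \<iota> :: "nat \<Rightarrow> nat"
    by (rule measurable_compose[OF _ G_meas]) (intro measurable_restrict measurable_component_singleton, auto)
  have *: "G (\<lambda>k\<in>{1..m}. (restrict (\<lambda>i. D i \<omega>) (\<iota> ` {1..m})) (\<iota> k)) = selected \<iota> \<omega>" for \<iota> \<omega>
    unfolding apply_selected_def by (intro arg_cong[of _ _ G]) (auto simp: fun_eq_iff)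
  from indep_var_compose[OF indep_var_restrict[OF indep_D assms(3) assms(1,2)] meas[of \<iota>] meas[of \<kappa>]]
  show ?thesis by (simp only: comp_def *)
qed

text \<open>Hoeffding's argument for U-statistics: the average over all permutations is an average of
  averages over \<open>L\<close> disjoint, hence independent, blocks.\<close>

lemma variance_permutation_average:
  assumes L: "1 \<le> L" "L * m \<le> n"
  shows "expectation (\<lambda>\<omega>. ((\<Sum>\<pi>\<in>perms n. selected \<pi> \<omega>) / fact n - expectation (selected id))\<^sup>2) \<le> K\<^sup>2 / L"
proof -
  define g where "g = expectation (selected id)"
  define shift where "shift b = block_swap m (b * m)" for b
  have bm: "b * m + m \<le> n" if "b < L" for b
  proof -
    have "Suc b * m \<le> L * m" using that by (intro mult_le_mono1) simp
    then show ?thesis using L(2) by simp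
  qed
  have disj: "b * m = 0 \<or> m \<le> b * m" for b by (cases b) auto
  have shift_perm: "shift b permutes {1..n}" if "b < L" for b
    unfolding shift_def by (rule block_swap_permutes[OF disj bm[OF that]])
  have comp: "(\<pi> \<circ> shift b) ` {1..m} \<subseteq> {1..n}" "inj_on (\<pi> \<circ> shift b) {1..m}"
    if "\<pi> \<in> perms n" "b < L" for \<pi> b
  proof -
    have "(\<pi> \<circ> shift b) permutes {1..n}"
      using that shift_perm by (auto simp: perms_def intro: permutes_compose)
    moreover have "(\<pi> \<circ> shift b) ` {1..m} \<subseteq> (\<pi> \<circ> shift b) ` {1..n}" using m(2) by (intro image_mono) auto
    ultimately show "(\<pi> \<circ> shift b) ` {1..m} \<subseteq> {1..n}" "inj_on (\<pi> \<circ> shift b) {1..m}"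
      by (simp_all only: permutes_image) (auto dest: permutes_inj intro: inj_on_subset)
  qed
  have id: "id ` {1..m} \<subseteq> {1..n}" "inj_on id {1..m}" using m by auto
  define Z where "Z \<pi> b \<omega> = selected (\<pi> \<circ> shift b) \<omega> - g" for \<pi> b \<omega>
  have g_bounds: "0 \<le> g" "g \<le> K"
  proof -
    show "0 \<le> g" unfolding g_def apply_selected_def using G_nonneg by simp
    have "g \<le> expectation (\<lambda>_. K)" unfolding g_def
      by (intro integral_mono selected_integrable id) (auto simp: apply_selected_def G_le)
    then show "g \<le> K" using prob_space by simp
  qed
  have Z_le: "\<bar>Z \<pi> b \<omega>\<bar> \<le> K" for \<pi> b \<omega>
    using g_bounds G_nonneg[of "\<lambda>k\<in>{1..m}. D ((\<pi> \<circ> shift b) k) \<omega>"]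
      G_le[of "\<lambda>k\<in>{1..m}. D ((\<pi> \<circ> shift b) k) \<omega>"] by (simp add: Z_def apply_selected_def abs_le_iff)
  have Z_int: "integrable M (Z \<pi> b)" and Z_mean: "expectation (Z \<pi> b) = 0" if "\<pi> \<in> perms n" "b < L" for \<pi> b
    using selected_integrable[OF comp(1)[OF that]] integral_selected_cong(1)[OF comp(2,1)[OF that] id(2,1) G_meas] prob_space
    by (simp_all add: Z_def[abs_def] g_def)
  have ZZ_le: "\<bar>Z \<pi> b \<omega> * Z \<pi>' b' \<omega>\<bar> \<le> K * K" for \<pi> b \<pi>' b' \<omega>
    unfolding abs_mult using g_bounds by (intro mult_mono Z_le) auto
  have ZZ_int: "integrable M (\<lambda>\<omega>. Z \<pi> b \<omega> * Z \<pi>' b' \<omega>)"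
    if "\<pi> \<in> perms n" "b < L" "\<pi>' \<in> perms n" "b' < L" for \<pi> b \<pi>' b'
  proof (rule integrable_const_bound[where B="K * K"])
    show "AE \<omega> in M. norm (Z \<pi> b \<omega> * Z \<pi>' b' \<omega>) \<le> K * K"
      using ZZ_le by simp
    show "(\<lambda>\<omega>. Z \<pi> b \<omega> * Z \<pi>' b' \<omega>) \<in> borel_measurable M"
      using Z_int that by (intro borel_measurable_times borel_measurable_integrable)
  qed
  have cov: "expectation (\<lambda>\<omega>. Z \<pi> b \<omega> * Z \<pi> b' \<omega>) \<le> (if b = b' then K\<^sup>2 else 0)"
    if "\<pi> \<in> perms n" "b < L" "b' < L" for \<pi> b b'
  proof (cases "b = b'")
    case True
    have "expectation (\<lambda>\<omega>. Z \<pi> b \<omega> * Z \<pi> b' \<omega>) \<le> expectation (\<lambda>_. K * K)"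
      using that by (intro integral_mono ZZ_int abs_le_D1[OF ZZ_le]) auto
    then show ?thesis using True prob_space by (simp add: power2_eq_square)
  next
    case False
    \<comment> \<open>The first m indices are sent into the block between \<open>b * m\<close> and
      \<open>Suc b * m\<close>; distinct blocks are disjoint, and an injective \<pi> keeps their
      images disjoint.\<close>
    have sh: "shift b ` {1..m} \<inter> shift b' ` {1..m} = {}"
    proof -
      have block: "shift b ` {1..m} \<subseteq> {b * m<..Suc b * m}" for b
        by (auto simp: shift_def block_swap_def)
      have "{b * m<..Suc b * m} \<inter> {b' * m<..Suc b' * m} = {}" if "b < b'" for b b'
        using mult_le_mono1[of "Suc b" b' m] that by auto
      from this[of b b'] this[of b' b] show ?thesis
        using False block[of b] block[of b'] by (metis Int_commute Int_mono neq_iff subset_empty)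
    qed
    have "(\<pi> \<circ> shift b) ` {1..m} \<inter> (\<pi> \<circ> shift b') ` {1..m} = {}"
      using sh permutes_inj[of \<pi> "{1..n}"] that(1) unfolding image_comp[symmetric]
      by (simp add: perms_def image_Int[symmetric])
    from indep_selected[OF comp(1)[OF that(1,2)] comp(1)[OF that(1,3)] this]
    have "indep_var borel (Z \<pi> b) borel (Z \<pi> b')"
      unfolding Z_def[abs_def] using indep_var_compose[of borel _ borel _ "\<lambda>x. x - g" borel "\<lambda>x. x - g" borel]
      by (simp add: comp_def)
    then show ?thesis
      using False that by (simp add: indep_var_lebesgue_integral Z_int Z_mean)
  qed
  have card: "finite (perms n)" "card (perms n) = fact n"
    unfolding perms_def by (auto simp: finite_permutations card_permutations)
  \<comment> \<open>Composition with a block swap merely reorders the set of permutations, so all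
    blocks have the same sum over it and averaging over the blocks changes nothing.\<close>
  have avg: "(\<Sum>\<pi>\<in>perms n. selected \<pi> \<omega>) / fact n - g = (\<Sum>\<pi>\<in>perms n. (\<Sum>b<L. Z \<pi> b \<omega>) / L) / fact n" for \<omega>
  proof -
    have "(\<Sum>\<pi>\<in>perms n. selected (\<pi> \<circ> shift b) \<omega>) = (\<Sum>\<pi>\<in>perms n. selected \<pi> \<omega>)" if "b < L" for b
      unfolding perms_def by (rule sum_permutations_compose_right[OF shift_perm[OF that], symmetric])
    then have "(\<Sum>b<L. \<Sum>\<pi>\<in>perms n. Z \<pi> b \<omega>) = (\<Sum>b<L. (\<Sum>\<pi>\<in>perms n. selected \<pi> \<omega>) - fact n * g)"
      by (intro sum.cong) (auto simp: Z_def sum_subtractf card)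
    also have "\<dots> = L * ((\<Sum>\<pi>\<in>perms n. selected \<pi> \<omega>) - fact n * g)" by simp
    finally show ?thesis
      using L(1) by (subst (asm) sum.swap) (simp add: sum_divide_distrib[symmetric] diff_divide_distrib)
  qed
  have "((\<Sum>\<pi>\<in>perms n. selected \<pi> \<omega>) / fact n - g)\<^sup>2
      \<le> (\<Sum>\<pi>\<in>perms n. (\<Sum>b<L. \<Sum>b'<L. Z \<pi> b \<omega> * Z \<pi> b' \<omega>) / L\<^sup>2) / fact n" for \<omega>
  proof -
    \<comment> \<open>Convexity of the square brings the average over permutations outside. What
      remains is one fixed \<pi>, for which the blocks are independent.\<close>
    have "(\<Sum>\<pi>\<in>perms n. (\<Sum>b<L. Z \<pi> b \<omega>) / L)\<^sup>2 \<le> (\<Sum>\<pi>\<in>perms n. ((\<Sum>b<L. Z \<pi> b \<omega>) / L)\<^sup>2) * card (perms n)"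
      by (rule sum_squared_le_sum_of_squares)
    then have "(\<Sum>\<pi>\<in>perms n. (\<Sum>b<L. Z \<pi> b \<omega>) / L)\<^sup>2 / (fact n)\<^sup>2
        \<le> (\<Sum>\<pi>\<in>perms n. ((\<Sum>b<L. Z \<pi> b \<omega>) / L)\<^sup>2) * fact n / (fact n)\<^sup>2"
      unfolding card by (intro divide_right_mono) auto
    then show ?thesis
      unfolding avg by (simp add: power_divide power2_eq_square sum_product)
  qed
  then have "expectation (\<lambda>\<omega>. ((\<Sum>\<pi>\<in>perms n. selected \<pi> \<omega>) / fact n - g)\<^sup>2)
      \<le> expectation (\<lambda>\<omega>. (\<Sum>\<pi>\<in>perms n. (\<Sum>b<L. \<Sum>b'<L. Z \<pi> b \<omega> * Z \<pi> b' \<omega>) / L\<^sup>2) / fact n)"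
    by (intro integral_mono' Bochner_Integration.integrable_divide Bochner_Integration.integrable_sum ZZ_int)
      (auto intro: order_trans[OF zero_le_power2])
  also have "\<dots> = (\<Sum>\<pi>\<in>perms n. (\<Sum>b<L. \<Sum>b'<L. expectation (\<lambda>\<omega>. Z \<pi> b \<omega> * Z \<pi> b' \<omega>)) / L\<^sup>2) / fact n"
  proof -
    have "expectation (\<lambda>\<omega>. \<Sum>b<L. \<Sum>b'<L. Z \<pi> b \<omega> * Z \<pi> b' \<omega>) = (\<Sum>b<L. \<Sum>b'<L. expectation (\<lambda>\<omega>. Z \<pi> b \<omega> * Z \<pi> b' \<omega>))"
      if "\<pi> \<in> perms n" for \<pi>
    proof (subst Bochner_Integration.integral_sum)
      show "integrable M (\<lambda>\<omega>. \<Sum>b'<L. Z \<pi> b \<omega> * Z \<pi> b' \<omega>)" if "b \<in> {..<L}" for b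
        using that \<open>\<pi> \<in> perms n\<close> by (intro Bochner_Integration.integrable_sum ZZ_int) auto
      show "(\<Sum>b<L. expectation (\<lambda>\<omega>. \<Sum>b'<L. Z \<pi> b \<omega> * Z \<pi> b' \<omega>))
          = (\<Sum>b<L. \<Sum>b'<L. expectation (\<lambda>\<omega>. Z \<pi> b \<omega> * Z \<pi> b' \<omega>))"
        using that by (intro sum.cong refl Bochner_Integration.integral_sum ZZ_int) auto
    qed
    moreover have "integrable M (\<lambda>\<omega>. \<Sum>b<L. \<Sum>b'<L. Z \<pi> b \<omega> * Z \<pi> b' \<omega>)" if "\<pi> \<in> perms n" for \<pi>
      using that by (intro Bochner_Integration.integrable_sum ZZ_int) auto
    ultimately show ?thesis by (simp add: Bochner_Integration.integral_sum)
  qed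
  also have "\<dots> \<le> (\<Sum>\<pi>\<in>perms n. (\<Sum>b<L. \<Sum>b'<L. if b = b' then K\<^sup>2 else 0) / L\<^sup>2) / fact n"
    by (intro divide_right_mono sum_mono cov) auto
  \<comment> \<open>Only the L diagonal terms remain out of L^2.\<close>
  also have "\<dots> = K\<^sup>2 / L"
    using L(1) by (simp add: card power2_eq_square)
  finally show ?thesis unfolding g_def .
qed

end

end

end

section \<open>Sampling permutations independently of the path\<close>

lemma finite_perms: "finite (perms n)" and card_perms: "card (perms n) = fact n"
  unfolding perms_def by (auto simp: finite_permutations card_permutations)

abbreviation (in prob_space) path_algebra :: "(real \<Rightarrow> 'a \<Rightarrow> real) \<Rightarrow> 'a measure" where
  "path_algebra X \<equiv> vimage_algebra (space M) (path_of X) (Pi\<^sub>M {0..} (\<lambda>_. borel))"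

context prob_space
begin

lemma indep_var_of_indep_set:
  assumes indep: "indep_set (sets N) (sets N')" and space: "space N = space M" "space N' = space M"
    and Z: "Z \<in> N \<rightarrow>\<^sub>M A" and Y: "Y \<in> N' \<rightarrow>\<^sub>M B"
  shows "indep_var A Z B Y"
  unfolding indep_var_eq
proof (intro conjI)
  have sub: "sets N \<subseteq> events" "sets N' \<subseteq> events"
    using indep_setD_ev1[OF indep] indep_setD_ev2[OF indep] by auto
  show "random_variable A Z"
    using measurable_space[OF Z] measurable_sets[OF Z] sub space by (intro measurableI) auto
  show "random_variable B Y"
    using measurable_space[OF Y] measurable_sets[OF Y] sub space by (intro measurableI) auto
  have "sigma_sets (space M) {Z -` C \<inter> space M |C. C \<in> sets A} \<subseteq> sets N"
    unfolding space(1)[symmetric] using measurable_sets[OF Z] by (intro sets.sigma_sets_subset) auto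
  moreover have "sigma_sets (space M) {Y -` C \<inter> space M |C. C \<in> sets B} \<subseteq> sets N'"
    unfolding space(2)[symmetric] using measurable_sets[OF Y] by (intro sets.sigma_sets_subset) auto
  ultimately show "indep_set (sigma_sets (space M) {Z -` C \<inter> space M |C. C \<in> sets A})
      (sigma_sets (space M) {Y -` C \<inter> space M |C. C \<in> sets B})"
    using indep unfolding indep_sets2_eq by blast
qed

lemma path_algebra_measurable:
  assumes "0 \<le> t" shows "X t \<in> borel_measurable (path_algebra X)"
proof -
  have "path_of X \<in> path_algebra X \<rightarrow>\<^sub>M Pi\<^sub>M {0..} (\<lambda>_. borel)"
    by (rule measurable_vimage_algebra1) (auto simp: path_of_def space_PiM)
  from measurable_compose[OF this measurable_component_singleton, of t] assms show ?thesis
    by (simp add: path_of_def)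
qed

text \<open>For the event \<open>A\<close> that given permutations are drawn: it is independent of
  the path, so it contributes its probability as a factor.\<close>

lemma indep_set_expectation_indicator:
  fixes Z :: "'a \<Rightarrow> real"
  assumes indep: "indep_set (sets N) (sets N')" and N: "space N = space M" "space N' = space M"
    and Z: "Z \<in> borel_measurable N" "integrable M Z" and A: "A \<in> sets N'"
  shows "expectation (\<lambda>\<omega>. indicator A \<omega> * Z \<omega>) = prob A * expectation Z"
    and "integrable M (\<lambda>\<omega>. indicator A \<omega> * Z \<omega>)"
proof -
  have A_M[measurable]: "A \<in> sets M" using indep_setD_ev2[OF indep] A by auto
  show "integrable M (\<lambda>\<omega>. indicator A \<omega> * Z \<omega>)"
    using integrable_mult_indicator[OF A_M Z(2)] by simp
  have "indep_var borel Z borel (indicator A :: 'a \<Rightarrow> real)"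
    using A N by (intro indep_var_of_indep_set[OF indep] borel_measurable_indicator Z(1)) auto
  moreover have "integrable M (indicator A :: 'a \<Rightarrow> real)"
    by (rule integrable_real_indicator) (auto simp: emeasure_eq_measure)
  ultimately have "expectation (\<lambda>\<omega>. Z \<omega> * indicator A \<omega>) = expectation Z * expectation (indicator A)"
    using Z(2) by (intro indep_var_lebesgue_integral)
  then show "expectation (\<lambda>\<omega>. indicator A \<omega> * Z \<omega>) = prob A * expectation Z"
    by (simp add: mult.commute)
qed

context
  fixes X :: "real \<Rightarrow> 'a \<Rightarrow> real" and n a :: nat and I :: "nat \<Rightarrow> 'a \<Rightarrow> nat \<Rightarrow> nat"
  assumes sample: "uniform_perm_sample X n a I" and a: "1 \<le> a"
begin

private abbreviation "perm_events \<equiv> sets (vimage_algebra (space M) (\<lambda>\<omega>. \<lambda>k\<in>{1..a}. I k \<omega>)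
          (Pi\<^sub>M {1..a} (\<lambda>_. count_space (perms n))))"

private abbreviation "drawn k \<pi> \<equiv> {\<omega>\<in>space M. I k \<omega> = \<pi>}"

lemma sample_measurable: "k \<in> {1..a} \<Longrightarrow> I k \<in> M \<rightarrow>\<^sub>M count_space (perms n)"
  using sample by (auto simp: uniform_perm_sample_def indep_vars_def)

lemma sample_in_perms: "k \<in> {1..a} \<Longrightarrow> \<omega> \<in> space M \<Longrightarrow> I k \<omega> \<in> perms n"
  using measurable_space[OF sample_measurable] by simp

lemma sample_indep: "indep_set (sets (path_algebra X)) perm_events"
  using sample by (simp add: uniform_perm_sample_def)

lemma sample_event_in_perm_events:
  assumes k: "k \<in> {1..a}" and \<pi>: "\<pi> \<in> perms n"
  shows "drawn k \<pi> \<in> perm_events"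
proof -
  let ?P = "Pi\<^sub>M {1..a} (\<lambda>_. count_space (perms n))"
  have "(\<lambda>f. f k) -` {\<pi>} \<inter> space ?P \<in> sets ?P"
    using \<pi> by (intro measurable_sets[OF measurable_component_singleton[OF k]]) simp
  then have "(\<lambda>\<omega>. \<lambda>k\<in>{1..a}. I k \<omega>) -` ((\<lambda>f. f k) -` {\<pi>} \<inter> space ?P) \<inter> space M \<in> perm_events"
    by (rule in_vimage_algebra)
  also have "(\<lambda>\<omega>. \<lambda>k\<in>{1..a}. I k \<omega>) -` ((\<lambda>f. f k) -` {\<pi>} \<inter> space ?P) \<inter> space M = drawn k \<pi>"
    using k sample_in_perms by (auto simp: space_PiM)
  finally show ?thesis .
qed

lemma prob_sample:
  assumes k: "k \<in> {1..a}" and \<pi>: "\<pi> \<in> perms n"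
  shows "prob (drawn k \<pi>) = 1 / fact n"
proof -
  have "measure (distr M (count_space (perms n)) (I k)) {\<pi>} = 1 / fact n"
    using sample k \<pi> finite_perms[of n]
    by (simp add: uniform_perm_sample_def measure_uniform_count_measure card_perms)
  moreover have "I k -` {\<pi>} \<inter> space M = drawn k \<pi>" by auto
  ultimately show ?thesis
    using \<pi> by (simp add: measure_distr[OF sample_measurable[OF k]])
qed

lemma prob_sample_pair:
  assumes k: "k \<in> {1..a}" "l \<in> {1..a}" "k \<noteq> l" and \<pi>: "\<pi> \<in> perms n" "\<rho> \<in> perms n"
  shows "prob (drawn k \<pi> \<inter> drawn l \<rho>) = 1 / (fact n)\<^sup>2"
proof -
  have "indep_vars (\<lambda>_. count_space (perms n)) I {1..a}"
    using sample by (simp add: uniform_perm_sample_def)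
  from indep_varsD[OF this, of "{k, l}" "\<lambda>i. if i = k then {\<pi>} else {\<rho>}"]
  have "prob (\<Inter>i\<in>{k, l}. I i -` (if i = k then {\<pi>} else {\<rho>}) \<inter> space M)
      = (\<Prod>i\<in>{k, l}. prob (I i -` (if i = k then {\<pi>} else {\<rho>}) \<inter> space M))"
    using k \<pi> by auto
  moreover have "I i -` {\<pi>} \<inter> space M = drawn i \<pi>" for i \<pi> by auto
  ultimately show ?thesis
    using k \<pi> by (simp add: prob_sample power2_eq_square)
qed

text \<open>Exactly one indicator is 1. Splitting by the value drawn replaces a random permutation
  by finitely many fixed ones, each weighted with an event independent of the path.\<close>

lemma sum_indicator_perms:
  "k \<in> {1..a} \<Longrightarrow> \<omega> \<in> space M \<Longrightarrow>
    (\<Sum>\<pi>\<in>perms n. indicator (drawn k \<pi>) \<omega> * z \<pi>) = (z (I k \<omega>) :: real)"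
  using sample_in_perms finite_perms[of n] by (simp add: indicator_def if_distrib[of "\<lambda>x. x * _"] cong: if_cong)

lemma expectation_sample:
  fixes Z :: "(nat \<Rightarrow> nat) \<Rightarrow> 'a \<Rightarrow> real"
  assumes k: "k \<in> {1..a}"
    and Z: "\<And>\<pi>. \<pi> \<in> perms n \<Longrightarrow> Z \<pi> \<in> borel_measurable (path_algebra X)"
      "\<And>\<pi>. \<pi> \<in> perms n \<Longrightarrow> integrable M (Z \<pi>)"
  shows "integrable M (\<lambda>\<omega>. Z (I k \<omega>) \<omega>)"
    and "expectation (\<lambda>\<omega>. Z (I k \<omega>) \<omega>) = (\<Sum>\<pi>\<in>perms n. expectation (Z \<pi>)) / fact n"
proof -
  note [simp] = indep_set_expectation_indicator[OF sample_indep space_vimage_algebra space_vimage_algebra Z sample_event_in_perm_events[OF k]]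
    prob_sample[OF k]
  have int: "integrable M (\<lambda>\<omega>. \<Sum>\<pi>\<in>perms n. indicator (drawn k \<pi>) \<omega> * Z \<pi> \<omega>)"
    by (intro Bochner_Integration.integrable_sum) simp
  then show "integrable M (\<lambda>\<omega>. Z (I k \<omega>) \<omega>)"
    by (rule Bochner_Integration.integrable_cong[THEN iffD1, rotated 2]) (simp_all add: sum_indicator_perms[OF k])
  have "expectation (\<lambda>\<omega>. Z (I k \<omega>) \<omega>)
      = expectation (\<lambda>\<omega>. \<Sum>\<pi>\<in>perms n. indicator (drawn k \<pi>) \<omega> * Z \<pi> \<omega>)"
    by (rule Bochner_Integration.integral_cong) (simp_all add: sum_indicator_perms[OF k])
  also have "\<dots> = (\<Sum>\<pi>\<in>perms n. expectation (\<lambda>\<omega>. indicator (drawn k \<pi>) \<omega> * Z \<pi> \<omega>))"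
    by (rule Bochner_Integration.integral_sum) simp
  finally show "expectation (\<lambda>\<omega>. Z (I k \<omega>) \<omega>) = (\<Sum>\<pi>\<in>perms n. expectation (Z \<pi>)) / fact n"
    by (simp add: sum_divide_distrib)
qed

text \<open>Two distinct draws are uniform on pairs of permutations and jointly independent of the
  path, so both arguments are averaged over separately.\<close>

lemma expectation_sample_pair:
  fixes Z :: "(nat \<Rightarrow> nat) \<Rightarrow> (nat \<Rightarrow> nat) \<Rightarrow> 'a \<Rightarrow> real"
  assumes k: "k \<in> {1..a}" "l \<in> {1..a}" "k \<noteq> l"
    and Z: "\<And>\<pi> \<rho>. \<pi> \<in> perms n \<Longrightarrow> \<rho> \<in> perms n \<Longrightarrow> Z \<pi> \<rho> \<in> borel_measurable (path_algebra X)"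
      "\<And>\<pi> \<rho>. \<pi> \<in> perms n \<Longrightarrow> \<rho> \<in> perms n \<Longrightarrow> integrable M (Z \<pi> \<rho>)"
  shows "integrable M (\<lambda>\<omega>. Z (I k \<omega>) (I l \<omega>) \<omega>)"
    and "expectation (\<lambda>\<omega>. Z (I k \<omega>) (I l \<omega>) \<omega>) = (\<Sum>\<pi>\<in>perms n. \<Sum>\<rho>\<in>perms n. expectation (Z \<pi> \<rho>)) / (fact n)\<^sup>2"
proof -
  define E where "E \<pi> \<rho> = drawn k \<pi> \<inter> (drawn l \<rho>)" for \<pi> \<rho>
  have E: "E \<pi> \<rho> \<in> perm_events" "prob (E \<pi> \<rho>) = 1 / (fact n)\<^sup>2" if "\<pi> \<in> perms n" "\<rho> \<in> perms n" for \<pi> \<rho>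
    using sample_event_in_perm_events k that prob_sample_pair[OF k that] by (auto simp: E_def)
  have sum: "(\<Sum>\<pi>\<in>perms n. \<Sum>\<rho>\<in>perms n. indicator (E \<pi> \<rho>) \<omega> * Z \<pi> \<rho> \<omega>) = Z (I k \<omega>) (I l \<omega>) \<omega>" if "\<omega> \<in> space M" for \<omega>
  proof -
    have "(\<Sum>\<pi>\<in>perms n. \<Sum>\<rho>\<in>perms n. indicator (E \<pi> \<rho>) \<omega> * Z \<pi> \<rho> \<omega>)
      = (\<Sum>\<pi>\<in>perms n. indicator (drawn k \<pi>) \<omega> * (\<Sum>\<rho>\<in>perms n. indicator (drawn l \<rho>) \<omega> * Z \<pi> \<rho> \<omega>))"
      by (simp add: E_def indicator_inter_arith sum_distrib_left mult.assoc)
    then show ?thesis using that k by (simp only: sum_indicator_perms)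
  qed
  note ind = indep_set_expectation_indicator[OF sample_indep space_vimage_algebra space_vimage_algebra Z E(1)]
  have int: "integrable M (\<lambda>\<omega>. \<Sum>\<pi>\<in>perms n. \<Sum>\<rho>\<in>perms n. indicator (E \<pi> \<rho>) \<omega> * Z \<pi> \<rho> \<omega>)"
    by (intro Bochner_Integration.integrable_sum) (simp add: ind)
  then show "integrable M (\<lambda>\<omega>. Z (I k \<omega>) (I l \<omega>) \<omega>)"
    by (rule Bochner_Integration.integrable_cong[THEN iffD1, rotated 2]) (simp_all add: sum)
  have "expectation (\<lambda>\<omega>. Z (I k \<omega>) (I l \<omega>) \<omega>)
      = expectation (\<lambda>\<omega>. \<Sum>\<pi>\<in>perms n. \<Sum>\<rho>\<in>perms n. indicator (E \<pi> \<rho>) \<omega> * Z \<pi> \<rho> \<omega>)"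
    by (rule Bochner_Integration.integral_cong) (simp_all add: sum)
  also have "\<dots> = (\<Sum>\<pi>\<in>perms n. expectation (\<lambda>\<omega>. \<Sum>\<rho>\<in>perms n. indicator (E \<pi> \<rho>) \<omega> * Z \<pi> \<rho> \<omega>))"
    by (intro Bochner_Integration.integral_sum Bochner_Integration.integrable_sum) (simp add: ind)
  also have "\<dots> = (\<Sum>\<pi>\<in>perms n. \<Sum>\<rho>\<in>perms n. expectation (\<lambda>\<omega>. indicator (E \<pi> \<rho>) \<omega> * Z \<pi> \<rho> \<omega>))"
    by (intro sum.cong refl Bochner_Integration.integral_sum) (simp add: ind)
  finally show "expectation (\<lambda>\<omega>. Z (I k \<omega>) (I l \<omega>) \<omega>) = (\<Sum>\<pi>\<in>perms n. \<Sum>\<rho>\<in>perms n. expectation (Z \<pi> \<rho>)) / (fact n)\<^sup>2"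
    by (simp add: ind E sum_divide_distrib)
qed

text \<open>Expanding the square, a pair of distinct draws has as expectation exactly the mean
  square deviation of the average over all permutations. The a diagonal pairs are bounded by K^2
  each and divided by a^2.\<close>

lemma variance_sample_average:
  fixes G :: "(nat \<Rightarrow> nat) \<Rightarrow> 'a \<Rightarrow> real"
  assumes G: "\<And>\<pi>. \<pi> \<in> perms n \<Longrightarrow> G \<pi> \<in> borel_measurable (path_algebra X)"
      "\<And>\<pi>. \<pi> \<in> perms n \<Longrightarrow> G \<pi> \<in> borel_measurable M"
    and bounds: "\<And>\<pi> \<omega>. 0 \<le> G \<pi> \<omega>" "\<And>\<pi> \<omega>. G \<pi> \<omega> \<le> K" "0 \<le> g" "g \<le> K"
  shows "expectation (\<lambda>\<omega>. ((\<Sum>k=1..a. G (I k \<omega>) \<omega>) / a - g)\<^sup>2)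
    \<le> K\<^sup>2 / a + expectation (\<lambda>\<omega>. ((\<Sum>\<pi>\<in>perms n. G \<pi> \<omega>) / fact n - g)\<^sup>2)" (is "_ \<le> _ + ?v")
    and "integrable M (\<lambda>\<omega>. ((\<Sum>k=1..a. G (I k \<omega>) \<omega>) / a - g)\<^sup>2)"
proof -
  define Z where "Z \<pi> \<rho> \<omega> = (G \<pi> \<omega> - g) * (G \<rho> \<omega> - g)" for \<pi> \<rho> \<omega>
  have Z_le: "\<bar>Z \<pi> \<rho> \<omega>\<bar> \<le> K\<^sup>2" for \<pi> \<rho> \<omega>
  proof -
    have "\<bar>G \<pi> \<omega> - g\<bar> \<le> K" for \<pi> using bounds(1,2)[of \<pi> \<omega>] bounds(3,4) by (simp add: abs_le_iff)
    then show ?thesis using bounds(3,4) unfolding Z_def abs_mult power2_eq_square by (intro mult_mono) auto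
  qed
  have Z: "Z \<pi> \<rho> \<in> borel_measurable (path_algebra X)" "integrable M (Z \<pi> \<rho>)"
    if "\<pi> \<in> perms n" "\<rho> \<in> perms n" for \<pi> \<rho>
  proof -
    show "Z \<pi> \<rho> \<in> borel_measurable (path_algebra X)" unfolding Z_def[abs_def] using G(1) that by simp
    have "Z \<pi> \<rho> \<in> borel_measurable M" unfolding Z_def[abs_def] using G(2) that by simp
    then show "integrable M (Z \<pi> \<rho>)" by (rule integrable_const_bound[where B="K\<^sup>2", rotated]) (simp add: Z_le)
  qed
  have sq: "((\<Sum>k=1..a. G (I k \<omega>) \<omega>) / a - g)\<^sup>2 = (\<Sum>k=1..a. \<Sum>l=1..a. Z (I k \<omega>) (I l \<omega>) \<omega>) / a\<^sup>2" for \<omega>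
  proof -
    have "(\<Sum>k=1..a. G (I k \<omega>) \<omega>) / a - g = (\<Sum>k=1..a. G (I k \<omega>) \<omega> - g) / a"
      using a by (simp add: sum_subtractf field_simps)
    then show ?thesis by (simp add: power_divide power2_eq_square sum_product Z_def)
  qed
  have int: "integrable M (\<lambda>\<omega>. Z (I k \<omega>) (I l \<omega>) \<omega>)" if "k \<in> {1..a}" "l \<in> {1..a}" for k l
    using expectation_sample(1)[OF that(1), of "\<lambda>\<pi>. Z \<pi> \<pi>"] expectation_sample_pair(1)[OF that, of Z] Z
    by (cases "k = l") auto
  show "integrable M (\<lambda>\<omega>. ((\<Sum>k=1..a. G (I k \<omega>) \<omega>) / a - g)\<^sup>2)"
    unfolding sq by (intro Bochner_Integration.integrable_divide Bochner_Integration.integrable_sum int)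
  have "?v = expectation (\<lambda>\<omega>. (\<Sum>\<pi>\<in>perms n. \<Sum>\<rho>\<in>perms n. Z \<pi> \<rho> \<omega>) / (fact n)\<^sup>2)"
  proof (rule Bochner_Integration.integral_cong[OF refl])
    fix \<omega>
    have "(\<Sum>\<pi>\<in>perms n. G \<pi> \<omega>) / fact n - g = (\<Sum>\<pi>\<in>perms n. G \<pi> \<omega> - g) / fact n"
      by (simp add: sum_subtractf card_perms field_simps)
    then show "((\<Sum>\<pi>\<in>perms n. G \<pi> \<omega>) / fact n - g)\<^sup>2 = (\<Sum>\<pi>\<in>perms n. \<Sum>\<rho>\<in>perms n. Z \<pi> \<rho> \<omega>) / (fact n)\<^sup>2"
      by (simp add: power_divide power2_eq_square sum_product Z_def)
  qed
  also have "\<dots> = expectation (\<lambda>\<omega>. \<Sum>\<pi>\<in>perms n. \<Sum>\<rho>\<in>perms n. Z \<pi> \<rho> \<omega>) / (fact n)\<^sup>2"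
    by (rule integral_divide_zero)
  also have "expectation (\<lambda>\<omega>. \<Sum>\<pi>\<in>perms n. \<Sum>\<rho>\<in>perms n. Z \<pi> \<rho> \<omega>) = (\<Sum>\<pi>\<in>perms n. expectation (\<lambda>\<omega>. \<Sum>\<rho>\<in>perms n. Z \<pi> \<rho> \<omega>))"
    by (intro Bochner_Integration.integral_sum Bochner_Integration.integrable_sum Z)
  also have "\<dots> = (\<Sum>\<pi>\<in>perms n. \<Sum>\<rho>\<in>perms n. expectation (Z \<pi> \<rho>))"
    by (intro sum.cong refl Bochner_Integration.integral_sum Z)
  finally have v: "?v = (\<Sum>\<pi>\<in>perms n. \<Sum>\<rho>\<in>perms n. expectation (Z \<pi> \<rho>)) / (fact n)\<^sup>2" .
  have le: "expectation (\<lambda>\<omega>. Z (I k \<omega>) (I l \<omega>) \<omega>) \<le> (if k = l then K\<^sup>2 else 0) + ?v"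
    if "k \<in> {1..a}" "l \<in> {1..a}" for k l
  proof (cases "k = l")
    case True
    have "expectation (\<lambda>\<omega>. Z (I k \<omega>) (I l \<omega>) \<omega>) \<le> expectation (\<lambda>_. K\<^sup>2)"
      using that by (intro integral_mono int abs_le_D1[OF Z_le]) auto
    then show ?thesis using True prob_space by (simp add: add_increasing2)
  next
    case False
    then show ?thesis using expectation_sample_pair(2)[OF that, of Z] Z v by simp
  qed
  have "expectation (\<lambda>\<omega>. ((\<Sum>k=1..a. G (I k \<omega>) \<omega>) / a - g)\<^sup>2)
      = expectation (\<lambda>\<omega>. \<Sum>k=1..a. \<Sum>l=1..a. Z (I k \<omega>) (I l \<omega>) \<omega>) / a\<^sup>2"
    unfolding sq by (rule integral_divide_zero)
  also have "expectation (\<lambda>\<omega>. \<Sum>k=1..a. \<Sum>l=1..a. Z (I k \<omega>) (I l \<omega>) \<omega>)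
      = (\<Sum>k=1..a. expectation (\<lambda>\<omega>. \<Sum>l=1..a. Z (I k \<omega>) (I l \<omega>) \<omega>))"
    by (intro Bochner_Integration.integral_sum Bochner_Integration.integrable_sum int)
  also have "\<dots> = (\<Sum>k=1..a. \<Sum>l=1..a. expectation (\<lambda>\<omega>. Z (I k \<omega>) (I l \<omega>) \<omega>))"
    by (intro sum.cong refl Bochner_Integration.integral_sum int)
  also have "\<dots> / a\<^sup>2 \<le> (\<Sum>k=1..a. \<Sum>l=1..a. (if k = l then K\<^sup>2 else 0) + ?v) / a\<^sup>2"
    by (intro divide_right_mono sum_mono le) auto
  also have "\<dots> = (a * K\<^sup>2 + a * (a * ?v)) / a\<^sup>2"
    by (simp add: sum.distrib distrib_left)
  also have "\<dots> = K\<^sup>2 / a + ?v"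
  proof -
    have "(A * k + A * (A * v)) / A\<^sup>2 = k / A + v" if "0 < A" for A k v :: real
      using that by (simp add: field_simps power2_eq_square)
    from this[of "real a" "K\<^sup>2" ?v] a show ?thesis unfolding of_nat_power by linarith
  qed
  finally show "expectation (\<lambda>\<omega>. ((\<Sum>k=1..a. G (I k \<omega>) \<omega>) / a - g)\<^sup>2) \<le> K\<^sup>2 / a + ?v" .
qed

end

end

section \<open>Increments of the risk process\<close>

definition grid_increment :: "(real \<Rightarrow> 'a \<Rightarrow> real) \<Rightarrow> real \<Rightarrow> nat \<Rightarrow> 'a \<Rightarrow> real" where
  "grid_increment Y \<delta> k \<omega> = Y (real k * \<delta>) \<omega> - Y (real (k - 1) * \<delta>) \<omega>"

lemma sum_grid_increment: "(\<Sum>j=1..k. grid_increment Y \<delta> j \<omega>) = Y (real k * \<delta>) \<omega> - Y 0 \<omega>"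
proof (induction k)
  case (Suc k)
  then show ?case by (simp add: grid_increment_def)
qed simp

lemma grid_step: "1 \<le> k \<Longrightarrow> real k * \<delta> - real (k - 1) * \<delta> = \<delta>"
  by (simp add: of_nat_diff algebra_simps)

context stochastic_basis
begin

lemma F_space: "0 \<le> t \<Longrightarrow> space (F t) = space M"
  using subalgebra_F[of t] by (simp add: subalgebra_def)

lemma F_measurable_mono: "0 \<le> s \<Longrightarrow> s \<le> t \<Longrightarrow> f \<in> F s \<rightarrow>\<^sub>M N \<Longrightarrow> f \<in> F t \<rightarrow>\<^sub>M N"
  using mono_F[of s t] by (auto simp: measurable_def F_space)

lemma F_measurable_M: "0 \<le> t \<Longrightarrow> f \<in> F t \<rightarrow>\<^sub>M N \<Longrightarrow> f \<in> M \<rightarrow>\<^sub>M N"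
  by (rule measurable_from_subalg[OF subalgebra_F])

section \<open>Levy increments along the grid\<close>

context
  fixes Y :: "real \<Rightarrow> 'a \<Rightarrow> real"
  assumes Y: "levy_process Y"
begin

lemma levy_adapted: "0 \<le> s \<Longrightarrow> s \<le> t \<Longrightarrow> Y s \<in> borel_measurable (F t)"
  using Y F_measurable_mono[of s t "Y s" borel] by (auto simp: levy_process_def)

lemma levy_measurable: "0 \<le> t \<Longrightarrow> Y t \<in> borel_measurable M"
  using levy_adapted[of t t] F_measurable_M by blast

lemma levy_indep_set:
  "0 \<le> s \<Longrightarrow> s \<le> t \<Longrightarrow>
    indep_set (sets (F s)) (sets (vimage_algebra (space M) (\<lambda>\<omega>. Y t \<omega> - Y s \<omega>) borel))"
  using Y by (auto simp: levy_process_def)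

lemma levy_indep_increment:
  assumes st: "0 \<le> s" "s \<le> t" and Z: "Z \<in> borel_measurable (F s)"
  shows "indep_var borel Z borel (\<lambda>\<omega>. Y t \<omega> - Y s \<omega>)"
proof (rule indep_var_of_indep_set[OF levy_indep_set[OF st]])
  show "(\<lambda>\<omega>. Y t \<omega> - Y s \<omega>) \<in> vimage_algebra (space M) (\<lambda>\<omega>. Y t \<omega> - Y s \<omega>) borel \<rightarrow>\<^sub>M borel"
    by (rule measurable_vimage_algebra1) auto
qed (use Z st F_space in auto)

lemma levy_increment_distr:
  "0 \<le> s \<Longrightarrow> s \<le> t \<Longrightarrow> distr M borel (\<lambda>\<omega>. Y t \<omega> - Y s \<omega>) = distr M borel (Y (t - s))"
  using Y by (auto simp: levy_process_def)

context
  fixes \<delta> :: real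
  assumes \<delta>: "0 < \<delta>"
begin

lemma grid_increment_measurable: "grid_increment Y \<delta> k \<in> borel_measurable M"
  unfolding grid_increment_def[abs_def] using \<delta> by (intro borel_measurable_diff levy_measurable) auto

lemma grid_increment_distr:
  assumes "1 \<le> k"
  shows "distr M borel (grid_increment Y \<delta> k) = distr M borel (Y \<delta>)"
proof -
  have "0 \<le> real (k - 1) * \<delta>" "real (k - 1) * \<delta> \<le> real k * \<delta>" using \<delta> by auto
  from levy_increment_distr[OF this] show ?thesis
    by (simp only: grid_step[OF assms] grid_increment_def[abs_def])
qed

text \<open>Induction on n: the next increment is independent of
  \<open>F (real n * \<delta>)\<close>. The membership of the event in this sigma-algebra is part of
  the statement because the induction step has to apply that independence.\<close>

lemma prob_grid_increments:
  assumes A: "\<And>k. A k \<in> sets borel"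
  shows "{\<omega>\<in>space M. \<forall>k\<in>{1..n}. grid_increment Y \<delta> k \<omega> \<in> A k} \<in> sets (F (real n * \<delta>))
    \<and> prob {\<omega>\<in>space M. \<forall>k\<in>{1..n}. grid_increment Y \<delta> k \<omega> \<in> A k}
      = (\<Prod>k=1..n. prob (grid_increment Y \<delta> k -` A k \<inter> space M))"
proof (induction n)
  case 0
  then show ?case using sets.top[of "F 0"] F_space[of 0] by (simp add: prob_space)
next
  case (Suc n)
  let ?E = "\<lambda>n. {\<omega>\<in>space M. \<forall>k\<in>{1..n}. grid_increment Y \<delta> k \<omega> \<in> A k}"
  let ?B = "grid_increment Y \<delta> (Suc n) -` A (Suc n) \<inter> space M"
  have E: "?E (Suc n) = ?E n \<inter> ?B" by (auto simp: atLeastAtMostSuc_conv)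
  have ord: "0 \<le> real n * \<delta>" "real n * \<delta> \<le> real (Suc n) * \<delta>" using \<delta> by auto
  have "?B \<in> sets (vimage_algebra (space M) (\<lambda>\<omega>. Y (real (Suc n) * \<delta>) \<omega> - Y (real n * \<delta>) \<omega>) borel)"
    using in_vimage_algebra[OF A[of "Suc n"], of "\<lambda>\<omega>. Y (real (Suc n) * \<delta>) \<omega> - Y (real n * \<delta>) \<omega>" "space M"]
    by (simp add: grid_increment_def[abs_def])
  with Suc have "prob (?E n \<inter> ?B) = prob (?E n) * prob ?B"
    by (intro indep_setD[OF levy_indep_set[OF ord]]) auto
  moreover have "?E n \<in> sets (F (real (Suc n) * \<delta>))" using Suc mono_F[OF ord] by auto
  moreover have "?B \<in> sets (F (real (Suc n) * \<delta>))"
  proof -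
    have "grid_increment Y \<delta> (Suc n) \<in> borel_measurable (F (real (Suc n) * \<delta>))"
      unfolding grid_increment_def[abs_def] using ord \<delta> by (intro borel_measurable_diff levy_adapted) auto
    from measurable_sets[OF this A] show ?thesis using \<delta> by (simp add: F_space)
  qed
  ultimately show ?case unfolding E using Suc by auto
qed

end

end

end

context risk_model
begin

lemma levy_W: "levy_process W" and levy_S: "levy_process S"
  using wiener_W subordinator_S by (auto simp: wiener_process_def subordinator_def)

abbreviation X :: "real \<Rightarrow> 'a \<Rightarrow> real" where "X \<equiv> risk_process u c \<sigma> W S"

abbreviation noise_increment :: "real \<Rightarrow> nat \<times> bool \<Rightarrow> 'a \<Rightarrow> real" where
  "noise_increment \<delta> \<equiv> \<lambda>(k, b). grid_increment (if b then W else S) \<delta> k"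

context
  fixes \<delta> :: real
  assumes \<delta>: "0 < \<delta>"
begin

lemma grid_increment_X:
  "1 \<le> k \<Longrightarrow> grid_increment X \<delta> k \<omega> = c * \<delta> + \<sigma> * grid_increment W \<delta> k \<omega> - grid_increment S \<delta> k \<omega>"
  using grid_step[of k \<delta>, THEN arg_cong, of "\<lambda>x. c * x"]
  by (simp add: grid_increment_def risk_process_def algebra_simps)

text \<open>The filtration makes each single increment independent of the past, but says nothing
  directly about the pair formed by the increments of \<open>W\<close> and \<open>S\<close>. So the
  product formula is first split along the two independent paths, and then each factor along the
  grid.\<close>

lemma indep_grid_increments_pairs:
  "indep_vars (\<lambda>_. borel) (noise_increment \<delta>) ({1..n} \<times> UNIV)"
proof (cases "n = 0")
  case True
  then show ?thesis by (simp add: indep_vars_def indep_sets_def)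
next
  case False
  have paths: "indep_set (sets (path_algebra W)) (sets (path_algebra S))"
    using indep_W_S by (simp add: indep_var_eq sets_vimage_algebra)
  show ?thesis
  proof (subst indep_vars_finite[where E="\<lambda>_. sets borel"])
    show "random_variable borel (noise_increment \<delta> i)" for i
      using grid_increment_measurable[OF levy_W \<delta>] grid_increment_measurable[OF levy_S \<delta>]
      by (cases i) auto
    show "\<forall>A\<in>({1..n} \<times> UNIV) \<rightarrow> sets borel.
       prob (\<Inter>j\<in>{1..n} \<times> UNIV. noise_increment \<delta> j -` A j \<inter> space M) =
       (\<Prod>j\<in>{1..n} \<times> UNIV. prob (noise_increment \<delta> j -` A j \<inter> space M))"
    proof
      fix A :: "nat \<times> bool \<Rightarrow> real set" assume A: "A \<in> ({1..n} \<times> UNIV) \<rightarrow> sets borel"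
      \<comment> \<open>Filled up with the whole line, since the product formula for one process
        expects a Borel set at every index.\<close>
      define A' where "A' b k = (if k \<in> {1..n} then A (k, b) else UNIV)" for b k
      have A': "A' b k \<in> sets borel" for b k using A by (auto simp: A'_def)
      let ?E = "\<lambda>Y b. {\<omega>\<in>space M. \<forall>k\<in>{1..n}. grid_increment Y \<delta> k \<omega> \<in> A' b k}"
      have E: "?E Y b \<in> sets (path_algebra Y)" for Y :: "real \<Rightarrow> 'a \<Rightarrow> real" and b
      proof -
        let ?V = "path_algebra Y"
        have [measurable]: "grid_increment Y \<delta> k \<in> borel_measurable ?V" for k
          unfolding grid_increment_def[abs_def] using \<delta> by (intro borel_measurable_diff path_algebra_measurable) auto
        have "{\<omega>\<in>space ?V. \<forall>k\<in>{1..n}. grid_increment Y \<delta> k \<omega> \<in> A' b k} \<in> sets ?V"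
          using A' by measurable
        then show ?thesis by (simp only: space_vimage_algebra)
      qed
      have "(\<Inter>j\<in>{1..n} \<times> UNIV. noise_increment \<delta> j -` A j \<inter> space M)
          = {\<omega>\<in>space M. \<forall>k\<in>{1..n}. \<forall>b. grid_increment (if b then W else S) \<delta> k \<omega> \<in> A (k, b)}"
        using False by (auto simp del: all_bool_eq split del: if_split intro: Suc_leI)
      also have "\<dots> = ?E W True \<inter> ?E S False"
        by (auto simp: A'_def all_bool_eq)
      also have "prob (?E W True \<inter> ?E S False) = prob (?E W True) * prob (?E S False)"
        by (rule indep_setD[OF paths E E])
      also have "\<dots> = (\<Prod>k=1..n. prob (grid_increment W \<delta> k -` A' True k \<inter> space M))
          * (\<Prod>k=1..n. prob (grid_increment S \<delta> k -` A' False k \<inter> space M))"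
        using prob_grid_increments[OF levy_W \<delta> A'] prob_grid_increments[OF levy_S \<delta> A'] by simp
      also have "\<dots> = (\<Prod>k=1..n. prob (grid_increment W \<delta> k -` A (k, True) \<inter> space M))
          * (\<Prod>k=1..n. prob (grid_increment S \<delta> k -` A (k, False) \<inter> space M))"
        by (intro arg_cong2[of _ _ _ _ "(*)"] prod.cong) (auto simp: A'_def)
      also have "\<dots> = (\<Prod>k=1..n. \<Prod>b\<in>UNIV. prob (grid_increment (if b then W else S) \<delta> k -` A (k, b) \<inter> space M))"
        by (simp add: UNIV_bool prod.distrib mult.commute)
      also have "\<dots> = (\<Prod>j\<in>{1..n} \<times> UNIV. prob (noise_increment \<delta> j -` A j \<inter> space M))"
        by (subst prod.cartesian_product) (simp add: case_prod_beta)
      finally show "prob (\<Inter>j\<in>{1..n} \<times> UNIV. noise_increment \<delta> j -` A j \<inter> space M) =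
        (\<Prod>j\<in>{1..n} \<times> UNIV. prob (noise_increment \<delta> j -` A j \<inter> space M))" .
    qed
    show "{1..n} \<times> (UNIV :: bool set) \<noteq> {}" using False by simp
    show "sets borel = sigma_sets (space borel) (sets borel)" by (rule sets.sigma_sets_eq[symmetric])
    show "Int_stable (sets borel)" by (rule sets.Int_stable)
  qed auto
qed

lemma indep_grid_increments: "indep_vars (\<lambda>_. borel) (grid_increment X \<delta>) {1..n}"
proof -
  have "indep_vars (\<lambda>k. PiM ({k} \<times> UNIV) (\<lambda>_. borel))
      (\<lambda>k \<omega>. restrict (\<lambda>i. noise_increment \<delta> i \<omega>) ({k} \<times> UNIV)) {1..n}"
    by (intro indep_vars_restrict[OF indep_grid_increments_pairs]) (auto simp: disjoint_family_on_def)
  from indep_vars_compose2[OF this, of "\<lambda>k f. c * \<delta> + \<sigma> * f (k, True) - f (k, False)" "\<lambda>_. borel"]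
  have "indep_vars (\<lambda>_. borel) (\<lambda>k \<omega>. c * \<delta> + \<sigma> * grid_increment W \<delta> k \<omega> - grid_increment S \<delta> k \<omega>) {1..n}"
    by (simp add: measurable_component_singleton)
  then show ?thesis
    by (rule indep_vars_cong[THEN iffD1, rotated 3]) (auto simp: grid_increment_X)
qed

text \<open>By independence the pair of noise increments has a product law whose factors are the
  laws of \<open>W \<delta>\<close> and \<open>S \<delta>\<close>, for every k.\<close>

lemma grid_increment_X_distr:
  assumes k: "1 \<le> k"
  shows "distr M borel (grid_increment X \<delta> k) = distr M borel (grid_increment X \<delta> 1)"
proof -
  define f where "f = (\<lambda>(a, b). c * \<delta> + \<sigma> * a - b :: real)"
  have [measurable]: "f \<in> borel_measurable (borel \<Otimes>\<^sub>M borel)" unfolding f_def by measurable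
  have "distr M borel (grid_increment X \<delta> k) = distr (distr M borel (W \<delta>) \<Otimes>\<^sub>M distr M borel (S \<delta>)) borel f"
    if k: "1 \<le> k" for k
  proof -
    note [measurable] = grid_increment_measurable[OF levy_W \<delta>] grid_increment_measurable[OF levy_S \<delta>]
    have "indep_var borel (grid_increment W \<delta> k) borel (grid_increment S \<delta> k)"
    proof -
      have "indep_vars (\<lambda>_. borel) (\<lambda>b. noise_increment \<delta> (k, b)) (UNIV :: bool set)"
        by (rule indep_vars_select[OF indep_grid_increments_pairs[of k]]) (use k in \<open>auto simp: inj_on_def\<close>)
      then show ?thesis
        unfolding indep_var_def by (rule indep_vars_cong[THEN iffD1, rotated 3]) (auto split: bool.split)
    qed
    then have "distr M borel (W \<delta>) \<Otimes>\<^sub>M distr M borel (S \<delta>)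
        = distr M (borel \<Otimes>\<^sub>M borel) (\<lambda>\<omega>. (grid_increment W \<delta> k \<omega>, grid_increment S \<delta> k \<omega>))"
      using k by (simp add: indep_var_distribution_eq grid_increment_distr[OF levy_W \<delta>] grid_increment_distr[OF levy_S \<delta>])
    then have "distr (distr M borel (W \<delta>) \<Otimes>\<^sub>M distr M borel (S \<delta>)) borel f
        = distr M borel (\<lambda>\<omega>. f (grid_increment W \<delta> k \<omega>, grid_increment S \<delta> k \<omega>))"
      by (simp add: distr_distr comp_def)
    also have "(\<lambda>\<omega>. f (grid_increment W \<delta> k \<omega>, grid_increment S \<delta> k \<omega>)) = grid_increment X \<delta> k"
      using k by (simp add: fun_eq_iff f_def grid_increment_X)
    finally show ?thesis ..
  qed
  from this[of k] this[of 1] k show ?thesis by simp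
qed

end

end

section \<open>A second moment bound\<close>

text \<open>Summation by parts. A step that does not raise the maximum leaves the right-hand side
  unchanged; a new maximum b over an old one m leaves the slack (b - m)^2.\<close>

lemma running_max_doob_aux:
  assumes "s 0 = 0"
  shows "(running_max s n)\<^sup>2 \<le> 2 * running_max s n * s n - 2 * (\<Sum>i<n. running_max s i * (s (Suc i) - s i))"
proof (induction n)
  case 0
  then show ?case using assms by simp
next
  case (Suc n)
  let ?m = "running_max s n" and ?b = "s (Suc n)" and ?T = "\<Sum>i<n. running_max s i * (s (Suc i) - s i)"
  show ?case
  proof (cases "?b \<le> ?m")
    case True
    then show ?thesis using Suc by (simp add: max_absorb1 algebra_simps)
  next
    case False
    have "0 \<le> (?b - ?m)\<^sup>2" by simp
    then have "?b\<^sup>2 \<le> 2 * ?b * ?b - 2 * (?T + ?m * (?b - s n))"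
      using Suc by (simp add: algebra_simps power2_eq_square)
    then show ?thesis using False by (simp add: max_absorb2)
  qed
qed

text \<open>A pathwise form of Doob's \<open>L\<^sup>2\<close> maximal inequality: the sum is a martingale transform.\<close>

lemma running_max_doob:
  assumes "s 0 = 0"
  shows "(running_max s n)\<^sup>2 \<le> 4 * (s n)\<^sup>2 - 4 * (\<Sum>i<n. running_max s i * (s (Suc i) - s i))"
proof -
  \<comment> \<open>After doubling the previous inequality, 4 m s \<le> m^2 + 4 s^2 absorbs one m^2;
    this is the origin of the constant 4.\<close>
  have "0 \<le> (running_max s n - 2 * s n)\<^sup>2" by simp
  then show ?thesis using running_max_doob_aux[of s n, OF assms]
    by (simp add: power2_eq_square algebra_simps)
qed

text \<open>A crude bound, meant only for the integrability of the squared maximum.\<close>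

lemma running_max_square_le: "(running_max s n)\<^sup>2 \<le> (\<Sum>k\<le>n. (s k)\<^sup>2)"
proof (induction n)
  case (Suc n)
  have "0 \<le> (\<Sum>k\<le>n. (s k)\<^sup>2)" by (intro sum_nonneg) auto
  then show ?case using Suc by (auto simp: max_def add_increasing2)
qed simp

lemma running_max_measurable:
  "(\<And>j. j \<le> k \<Longrightarrow> (\<lambda>\<omega>. p \<omega> j) \<in> borel_measurable N) \<Longrightarrow> (\<lambda>\<omega>. running_max (p \<omega>) k) \<in> borel_measurable N"
  by (induction k) (auto intro!: borel_measurable_max)

lemma grid_dividend_measurable:
  "(\<And>j. j < k \<Longrightarrow> (\<lambda>\<omega>. p \<omega> j) \<in> borel_measurable N) \<Longrightarrow> (\<lambda>\<omega>. grid_dividend \<theta> (p \<omega>) k) \<in> borel_measurable N"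
  by (cases k) (auto simp: grid_dividend_Suc intro!: borel_measurable_max borel_measurable_diff running_max_measurable)

lemma grid_payout_measurable:
  "(\<And>j. j < k \<Longrightarrow> (\<lambda>\<omega>. p \<omega> j) \<in> borel_measurable N) \<Longrightarrow> (\<lambda>\<omega>. grid_payout \<theta> (p \<omega>) k) \<in> borel_measurable N"
proof (induction k)
  case (Suc k)
  have "{\<omega>\<in>space N. solvent_before \<theta> (p \<omega>) (Suc k)} \<in> sets N"
    unfolding solvent_before_def using Suc.prems
    by (intro sets.sets_Collect_finite_All borel_measurable_le grid_dividend_measurable) auto
  then show ?case using Suc
    by (auto intro!: measurable_If grid_dividend_measurable)
qed simp

lemma discounted_measurable:
  assumes "0 < r" "0 < \<delta>" "\<And>k. k \<le> n \<Longrightarrow> (\<lambda>\<omega>. f \<omega> k) \<in> borel_measurable N"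
  shows "(\<lambda>\<omega>. discounted r \<delta> n (f \<omega>)) \<in> borel_measurable N"
  unfolding discounted_eq_sum[OF assms(1,2)] using assms(3)
  by (intro borel_measurable_add borel_measurable_sum borel_measurable_times borel_measurable_diff) auto

text \<open>The killing time takes effect through finitely many weights, so the exchange is
  linearity of a finite sum.\<close>

lemma discounted_expectation:
  assumes "0 < r" "0 < \<delta>" and int: "\<And>k. k \<le> n \<Longrightarrow> integrable M (\<lambda>\<omega>. f \<omega> k)"
  shows "integrable M (\<lambda>\<omega>. discounted r \<delta> n (f \<omega>))"
    and "(LINT \<omega>|M. discounted r \<delta> n (f \<omega>)) = discounted r \<delta> n (\<lambda>k. LINT \<omega>|M. f \<omega> k)"
proof -
  have *: "integrable M (\<lambda>\<omega>. exp (- r * (real k * \<delta>)) * (f \<omega> (Suc k) - f \<omega> k))" if "k < n" for k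
    using that by (intro integrable_mult_right Bochner_Integration.integrable_diff int) auto
  then show "integrable M (\<lambda>\<omega>. discounted r \<delta> n (f \<omega>))"
    unfolding discounted_eq_sum[OF assms(1,2)]
    by (intro Bochner_Integration.integrable_add Bochner_Integration.integrable_sum int) auto
  have "(LINT \<omega>|M. discounted r \<delta> n (f \<omega>))
      = (LINT \<omega>|M. f \<omega> 0) + (\<Sum>k<n. LINT \<omega>|M. exp (- r * (real k * \<delta>)) * (f \<omega> (Suc k) - f \<omega> k))"
    unfolding discounted_eq_sum[OF assms(1,2)] using *
    by (subst Bochner_Integration.integral_add) (auto intro!: int Bochner_Integration.integral_sum)
  also have "\<dots> = discounted r \<delta> n (\<lambda>k. LINT \<omega>|M. f \<omega> k)"
    unfolding discounted_eq_sum[OF assms(1,2)] by (intro arg_cong2[of _ _ _ _ "(+)"] sum.cong) (auto simp: int)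
  finally show "(LINT \<omega>|M. discounted r \<delta> n (f \<omega>)) = discounted r \<delta> n (\<lambda>k. LINT \<omega>|M. f \<omega> k)" .
qed

lemma exp_measure_moment_integrable: "0 < r \<Longrightarrow> integrable (exp_measure r) (\<lambda>s. s ^ i)"
proof -
  assume r: "0 < r"
  interpret E: prob_space "exp_measure r" using r by (rule prob_space_exponential_density)
  have "distributed (exp_measure r) lborel (\<lambda>s. s) (exponential_density r)"
    unfolding distributed_def by (auto simp: distr_id2)
  then show ?thesis by (rule E.erlang_ith_moment_integrable[OF r])
qed

text \<open>Rounding up adds at most the mesh, here at most 1, so \<open>s + 1\<close> dominates the
  rounded time. The bound is thereby uniform in \<delta> and n.\<close>

lemma discounted_quadratic_le:
  assumes r: "0 < r" and \<delta>: "0 < \<delta>" "\<delta> \<le> 1" and ab: "0 \<le> a" "0 \<le> b"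
  shows "discounted r \<delta> n (\<lambda>k. a * (real k * \<delta>)\<^sup>2 + b * (real k * \<delta>))
    \<le> (LINT s|exp_measure r. a * (s + 1)\<^sup>2 + b * (s + 1))"
  unfolding discounted_def
proof (rule integral_mono_AE)
  show "integrable (exp_measure r) (\<lambda>s. a * (real (min n (grid_index \<delta> s)) * \<delta>)\<^sup>2 + b * (real (min n (grid_index \<delta> s)) * \<delta>))"
    using discounted_integrable[OF r \<delta>(1), of "\<lambda>k. a * (real k * \<delta>)\<^sup>2 + b * (real k * \<delta>)"] .
  have "(\<lambda>s::real. a * (s + 1)\<^sup>2 + b * (s + 1)) = (\<lambda>s. a * s ^ 2 + (2 * a + b) * s ^ 1 + (a + b) * s ^ 0)"
    by (auto simp: power2_eq_square algebra_simps)
  then show "integrable (exp_measure r) (\<lambda>s. a * (s + 1)\<^sup>2 + b * (s + 1))"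
    by (simp only:) (intro Bochner_Integration.integrable_add integrable_mult_right exp_measure_moment_integrable r)
  show "AE s in exp_measure r. a * (real (min n (grid_index \<delta> s)) * \<delta>)\<^sup>2 + b * (real (min n (grid_index \<delta> s)) * \<delta>)
      \<le> a * (s + 1)\<^sup>2 + b * (s + 1)"
    using AE_exp_measure_positive[OF r]
  proof eventually_elim
    case (elim s)
    have "real (min n (grid_index \<delta> s)) * \<delta> \<le> real (grid_index \<delta> s) * \<delta>" using \<delta> by simp
    also have "\<dots> \<le> s + 1" using grid_index_upper[OF \<delta>(1), of s] elim \<delta>(2) by simp
    finally show ?case using ab \<delta> by (intro add_mono mult_left_mono power_mono) auto
  qed
qed

lemma walk_measurable:
  "(\<And>j. j \<in> {1..k} \<Longrightarrow> (\<lambda>\<omega>. d \<omega> j) \<in> borel_measurable N) \<Longrightarrow> (\<lambda>\<omega>. walk u (d \<omega>) k) \<in> borel_measurable N"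
  unfolding walk_def by (intro borel_measurable_add borel_measurable_sum) auto

section \<open>Second moments of the Brownian part and of the payouts\<close>

context risk_model
begin

lemma X_measurable: "0 \<le> t \<Longrightarrow> X t \<in> borel_measurable M"
  unfolding risk_process_def[abs_def] using levy_measurable[OF levy_W] levy_measurable[OF levy_S] by simp

lemma grid_increment_X_measurable: "0 \<le> \<delta> \<Longrightarrow> grid_increment X \<delta> j \<in> borel_measurable M"
  unfolding grid_increment_def[abs_def] by (intro borel_measurable_diff X_measurable) auto

lemma W_normal: "0 \<le> s \<Longrightarrow> s < t \<Longrightarrow> distributed M lborel (\<lambda>\<omega>. W t \<omega> - W s \<omega>) (normal_density 0 (sqrt (t - s)))"
  using wiener_W by (auto simp: wiener_process_def)

lemma W_increment_moments:
  assumes "0 \<le> s" "s \<le> t"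
  shows "integrable M (\<lambda>\<omega>. W t \<omega> - W s \<omega>)" (is ?moment1)
    and "expectation (\<lambda>\<omega>. W t \<omega> - W s \<omega>) = 0" (is ?mean)
    and "integrable M (\<lambda>\<omega>. (W t \<omega> - W s \<omega>)\<^sup>2)" (is ?moment2)
    and "expectation (\<lambda>\<omega>. (W t \<omega> - W s \<omega>)\<^sup>2) = t - s" (is ?variance)
proof -
  have "?moment1 \<and> ?mean \<and> ?moment2 \<and> ?variance"
  proof (cases "s = t")
    case False
    then have st: "0 < sqrt (t - s)" "s < t" using assms by auto
    note D = W_normal[OF assms(1) st(2)]
    have "integrable M (\<lambda>\<omega>. (W t \<omega> - W s \<omega>) ^ i)" for i
      using integrable_normal_moment[OF st(1), of 0 i]
      by (subst distributed_integrable[OF D, symmetric]) (auto simp: normal_density_nonneg)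
    from this[of 1] this[of 2] show ?thesis
      using normal_distributed_expectation[OF st(1) D] normal_distributed_variance[OF st(1) D] st(2) by simp
  qed simp
  then show ?moment1 ?mean ?moment2 ?variance by auto
qed

abbreviation X_walk :: "real \<Rightarrow> 'a \<Rightarrow> nat \<Rightarrow> real" where
  "X_walk \<delta> \<omega> \<equiv> walk u (\<lambda>j. grid_increment X \<delta> j \<omega>)"

text \<open>With \<open>W 0\<close> subtracted the sequence starts at 0 for every outcome, not just
  almost surely, as the pathwise maximal inequality requires.\<close>

definition W_max :: "real \<Rightarrow> nat \<Rightarrow> 'a \<Rightarrow> real" where
  "W_max \<delta> k \<omega> = running_max (\<lambda>k. W (real k * \<delta>) \<omega> - W 0 \<omega>) k"

context
  fixes \<delta> :: real
  assumes \<delta>: "0 < \<delta>"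
begin

lemma W_max_adapted: "W_max \<delta> k \<in> borel_measurable (F (real k * \<delta>))"
  unfolding W_max_def[abs_def] using \<delta>
  by (intro running_max_measurable borel_measurable_diff levy_adapted[OF levy_W]) auto

lemma W_max_measurable: "W_max \<delta> k \<in> borel_measurable M"
  using \<delta> by (intro F_measurable_M[OF _ W_max_adapted]) auto

lemma W_max_square_integrable: "integrable M (\<lambda>\<omega>. (W_max \<delta> k \<omega>)\<^sup>2)"
proof (rule Bochner_Integration.integrable_bound)
  show "integrable M (\<lambda>\<omega>. \<Sum>j\<le>k. (W (real j * \<delta>) \<omega> - W 0 \<omega>)\<^sup>2)"
    using \<delta> by (intro Bochner_Integration.integrable_sum W_increment_moments) auto
  show "AE \<omega> in M. norm ((W_max \<delta> k \<omega>)\<^sup>2) \<le> norm (\<Sum>j\<le>k. (W (real j * \<delta>) \<omega> - W 0 \<omega>)\<^sup>2)"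
    by (auto simp: W_max_def sum_nonneg intro!: running_max_square_le)
qed (use W_max_measurable in auto)

text \<open>The maximum up to step i is measurable with respect to the past and the next increment
  is independent and centred, so the transform in the pathwise inequality has mean 0.\<close>

lemma W_max_second_moment: "expectation (\<lambda>\<omega>. (W_max \<delta> n \<omega>)\<^sup>2) \<le> 4 * (real n * \<delta>)"
proof -
  let ?w = "\<lambda>k \<omega>. W (real k * \<delta>) \<omega> - W 0 \<omega>"
  have W_max_integrable: "integrable M (W_max \<delta> k)" for k
    using W_max_measurable W_max_square_integrable by (rule square_integrable_imp_integrable)
  have inc: "integrable M (\<lambda>\<omega>. W_max \<delta> i \<omega> * (?w (Suc i) \<omega> - ?w i \<omega>))"
    "expectation (\<lambda>\<omega>. W_max \<delta> i \<omega> * (?w (Suc i) \<omega> - ?w i \<omega>)) = 0" for i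
  proof -
    have ord: "0 \<le> real i * \<delta>" "real i * \<delta> \<le> real (Suc i) * \<delta>" using \<delta> by auto
    note ind = levy_indep_increment[OF levy_W ord W_max_adapted]
    show "integrable M (\<lambda>\<omega>. W_max \<delta> i \<omega> * (?w (Suc i) \<omega> - ?w i \<omega>))"
      using indep_var_integrable[OF ind W_max_integrable W_increment_moments(1)[OF ord]] by simp
    show "expectation (\<lambda>\<omega>. W_max \<delta> i \<omega> * (?w (Suc i) \<omega> - ?w i \<omega>)) = 0"
      using indep_var_lebesgue_integral[OF ind W_max_integrable W_increment_moments(1)[OF ord]]
        W_increment_moments(2)[OF ord] by simp
  qed
  have sq: "integrable M (\<lambda>\<omega>. (?w n \<omega>)\<^sup>2)" "expectation (\<lambda>\<omega>. (?w n \<omega>)\<^sup>2) = real n * \<delta>"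
    using W_increment_moments(3,4)[of 0 "real n * \<delta>"] \<delta> by auto
  have "expectation (\<lambda>\<omega>. (W_max \<delta> n \<omega>)\<^sup>2)
      \<le> expectation (\<lambda>\<omega>. 4 * (?w n \<omega>)\<^sup>2 - 4 * (\<Sum>i<n. W_max \<delta> i \<omega> * (?w (Suc i) \<omega> - ?w i \<omega>)))"
    using sq inc(1) running_max_doob[of "\<lambda>k. ?w k _" n]
    by (intro integral_mono W_max_square_integrable Bochner_Integration.integrable_diff integrable_mult_right
        Bochner_Integration.integrable_sum) (auto simp: W_max_def)
  also have "\<dots> = 4 * (real n * \<delta>)"
    using sq inc by (simp add: Bochner_Integration.integral_diff Bochner_Integration.integral_sum)
  finally show ?thesis .
qed

lemma walk_increments: "X_walk \<delta> \<omega> k = u + (X (real k * \<delta>) \<omega> - X 0 \<omega>)"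
  unfolding walk_def sum_grid_increment ..

text \<open>The barrier is at least \<open>u\<close> and \<open>S\<close> only lowers the path, so
  what is paid is at most the drift plus \<sigma> times the Brownian maximum.\<close>

lemma grid_payout_square_le:
  assumes \<omega>: "\<omega> \<in> space M" and \<theta>: "u \<le> \<theta>"
  shows "(grid_payout \<theta> (X_walk \<delta> \<omega>) k)\<^sup>2
    \<le> 2 * c\<^sup>2 * (real k * \<delta>)\<^sup>2 + 2 * \<sigma>\<^sup>2 * (W_max \<delta> k \<omega>)\<^sup>2"
proof -
  let ?p = "X_walk \<delta> \<omega>"
  have W_max_nonneg: "0 \<le> W_max \<delta> k \<omega>"
    using running_max_ge[of 0 k "\<lambda>k. W (real k * \<delta>) \<omega> - W 0 \<omega>"] by (simp add: W_max_def)
  have "grid_dividend \<theta> ?p k \<le> c * (real k * \<delta>) + \<sigma> * W_max \<delta> k \<omega>"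
  proof (cases k)
    case (Suc j)
    have "running_max ?p j \<le> u + (c * (real k * \<delta>) + \<sigma> * W_max \<delta> k \<omega>)"
    proof (rule running_max_le)
      fix i assume i: "i \<le> j"
      have "S 0 \<omega> \<le> S (real i * \<delta>) \<omega>"
        using subordinator_S \<omega> \<delta> by (auto simp: subordinator_def mono_on_def)
      moreover have "c * (real i * \<delta>) \<le> c * (real k * \<delta>)"
        using i Suc c_pos \<delta> by (intro mult_left_mono mult_right_mono) auto
      moreover have "\<sigma> * (W (real i * \<delta>) \<omega> - W 0 \<omega>) \<le> \<sigma> * W_max \<delta> k \<omega>"
        unfolding W_max_def using i Suc \<sigma>_nonneg running_max_ge[of i k "\<lambda>k. W (real k * \<delta>) \<omega> - W 0 \<omega>"]
        by (intro mult_left_mono) auto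
      ultimately show "?p i \<le> u + (c * (real k * \<delta>) + \<sigma> * W_max \<delta> k \<omega>)"
        by (simp add: walk_increments risk_process_def algebra_simps)
    qed
    moreover have "0 \<le> c * (real k * \<delta>) + \<sigma> * W_max \<delta> k \<omega>"
      using c_pos \<delta> \<sigma>_nonneg W_max_nonneg by simp
    ultimately show ?thesis using \<theta> by (simp add: Suc grid_dividend_Suc)
  qed (use \<sigma>_nonneg W_max_nonneg in simp)
  then have "grid_payout \<theta> ?p k \<le> c * (real k * \<delta>) + \<sigma> * W_max \<delta> k \<omega>"
    using grid_payout_le by (rule order_trans[rotated])
  then have "(grid_payout \<theta> ?p k)\<^sup>2 \<le> (c * (real k * \<delta>) + \<sigma> * W_max \<delta> k \<omega>)\<^sup>2"
    by (intro power_mono grid_payout_nonneg)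
  also have "\<dots> \<le> 2 * c\<^sup>2 * (real k * \<delta>)\<^sup>2 + 2 * \<sigma>\<^sup>2 * (W_max \<delta> k \<omega>)\<^sup>2"
    using zero_le_power2[of "c * (real k * \<delta>) - \<sigma> * W_max \<delta> k \<omega>"]
    by (simp add: power2_eq_square algebra_simps)
  finally show ?thesis .
qed

lemma grid_payout_square_moment:
  assumes \<theta>: "u \<le> \<theta>"
  defines "y \<equiv> \<lambda>\<omega> k. grid_payout \<theta> (X_walk \<delta> \<omega>) k"
  shows "integrable M (\<lambda>\<omega>. (y \<omega> k)\<^sup>2)"
    and "expectation (\<lambda>\<omega>. (y \<omega> k)\<^sup>2) \<le> 2 * c\<^sup>2 * (real k * \<delta>)\<^sup>2 + 8 * \<sigma>\<^sup>2 * (real k * \<delta>)"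
proof -
  have int: "integrable M (\<lambda>\<omega>. 2 * c\<^sup>2 * (real k * \<delta>)\<^sup>2 + 2 * \<sigma>\<^sup>2 * (W_max \<delta> k \<omega>)\<^sup>2)"
    by (intro Bochner_Integration.integrable_add integrable_mult_right W_max_square_integrable) auto
  show int_y: "integrable M (\<lambda>\<omega>. (y \<omega> k)\<^sup>2)"
  proof (rule Bochner_Integration.integrable_bound[OF int])
    show "(\<lambda>\<omega>. (y \<omega> k)\<^sup>2) \<in> borel_measurable M" unfolding y_def
      by (intro borel_measurable_power grid_payout_measurable walk_measurable grid_increment_X_measurable)
        (use \<delta> in auto)
    show "AE \<omega> in M. norm ((y \<omega> k)\<^sup>2) \<le> norm (2 * c\<^sup>2 * (real k * \<delta>)\<^sup>2 + 2 * \<sigma>\<^sup>2 * (W_max \<delta> k \<omega>)\<^sup>2)"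
      unfolding y_def using grid_payout_square_le[OF _ \<theta>] by (auto intro: order_trans[OF _ abs_ge_self])
  qed
  have "expectation (\<lambda>\<omega>. (y \<omega> k)\<^sup>2) \<le> expectation (\<lambda>\<omega>. 2 * c\<^sup>2 * (real k * \<delta>)\<^sup>2 + 2 * \<sigma>\<^sup>2 * (W_max \<delta> k \<omega>)\<^sup>2)"
    unfolding y_def by (intro integral_mono int_y[unfolded y_def] int grid_payout_square_le \<theta>)
  also have "\<dots> = 2 * c\<^sup>2 * (real k * \<delta>)\<^sup>2 + 2 * \<sigma>\<^sup>2 * expectation (\<lambda>\<omega>. (W_max \<delta> k \<omega>)\<^sup>2)"
    using W_max_square_integrable prob_space by simp
  also have "\<dots> \<le> 2 * c\<^sup>2 * (real k * \<delta>)\<^sup>2 + 2 * \<sigma>\<^sup>2 * (4 * (real k * \<delta>))"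
    by (intro add_left_mono mult_left_mono W_max_second_moment) auto
  finally show "expectation (\<lambda>\<omega>. (y \<omega> k)\<^sup>2) \<le> 2 * c\<^sup>2 * (real k * \<delta>)\<^sup>2 + 8 * \<sigma>\<^sup>2 * (real k * \<delta>)" by simp
qed

end

text \<open>Free of the mesh, the number of steps and the barrier, so capping at K costs at most
  this number divided by K, uniformly in n.\<close>

abbreviation second_moment_bound :: "real \<Rightarrow> real" where
  "second_moment_bound r \<equiv> LINT s|exp_measure r. 2 * c\<^sup>2 * (s + 1)\<^sup>2 + 8 * \<sigma>\<^sup>2 * (s + 1)"

lemma discounted_second_moment:
  fixes n :: nat
  assumes r: "0 < r" and \<delta>: "0 < \<delta>" "\<delta> \<le> 1" and \<theta>: "u \<le> \<theta>"
  defines "q \<equiv> \<lambda>\<omega>. discounted r \<delta> n (\<lambda>k. (grid_payout \<theta> (X_walk \<delta> \<omega>) k)\<^sup>2)"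
  shows "integrable M q"
    and "expectation q \<le> second_moment_bound r"
proof -
  note sq = grid_payout_square_moment[OF \<delta>(1) \<theta>]
  show "integrable M q" unfolding q_def by (rule discounted_expectation(1)[OF r \<delta>(1) sq(1)])
  have "expectation q \<le> discounted r \<delta> n (\<lambda>k. 2 * c\<^sup>2 * (real k * \<delta>)\<^sup>2 + 8 * \<sigma>\<^sup>2 * (real k * \<delta>))"
    unfolding q_def discounted_expectation(2)[OF r \<delta>(1) sq(1)] by (intro discounted_mono r \<delta> sq(2))
  also have "\<dots> \<le> second_moment_bound r"
    by (rule discounted_quadratic_le[OF r \<delta>]) auto
  finally show "expectation q \<le> second_moment_bound r" .
qed

end

section \<open>Convergence of the expected discounted dividends\<close>

lemma stopped_dividend_nonneg: "0 \<le> stopped_dividend \<theta> x \<tau> s"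
  by (simp add: stopped_dividend_def dividend_nonneg)

lemma stopped_dividend_mono:
  assumes bdd: "\<And>t. bdd_above (x ` {0..<t})" and \<tau>: "0 \<le> \<tau>" and "s \<le> t"
  shows "stopped_dividend \<theta> x \<tau> s \<le> stopped_dividend \<theta> x \<tau> t"
  unfolding stopped_dividend_def
proof (rule dividend_mono[OF bdd])
  show "real_of_ereal (min (ereal s) \<tau>) \<le> real_of_ereal (min (ereal t) \<tau>)"
    using \<open>s \<le> t\<close> \<tau> by (cases \<tau>) (auto simp: min_def)
qed

text \<open>Above the cap y is charged to its square, since y \<le> y^2 / K there.\<close>

lemma le_min_add_square: "0 < K \<Longrightarrow> 0 \<le> y \<Longrightarrow> y \<le> min y K + y\<^sup>2 / K" for y :: real
proof -
  assume K: "0 < K" and y: "0 \<le> y"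
  have "y \<le> y\<^sup>2 / K" if "K \<le> y"
  proof -
    have "y * K \<le> y * y" using that y by (rule mult_left_mono)
    then show ?thesis using K by (simp add: pos_le_divide_eq power2_eq_square)
  qed
  then show ?thesis using K by (auto simp: min_def)
qed

lemma discounted_le_truncated:
  assumes "0 < r" "0 < \<delta>" "0 < K" "\<And>k. 0 \<le> f k"
  shows "discounted r \<delta> n f \<le> discounted r \<delta> n (\<lambda>k. min (f k) K) + discounted r \<delta> n (\<lambda>k. (f k)\<^sup>2) / K"
proof -
  have "discounted r \<delta> n f \<le> discounted r \<delta> n (\<lambda>k. min (f k) K + inverse K * (f k)\<^sup>2)"
    using le_min_add_square[OF assms(3,4)] by (intro discounted_mono assms(1,2)) (simp add: divide_inverse mult.commute)
  also have "\<dots> = discounted r \<delta> n (\<lambda>k. min (f k) K) + discounted r \<delta> n (\<lambda>k. (f k)\<^sup>2) / K"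
    by (simp only: discounted_add[OF assms(1,2)] discounted_cmult[OF assms(1,2)]) (simp add: divide_inverse)
  finally show ?thesis .
qed

section \<open>Path properties of the risk process\<close>

context risk_model
begin

context
  fixes \<omega> assumes \<omega>: "\<omega> \<in> space M"
begin

lemma X_right_continuous: "0 \<le> t \<Longrightarrow> ((\<lambda>t. X t \<omega>) \<longlongrightarrow> X t \<omega>) (at_right t)"
  unfolding risk_process_def using levy_W levy_S \<omega>
  by (intro tendsto_intros) (auto simp: levy_process_def cadlag_def)

lemma S_nonneg: "0 \<le> t \<Longrightarrow> 0 \<le> S t \<omega>"
  using subordinator_S \<omega> by (auto simp: subordinator_def)

lemma S_mono: "0 \<le> s \<Longrightarrow> s \<le> t \<Longrightarrow> S s \<omega> \<le> S t \<omega>"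
  using subordinator_S \<omega> by (auto simp: subordinator_def mono_on_def)

lemma W_continuous: "continuous_on {0..} (\<lambda>t. W t \<omega>)"
  using wiener_W \<omega> by (auto simp: wiener_process_def)

lemma X_bdd_above: "bdd_above ((\<lambda>t. X t \<omega>) ` {0..<t})"
proof -
  have "continuous_on {0..t} (\<lambda>s. u + c * s + \<sigma> * W s \<omega>)"
    by (intro continuous_intros continuous_on_subset[OF W_continuous]) auto
  then have "bdd_above ((\<lambda>s. u + c * s + \<sigma> * W s \<omega>) ` {0..t})"
    by (intro bounded_imp_bdd_above compact_imp_bounded compact_continuous_image) auto
  then obtain B where B: "\<And>s. s \<in> {0..t} \<Longrightarrow> u + c * s + \<sigma> * W s \<omega> \<le> B"
    unfolding bdd_above_def by blast
  show ?thesis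
  proof (rule bdd_aboveI2)
    fix s assume s: "s \<in> {0..<t}"
    then show "X s \<omega> \<le> B" using B[of s] S_nonneg[of s] by (simp add: risk_process_def)
  qed
qed

text \<open>Replacing S s by the larger constant S t gives a minorant of the path on the left of t
  that tends to X t, because \<open>W\<close> is continuous.\<close>

lemma X_no_up_jump:
  assumes t: "0 < t"
  shows "X t \<omega> \<le> (SUP s\<in>{0..<t}. X s \<omega>)"
proof (rule tendsto_upperbound)
  have "((\<lambda>t. W t \<omega>) \<longlongrightarrow> W t \<omega>) (at t within {0..})"
    using W_continuous t by (simp add: continuous_on)
  then have "((\<lambda>t. W t \<omega>) \<longlongrightarrow> W t \<omega>) (at t)"
    using t by (subst (asm) at_within_interior) (auto simp: interior_Ici[of "t - 1"] interior_real_atLeast)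
  then have "((\<lambda>s. W s \<omega>) \<longlongrightarrow> W t \<omega>) (at_left t)"
    by (rule tendsto_within_subset[of _ _ _ UNIV, simplified])
  then show "((\<lambda>s. u + c * s + \<sigma> * W s \<omega> - S t \<omega>) \<longlongrightarrow> X t \<omega>) (at_left t)"
    unfolding risk_process_def by (intro tendsto_intros)
  show "\<forall>\<^sub>F s in at_left t. u + c * s + \<sigma> * W s \<omega> - S t \<omega> \<le> (SUP s\<in>{0..<t}. X s \<omega>)"
    unfolding eventually_at_left_field
  proof (intro exI[of _ 0] conjI t allI impI)
    fix s assume s: "0 < s" "s < t"
    have "u + c * s + \<sigma> * W s \<omega> - S t \<omega> \<le> X s \<omega>"
      using S_mono[of s t] s by (simp add: risk_process_def)
    also have "\<dots> \<le> (SUP s\<in>{0..<t}. X s \<omega>)" using s by (intro cSUP_upper X_bdd_above) auto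
    finally show "u + c * s + \<sigma> * W s \<omega> - S t \<omega> \<le> (SUP s\<in>{0..<t}. X s \<omega>)" .
  qed
qed simp

end

lemma AE_X_0: "AE \<omega> in M. X 0 \<omega> = u"
proof -
  have "AE \<omega> in M. W 0 \<omega> = 0" "AE \<omega> in M. S 0 \<omega> = 0"
    using levy_W levy_S by (auto simp: levy_process_def)
  then show ?thesis by eventually_elim (simp add: risk_process_def)
qed

abbreviation payout :: "real \<Rightarrow> 'a \<Rightarrow> real \<Rightarrow> real" where
  "payout \<theta> \<omega> \<equiv> stopped_dividend \<theta> (\<lambda>t. X t \<omega>) (ruin_time \<theta> (\<lambda>t. X t \<omega>))"

definition truncated_value :: "real \<Rightarrow> real \<Rightarrow> real \<Rightarrow> 'a \<Rightarrow> real" where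
  "truncated_value r \<theta> K \<omega> =
     (LINT s|exp_measure r. min (payout \<theta> \<omega> s) K)"

definition grid_value :: "real \<Rightarrow> real \<Rightarrow> real \<Rightarrow> nat \<Rightarrow> 'a \<Rightarrow> real" where
  "grid_value r \<theta> \<delta> n \<omega> = discounted r \<delta> n (grid_payout \<theta> (X_walk \<delta> \<omega>))"

definition truncated_grid_value :: "real \<Rightarrow> real \<Rightarrow> real \<Rightarrow> real \<Rightarrow> nat \<Rightarrow> 'a \<Rightarrow> real" where
  "truncated_grid_value r \<theta> K \<delta> n \<omega> =
     discounted r \<delta> n (\<lambda>k. min (grid_payout \<theta> (X_walk \<delta> \<omega>) k) K)"

section \<open>Limits along the sampling scheme\<close>

context
  fixes r \<theta> :: real and \<delta> :: "nat \<Rightarrow> real"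
  assumes r: "0 < r" and \<theta>: "u \<le> \<theta>" "0 < \<theta>"
    and \<delta>_pos: "\<And>n. 1 \<le> n \<Longrightarrow> 0 < \<delta> n" and \<delta>_0: "\<delta> \<longlonglongrightarrow> 0"
    and horizon: "filterlim (\<lambda>n. real n * \<delta> n) at_top sequentially"
begin

interpretation E: prob_space "exp_measure r" using r by (rule prob_space_exponential_density)

lemma stopped_dividend_measurable:
  "\<omega> \<in> space M \<Longrightarrow> payout \<theta> \<omega> \<in> borel_measurable borel"
  by (intro borel_measurable_mono_real stopped_dividend_mono X_bdd_above ruin_time_nonneg)

lemma \<delta>_pos': "\<forall>\<^sub>F n in sequentially. 0 < \<delta> n"
  using eventually_ge_at_top[of 1] by eventually_elim (rule \<delta>_pos)

lemma truncated_value_limit: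
  assumes \<omega>: "\<omega> \<in> space M" and K: "0 \<le> K"
  shows "(\<lambda>n. discounted r (\<delta> n) n (\<lambda>k. min (grid_payout \<theta> (\<lambda>k. X (real k * \<delta> n) \<omega>) k) K))
    \<longlonglongrightarrow> truncated_value r \<theta> K \<omega>"
  unfolding discounted_def truncated_value_def
proof (rule integral_dominated_convergence[where w="\<lambda>_. K"])
  show "(\<lambda>s. min (payout \<theta> \<omega> s) K) \<in> borel_measurable (exp_measure r)"
    using stopped_dividend_measurable[OF \<omega>] by simp
  show "AE s in exp_measure r.
      (\<lambda>n. min (grid_payout \<theta> (\<lambda>k. X (real k * \<delta> n) \<omega>) (min n (grid_index (\<delta> n) s))) K)
      \<longlonglongrightarrow> min (payout \<theta> \<omega> s) K"
    using AE_exp_measure_positive[OF r] AE_exp_measure_neq[OF r, of "ruin_time \<theta> (\<lambda>t. X t \<omega>)"]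
  proof eventually_elim
    case (elim s)
    then show ?case
      by (intro tendsto_min tendsto_const grid_payout_tendsto X_right_continuous[OF \<omega>]
          X_bdd_above[OF \<omega>] X_no_up_jump[OF \<omega>] \<theta> \<delta>_pos' \<delta>_0 horizon)
  qed
  show "AE s in exp_measure r. norm (min (grid_payout \<theta> (\<lambda>k. X (real k * \<delta> n) \<omega>) (min n (grid_index (\<delta> n) s))) K) \<le> K" for n
    using K grid_payout_nonneg by (auto simp: abs_le_iff)
qed (use K in auto)

lemma truncated_grid_measurable:
  "1 \<le> n \<Longrightarrow> (\<lambda>\<omega>. discounted r (\<delta> n) n (\<lambda>k. min (grid_payout \<theta> (\<lambda>k. X (real k * \<delta> n) \<omega>) k) K)) \<in> borel_measurable M"
  using \<delta>_pos[of n]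
  by (intro discounted_measurable r borel_measurable_min grid_payout_measurable X_measurable) auto

text \<open>Obtained as a limit of functions of finitely many values of the path, which bypasses the
  joint measurability of ruin time and running supremum.\<close>

lemma truncated_value_measurable: "0 \<le> K \<Longrightarrow> truncated_value r \<theta> K \<in> borel_measurable M"
  by (rule borel_measurable_LIMSEQ_real[OF truncated_value_limit[THEN LIMSEQ_Suc] truncated_grid_measurable]) auto

lemma truncated_value_bounds: "0 \<le> K \<Longrightarrow> 0 \<le> truncated_value r \<theta> K \<omega>" "0 \<le> K \<Longrightarrow> \<omega> \<in> space M \<Longrightarrow> truncated_value r \<theta> K \<omega> \<le> K"
proof -
  show "0 \<le> truncated_value r \<theta> K \<omega>" if "0 \<le> K"
    unfolding truncated_value_def using that stopped_dividend_nonneg by (intro Bochner_Integration.integral_nonneg) auto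
  assume K: "0 \<le> K" and \<omega>: "\<omega> \<in> space M"
  have "truncated_value r \<theta> K \<omega> \<le> (LINT s|exp_measure r. K)"
    unfolding truncated_value_def
  proof (rule integral_mono)
    show "integrable (exp_measure r) (\<lambda>s. min (payout \<theta> \<omega> s) K)"
      using stopped_dividend_measurable[OF \<omega>] K stopped_dividend_nonneg
      by (intro E.integrable_const_bound[where B=K]) (auto simp: abs_le_iff)
  qed auto
  then show "truncated_value r \<theta> K \<omega> \<le> K" using E.prob_space by simp
qed

text \<open>The extended nonnegative integral may be infinite for some outcomes, where the path
  functional defaults to 0; keeping \<open>enn2real\<close> outside the supremum covers them
  too.\<close>

lemma h_path_eq_SUP:
  assumes \<omega>: "\<omega> \<in> space M"
  shows "h_path r \<theta> (\<lambda>t. X t \<omega>) = enn2real (SUP K. ennreal (truncated_value r \<theta> (real K) \<omega>))"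
proof -
  let ?f = "payout \<theta> \<omega>"
  have [measurable]: "?f \<in> borel_measurable borel" by (rule stopped_dividend_measurable[OF \<omega>])
  have f_eq: "ennreal (?f s) = (SUP K. ennreal (min (?f s) (real K)))" for s
  proof (rule antisym)
    obtain K :: nat where "?f s \<le> real K" using real_arch_simple by blast
    then show "ennreal (?f s) \<le> (SUP K. ennreal (min (?f s) (real K)))"
      by (intro SUP_upper2[of K]) (auto simp: min_absorb1)
    show "(SUP K. ennreal (min (?f s) (real K))) \<le> ennreal (?f s)"
      by (rule SUP_least) (auto intro!: ennreal_leI)
  qed
  have "(\<integral>\<^sup>+s. ennreal (?f s) \<partial>exp_measure r) = (\<integral>\<^sup>+s. (SUP K. ennreal (min (?f s) (real K))) \<partial>exp_measure r)"
    by (simp add: f_eq[symmetric])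
  also have "\<dots> = (SUP K. \<integral>\<^sup>+s. ennreal (min (?f s) (real K)) \<partial>exp_measure r)"
    by (rule nn_integral_monotone_convergence_SUP) (auto intro!: incseq_SucI le_funI ennreal_leI min.mono)
  also have "(\<lambda>K. \<integral>\<^sup>+s. ennreal (min (?f s) (real K)) \<partial>exp_measure r) = (\<lambda>K. ennreal (truncated_value r \<theta> (real K) \<omega>))"
  proof (rule ext)
    fix K :: nat
    show "(\<integral>\<^sup>+s. ennreal (min (?f s) (real K)) \<partial>exp_measure r) = ennreal (truncated_value r \<theta> (real K) \<omega>)"
      unfolding truncated_value_def using stopped_dividend_nonneg
      by (intro nn_integral_eq_integral E.integrable_const_bound[where B="real K"]) (auto simp: abs_le_iff)
  qed
  finally show ?thesis
    unfolding h_path_def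
    by (subst discounted_dividends_eq[OF r X_bdd_above[OF \<omega>] ruin_time_nonneg]) simp
qed

lemma truncated_value_mono: "\<omega> \<in> space M \<Longrightarrow> 0 \<le> K \<Longrightarrow> K \<le> L \<Longrightarrow> truncated_value r \<theta> K \<omega> \<le> truncated_value r \<theta> L \<omega>"
  unfolding truncated_value_def using stopped_dividend_nonneg stopped_dividend_measurable
  by (intro integral_mono E.integrable_const_bound[where B=K] E.integrable_const_bound[where B=L])
    (auto simp: abs_le_iff)

private abbreviation "capped_mean K n \<equiv> expectation (truncated_grid_value r \<theta> K (\<delta> n) n)"
private abbreviation "grid_mean n \<equiv> expectation (grid_value r \<theta> (\<delta> n) n)"

lemma truncated_grid_value_expectation_limit:
  assumes K: "0 \<le> K"
  shows "(\<lambda>n. capped_mean K n) \<longlonglongrightarrow> expectation (truncated_value r \<theta> K)"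
proof -
  let ?g = "\<lambda>n \<omega>. discounted r (\<delta> n) n (\<lambda>k. min (grid_payout \<theta> (\<lambda>k. X (real k * \<delta> n) \<omega>) k) K)"
  \<comment> \<open>Shifted by one because the mesh is known to be positive from n = 1 on.\<close>
  have "(\<lambda>n. expectation (?g (Suc n))) \<longlonglongrightarrow> expectation (truncated_value r \<theta> K)"
  proof (rule integral_dominated_convergence[where w="\<lambda>_. K"])
    show "AE \<omega> in M. (\<lambda>n. ?g (Suc n) \<omega>) \<longlonglongrightarrow> truncated_value r \<theta> K \<omega>"
      using truncated_value_limit[OF _ K] by (auto intro!: AE_I2 LIMSEQ_Suc)
    show "AE \<omega> in M. norm (?g (Suc n) \<omega>) \<le> K" for n
    proof (rule AE_I2)
      fix \<omega>
      have \<delta>: "0 < \<delta> (Suc n)" by (rule \<delta>_pos) simp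
      have "0 \<le> ?g (Suc n) \<omega>"
        using K grid_payout_nonneg by (intro discounted_nonneg r \<delta>) auto
      moreover have "?g (Suc n) \<omega> \<le> discounted r (\<delta> (Suc n)) (Suc n) (\<lambda>_. K)"
        by (intro discounted_mono r \<delta>) auto
      ultimately show "norm (?g (Suc n) \<omega>) \<le> K" using discounted_const[OF r \<delta>] by simp
    qed
  qed (use K truncated_value_measurable truncated_grid_measurable in auto)
  then have "(\<lambda>n. expectation (?g n)) \<longlonglongrightarrow> expectation (truncated_value r \<theta> K)"
    by (rule LIMSEQ_imp_Suc)
  moreover have "\<forall>\<^sub>F n in sequentially. expectation (?g n) = capped_mean K n"
    using eventually_ge_at_top[of 1]
  proof eventually_elim
    case (elim n)
    have walk_meas: "(\<lambda>\<omega>. X_walk (\<delta> n) \<omega> k) \<in> borel_measurable M" for k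
      using \<delta>_pos[OF elim] by (intro walk_measurable grid_increment_X_measurable) auto
    show ?case
    proof (rule integral_cong_AE)
      show "truncated_grid_value r \<theta> K (\<delta> n) n \<in> borel_measurable M"
        unfolding truncated_grid_value_def[abs_def] using \<delta>_pos[OF elim]
        by (intro discounted_measurable r borel_measurable_min grid_payout_measurable walk_meas) auto
      \<comment> \<open>The walk starts at \<open>u\<close>, the path only almost surely, so the two
        grid values are identified outside a null set.\<close>
      show "AE \<omega> in M. ?g n \<omega> = truncated_grid_value r \<theta> K (\<delta> n) n \<omega>"
        using AE_X_0
      proof eventually_elim
        case (elim \<omega>)
        then have "X_walk (\<delta> n) \<omega> = (\<lambda>k. X (real k * \<delta> n) \<omega>)"
          using walk_increments[OF \<delta>_pos[OF \<open>1 \<le> n\<close>], of \<omega>] by (simp add: fun_eq_iff)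
        then show ?case by (simp add: truncated_grid_value_def)
      qed
    qed (rule truncated_grid_measurable[OF elim])
  qed
  ultimately show ?thesis by (rule Lim_transform_eventually)
qed

lemma grid_value_properties:
  assumes n: "1 \<le> n" "\<delta> n \<le> 1" and K: "0 < K"
  defines "C \<equiv> second_moment_bound r"
  shows "integrable M (grid_value r \<theta> (\<delta> n) n)"
    and "integrable M (truncated_grid_value r \<theta> K (\<delta> n) n)"
    and "capped_mean K n \<le> grid_mean n"
    and "grid_mean n \<le> capped_mean K n + C / K"
proof -
  note \<delta> = \<delta>_pos[OF n(1)]
  let ?y = "\<lambda>\<omega>. grid_payout \<theta> (X_walk (\<delta> n) \<omega>)"
  have y_meas: "(\<lambda>\<omega>. ?y \<omega> k) \<in> borel_measurable M" for k
    using \<delta> by (intro grid_payout_measurable walk_measurable grid_increment_X_measurable) auto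
  note sq = grid_payout_square_moment(1)[OF \<delta> \<theta>(1)]
  have y_int: "integrable M (\<lambda>\<omega>. ?y \<omega> k)" for k
    by (rule square_integrable_imp_integrable[OF y_meas sq])
  show i1: "integrable M (grid_value r \<theta> (\<delta> n) n)"
    unfolding grid_value_def[abs_def] by (rule discounted_expectation(1)[OF r \<delta> y_int])
  show i2: "integrable M (truncated_grid_value r \<theta> K (\<delta> n) n)"
    unfolding truncated_grid_value_def[abs_def]
    by (rule discounted_expectation(1)[OF r \<delta>]) (intro integrable_min y_int, simp)
  show "capped_mean K n \<le> grid_mean n"
    by (intro integral_mono i1 i2) (auto simp: grid_value_def truncated_grid_value_def intro!: discounted_mono r \<delta>)
  define q where "q = (\<lambda>\<omega>. discounted r (\<delta> n) n (\<lambda>k. (?y \<omega> k)\<^sup>2))"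
  have q: "integrable M q" "expectation q \<le> C"
    unfolding q_def C_def by (rule discounted_second_moment[OF r \<delta> n(2) \<theta>(1)])+
  have "grid_mean n \<le> expectation (\<lambda>\<omega>. truncated_grid_value r \<theta> K (\<delta> n) n \<omega> + q \<omega> / K)"
    using discounted_le_truncated[OF r \<delta> K grid_payout_nonneg]
    by (intro integral_mono i1 i2 q Bochner_Integration.integrable_add integrable_divide_zero)
      (auto simp: grid_value_def truncated_grid_value_def q_def)
  also have "\<dots> = capped_mean K n + expectation q / K"
    using i2 q by simp
  also have "\<dots> \<le> capped_mean K n + C / K"
    using q K by (intro add_left_mono divide_right_mono) auto
  finally show "grid_mean n \<le> capped_mean K n + C / K" .
qed

text \<open>Each capped mean converges, and the error C / K of capping does not depend on n; this
  allows the limits in n and K to be exchanged. Monotone convergence identifies the result.\<close>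

lemma grid_value_expectation_limit:
  "(\<lambda>n. grid_mean n) \<longlonglongrightarrow> (LINT \<omega>|M. h_path r \<theta> (\<lambda>t. X t \<omega>))"
proof -
  define C where "C = second_moment_bound r"
  define a where "a K = expectation (truncated_value r \<theta> K)" for K
  have ev: "\<forall>\<^sub>F n in sequentially. 1 \<le> n \<and> \<delta> n \<le> 1"
    using eventually_ge_at_top[of 1] order_tendstoD(2)[OF \<delta>_0, of 1]
    by (auto elim!: eventually_elim2)
  have tv_int: "integrable M (truncated_value r \<theta> K)" if "0 \<le> K" for K
    using truncated_value_bounds truncated_value_measurable that
    by (intro integrable_const_bound[where B=K]) auto
  have a_mono: "a K \<le> a L" if "0 \<le> K" "K \<le> L" for K L
    unfolding a_def using that by (intro integral_mono tv_int truncated_value_mono) auto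
  \<comment> \<open>Comparing every cap with the cap 1 bounds all capped limits by 1 + C, so their
    supremum is a real number.\<close>
  have a_bound: "a K \<le> 1 + C" if "0 < K" for K
  proof (rule tendsto_upperbound[OF truncated_grid_value_expectation_limit[of K, folded a_def]])
    show "\<forall>\<^sub>F n in sequentially. capped_mean K n \<le> 1 + C"
      using ev
    proof eventually_elim
      case (elim n)
      have "capped_mean K n \<le> grid_mean n"
        using elim that by (intro grid_value_properties) auto
      also have "\<dots> \<le> capped_mean 1 n + C / 1"
        unfolding C_def using elim by (intro grid_value_properties) auto
      also have "capped_mean 1 n \<le> expectation (\<lambda>_. 1)"
      proof (rule integral_mono)
        have \<delta>: "0 < \<delta> n" using elim by (intro \<delta>_pos) auto
        show "truncated_grid_value r \<theta> 1 (\<delta> n) n \<omega> \<le> 1" for \<omega>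
          using discounted_mono[OF r \<delta>, of n _ "\<lambda>_. 1"] discounted_const[OF r \<delta>, of n 1]
          by (auto simp: truncated_grid_value_def)
      qed (use elim grid_value_properties(2)[of n 1] in auto)
      finally show ?case using prob_space by simp
    qed
  qed (use that in auto)
  define P where "P = (SUP K::nat. a (real K))"
  have bdd: "bdd_above (range (\<lambda>K::nat. a (real K)))"
  proof (rule bdd_aboveI2)
    fix K :: nat
    have "a (real K) \<le> a (real (Suc K))" by (intro a_mono) auto
    also have "\<dots> \<le> 1 + C" by (intro a_bound) auto
    finally show "a (real K) \<le> 1 + C" .
  qed
  have "(LINT \<omega>|M. h_path r \<theta> (\<lambda>t. X t \<omega>)) = P"
  proof -
    let ?N = "\<lambda>\<omega>. SUP K. ennreal (truncated_value r \<theta> (real K) \<omega>)"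
    have [measurable]: "truncated_value r \<theta> (real K) \<in> borel_measurable M" for K :: nat
      by (rule truncated_value_measurable) simp
    have a_nonneg: "0 \<le> a (real K)" for K :: nat
      unfolding a_def using truncated_value_bounds(1) by (intro Bochner_Integration.integral_nonneg) auto
    have "(\<integral>\<^sup>+\<omega>. ?N \<omega> \<partial>M) = (SUP K. \<integral>\<^sup>+\<omega>. ennreal (truncated_value r \<theta> (real K) \<omega>) \<partial>M)"
      by (rule nn_integral_monotone_convergence_SUP_AE)
        (auto intro!: AE_I2 ennreal_leI truncated_value_mono)
    also have "\<dots> = (SUP K::nat. ennreal (a (real K)))"
      unfolding a_def using truncated_value_bounds(1)
      by (intro SUP_cong refl nn_integral_eq_integral tv_int) auto
    also have "\<dots> = ennreal P"
      unfolding P_def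
      by (rule LIMSEQ_unique[OF LIMSEQ_SUP tendsto_ennrealI[OF LIMSEQ_incseq_SUP[OF bdd]]])
        (auto intro!: incseq_SucI ennreal_leI a_mono)
    finally have N: "(\<integral>\<^sup>+\<omega>. ?N \<omega> \<partial>M) = ennreal P" .
    have N_meas: "?N \<in> borel_measurable M" by measurable
    \<comment> \<open>The finite mean excludes infinite values almost surely, so the default of
      \<open>enn2real\<close> does not affect the integral.\<close>
    have fin: "AE \<omega> in M. ?N \<omega> \<noteq> \<infinity>"
      using nn_integral_PInf_AE[OF N_meas] N by simp
    have "0 \<le> P" unfolding P_def using cSUP_upper2[OF bdd, of 0 0] a_nonneg[of 0] by auto
    have "(LINT \<omega>|M. h_path r \<theta> (\<lambda>t. X t \<omega>)) = (LINT \<omega>|M. enn2real (?N \<omega>))"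
      by (rule Bochner_Integration.integral_cong[OF refl h_path_eq_SUP])
    also have "\<dots> = enn2real (\<integral>\<^sup>+\<omega>. ennreal (enn2real (?N \<omega>)) \<partial>M)"
      using N_meas by (intro integral_eq_nn_integral) auto
    also have "(\<integral>\<^sup>+\<omega>. ennreal (enn2real (?N \<omega>)) \<partial>M) = (\<integral>\<^sup>+\<omega>. ?N \<omega> \<partial>M)"
    proof (rule nn_integral_cong_AE)
      show "AE \<omega> in M. ennreal (enn2real (?N \<omega>)) = ?N \<omega>"
        using fin by eventually_elim (simp only: ennreal_enn2real_if infinity_ennreal_def if_False)
    qed
    finally show ?thesis using N \<open>0 \<le> P\<close> by simp
  qed
  moreover have "(\<lambda>n. grid_mean n) \<longlonglongrightarrow> P"
  proof (rule tendstoI)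
    fix e :: real assume e: "0 < e"
    obtain K0 :: nat where K0: "P - e / 2 < a (real K0)"
      using less_cSUP_iff[OF _ bdd, of "P - e / 2"] e by (auto simp: P_def)
    obtain K1 :: nat where K1: "2 * C / e < real K1" using reals_Archimedean2 by blast
    \<comment> \<open>Large enough for the limit of the capped means to be within e / 2 of P and for
      C / K to be below e / 2; \<open>Suc\<close> keeps it positive.\<close>
    define K where "K = real (max (Suc K0) K1)"
    have K: "0 < K" "P - e / 2 < a K" "a K \<le> P"
    proof -
      show "0 < K" by (simp add: K_def)
      have "a (real K0) \<le> a K" by (rule a_mono) (auto simp: K_def)
      then show "P - e / 2 < a K" using K0 by simp
      show "a K \<le> P" unfolding P_def K_def by (intro cSUP_upper bdd) auto
    qed
    have "2 * C / e < K" using K1 by (simp add: K_def)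
    then have CK: "C / K < e / 2" using K(1) e by (simp add: field_simps)
    have "0 < e / 2" using e by simp
    from eventually_conj[OF tendstoD[OF truncated_grid_value_expectation_limit[of K] this] ev] K(1)
    have "\<forall>\<^sub>F n in sequentially. dist (capped_mean K n) (a K) < e / 2 \<and> 1 \<le> n \<and> \<delta> n \<le> 1"
      unfolding a_def by simp
    then show "\<forall>\<^sub>F n in sequentially. dist (grid_mean n) P < e"
    proof eventually_elim
      case (elim n)
      have "capped_mean K n \<le> grid_mean n"
        "grid_mean n \<le> capped_mean K n + C / K"
        using grid_value_properties(3,4)[of n K, folded C_def] elim K(1) by auto
      then show ?case using elim K CK unfolding dist_real_def by linarith
    qed
  qed
  ultimately show ?thesis by simp
qed

end

end

section \<open>The law of large numbers for a fixed barrier\<close>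

lemma walk_cong: "(\<And>j. j \<in> {1..k} \<Longrightarrow> d j = d' j) \<Longrightarrow> walk u d k = walk u d' k"
  unfolding walk_def by (intro arg_cong2[of _ _ _ _ "(+)"] sum.cong) auto

lemma discounted_cong: "(\<And>k. k \<le> n \<Longrightarrow> f k = g k) \<Longrightarrow> discounted r \<delta> n f = discounted r \<delta> n g"
  unfolding discounted_def by (intro Bochner_Integration.integral_cong) auto

text \<open>\<phi> is meant to be the identity, a cap or the square, so that one measurability and
  invariance argument serves all three.\<close>

definition walk_value :: "(real \<Rightarrow> real) \<Rightarrow> real \<Rightarrow> real \<Rightarrow> real \<Rightarrow> real \<Rightarrow> nat \<Rightarrow> (nat \<Rightarrow> real) \<Rightarrow> real" where
  "walk_value \<phi> r u \<theta> \<delta> n d = discounted r \<delta> n (\<lambda>k. \<phi> (grid_payout \<theta> (walk u d) k))"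

lemma walk_value_cong:
  "(\<And>j. j \<in> {1..n} \<Longrightarrow> d j = d' j) \<Longrightarrow> walk_value \<phi> r u \<theta> \<delta> n d = walk_value \<phi> r u \<theta> \<delta> n d'"
  unfolding walk_value_def
  by (intro discounted_cong arg_cong[of _ _ \<phi>] grid_payout_cong walk_cong) auto

lemma apply_selected_walk_value:
  "apply_selected D n (walk_value \<phi> r u \<theta> \<delta> n) \<pi> \<omega> = walk_value \<phi> r u \<theta> \<delta> n (\<lambda>j. D (\<pi> j) \<omega>)"
  unfolding apply_selected_def by (rule walk_value_cong) auto

lemma walk_value_measurable:
  assumes "0 < r" "0 < \<delta>" "\<phi> \<in> borel_measurable borel"
    and "\<And>j. j \<in> {1..n} \<Longrightarrow> (\<lambda>\<omega>. d \<omega> j) \<in> borel_measurable N"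
  shows "(\<lambda>\<omega>. walk_value \<phi> r u \<theta> \<delta> n (d \<omega>)) \<in> borel_measurable N"
  unfolding walk_value_def
  by (intro discounted_measurable assms measurable_compose[OF _ assms(3)]
      grid_payout_measurable walk_measurable) auto

lemma walk_value_measurable_PiM:
  assumes "0 < r" "0 < \<delta>" "\<phi> \<in> borel_measurable borel"
  shows "walk_value \<phi> r u \<theta> \<delta> n \<in> borel_measurable (PiM {1..n} (\<lambda>_. borel))"
  using walk_value_measurable[OF assms, of n "\<lambda>d. d" "PiM {1..n} (\<lambda>_. borel)"]
  by (simp add: measurable_component_singleton)

lemma truncated_walk_value_bounds:
  assumes "0 < r" "0 < \<delta>" "0 \<le> K"
  shows "0 \<le> walk_value (\<lambda>y. min y K) r u \<theta> \<delta> n d" "walk_value (\<lambda>y. min y K) r u \<theta> \<delta> n d \<le> K"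
proof -
  show "0 \<le> walk_value (\<lambda>y. min y K) r u \<theta> \<delta> n d"
    unfolding walk_value_def using assms grid_payout_nonneg
    by (intro discounted_nonneg) auto
  show "walk_value (\<lambda>y. min y K) r u \<theta> \<delta> n d \<le> K"
    unfolding walk_value_def
    using discounted_mono[OF assms(1,2), of n "\<lambda>k. min (grid_payout \<theta> (walk u d) k) K" "\<lambda>_. K"]
      discounted_const[OF assms(1,2)] by simp
qed

text \<open>The first term pays for the cap through the second moment, the second one for stopping
  the capped payout after m steps.\<close>

lemma walk_value_truncation_error:
  assumes r: "0 < r" and \<delta>: "0 < \<delta>" and K: "0 < K" and "m \<le> n"
  shows "\<bar>walk_value (\<lambda>y. y) r u \<theta> \<delta> n d - walk_value (\<lambda>y. min y K) r u \<theta> \<delta> m d\<bar>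
    \<le> walk_value (\<lambda>y. y\<^sup>2) r u \<theta> \<delta> n d / K + K * exp (- r * (real m * \<delta>))"
proof -
  let ?y = "grid_payout \<theta> (walk u d)"
  have "discounted r \<delta> n ?y \<le> discounted r \<delta> n (\<lambda>k. min (?y k) K) + discounted r \<delta> n (\<lambda>k. (?y k)\<^sup>2) / K"
    by (rule discounted_le_truncated[OF r \<delta> K grid_payout_nonneg])
  moreover have "discounted r \<delta> n (\<lambda>k. min (?y k) K) \<le> discounted r \<delta> n ?y"
    by (intro discounted_mono r \<delta>) auto
  moreover have "\<bar>discounted r \<delta> n (\<lambda>k. min (?y k) K) - discounted r \<delta> m (\<lambda>k. min (?y k) K)\<bar>
      \<le> K * exp (- r * (real m * \<delta>))"
    using K grid_payout_nonneg by (intro discounted_truncate[OF r \<delta> \<open>m \<le> n\<close>]) auto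
  ultimately show ?thesis unfolding walk_value_def by linarith
qed

lemma perms_inj_image: "\<pi> \<in> perms n \<Longrightarrow> inj_on \<pi> {1..n}" "\<pi> \<in> perms n \<Longrightarrow> \<pi> ` {1..n} \<subseteq> {1..n}"
  unfolding perms_def by (simp_all add: permutes_inj_on permutes_image)

lemma id_in_perms: "id \<in> perms n"
  by (simp add: perms_def permutes_id)

section \<open>Functionals of permuted increments\<close>

context risk_model
begin

definition permuted_value :: "(real \<Rightarrow> real) \<Rightarrow> real \<Rightarrow> real \<Rightarrow> real \<Rightarrow> nat \<Rightarrow> (nat \<Rightarrow> nat) \<Rightarrow> 'a \<Rightarrow> real" where
  "permuted_value \<phi> r \<theta> \<delta> n \<pi> \<omega> = walk_value \<phi> r u \<theta> \<delta> n (\<lambda>j. grid_increment X \<delta> (\<pi> j) \<omega>)"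

lemma permuted_value_apply_selected:
  "permuted_value \<phi> r \<theta> \<delta> n \<pi> = apply_selected (grid_increment X \<delta>) n (walk_value \<phi> r u \<theta> \<delta> n) \<pi>"
  by (simp add: fun_eq_iff permuted_value_def apply_selected_walk_value)

lemma grid_value_eq_permuted: "grid_value r \<theta> \<delta> n = permuted_value (\<lambda>y. y) r \<theta> \<delta> n id"
  by (simp add: fun_eq_iff grid_value_def permuted_value_def walk_value_def)

context
  fixes r \<theta> \<delta> :: real and n :: nat
  assumes r: "0 < r" and \<theta>: "u \<le> \<theta>" and \<delta>: "0 < \<delta>" "\<delta> \<le> 1" and n: "1 \<le> n"
begin

lemma permuted_value_path_measurable:
  "\<phi> \<in> borel_measurable borel \<Longrightarrow> permuted_value \<phi> r \<theta> \<delta> m \<pi> \<in> borel_measurable (path_algebra X)"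
  unfolding permuted_value_def[abs_def] grid_increment_def using \<delta>
  by (intro walk_value_measurable r borel_measurable_diff path_algebra_measurable) auto

lemma permuted_value_measurable:
  "\<phi> \<in> borel_measurable borel \<Longrightarrow> permuted_value \<phi> r \<theta> \<delta> m \<pi> \<in> borel_measurable M"
  unfolding permuted_value_def[abs_def] using \<delta>
  by (intro walk_value_measurable r grid_increment_X_measurable) auto

text \<open>Exchangeability of the increments: mean and integrability can be read off from the
  unpermuted walk, where the second moment bound was proved.\<close>

lemma permuted_value_law:
  assumes \<pi>: "\<pi> \<in> perms n" and \<phi>: "\<phi> \<in> borel_measurable borel"
  shows "expectation (permuted_value \<phi> r \<theta> \<delta> n \<pi>) = expectation (permuted_value \<phi> r \<theta> \<delta> n id)"
    and "integrable M (permuted_value \<phi> r \<theta> \<delta> n \<pi>) \<longleftrightarrow> integrable M (permuted_value \<phi> r \<theta> \<delta> n id)"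
  unfolding permuted_value_apply_selected
  using integral_selected_cong[OF indep_grid_increments[OF \<delta>(1)] grid_increment_X_distr[OF \<delta>(1)] n order_refl
      perms_inj_image[OF \<pi>] perms_inj_image[OF id_in_perms] walk_value_measurable_PiM[OF r \<delta>(1) \<phi>]]
  by auto

lemma permuted_value_second_moment:
  assumes "\<pi> \<in> perms n"
  shows "integrable M (permuted_value (\<lambda>y. y\<^sup>2) r \<theta> \<delta> n \<pi>)"
    and "expectation (permuted_value (\<lambda>y. y\<^sup>2) r \<theta> \<delta> n \<pi>) \<le> second_moment_bound r"
proof -
  have eq: "permuted_value (\<lambda>y. y\<^sup>2) r \<theta> \<delta> n id
      = (\<lambda>\<omega>. discounted r \<delta> n (\<lambda>k. (grid_payout \<theta> (X_walk \<delta> \<omega>) k)\<^sup>2))"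
    by (simp add: fun_eq_iff permuted_value_def walk_value_def)
  show "integrable M (permuted_value (\<lambda>y. y\<^sup>2) r \<theta> \<delta> n \<pi>)"
    using permuted_value_law(2)[OF assms] discounted_second_moment(1)[OF r \<delta> \<theta>, of n] by (simp add: eq)
  show "expectation (permuted_value (\<lambda>y. y\<^sup>2) r \<theta> \<delta> n \<pi>) \<le> second_moment_bound r"
    using permuted_value_law(1)[OF assms] discounted_second_moment(2)[OF r \<delta> \<theta>, of n] by (simp add: eq)
qed

text \<open>Dominated through y \<le> min y 1 + y^2.\<close>

lemma permuted_value_integrable:
  assumes \<pi>: "\<pi> \<in> perms n" shows "integrable M (permuted_value (\<lambda>y. y) r \<theta> \<delta> n \<pi>)"
proof (rule Bochner_Integration.integrable_bound)
  show "integrable M (\<lambda>\<omega>. permuted_value (\<lambda>y. min y 1) r \<theta> \<delta> n \<pi> \<omega> + permuted_value (\<lambda>y. y\<^sup>2) r \<theta> \<delta> n \<pi> \<omega>)"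
    using truncated_walk_value_bounds[OF r \<delta>(1), of 1]
    by (intro Bochner_Integration.integrable_add permuted_value_second_moment(1)[OF \<pi>]
        integrable_const_bound[where B=1] permuted_value_measurable) (auto simp: permuted_value_def)
  show "AE \<omega> in M. norm (permuted_value (\<lambda>y. y) r \<theta> \<delta> n \<pi> \<omega>)
      \<le> norm (permuted_value (\<lambda>y. min y 1) r \<theta> \<delta> n \<pi> \<omega> + permuted_value (\<lambda>y. y\<^sup>2) r \<theta> \<delta> n \<pi> \<omega>)"
  proof (rule AE_I2)
    fix \<omega>
    let ?y = "grid_payout \<theta> (walk u (\<lambda>j. grid_increment X \<delta> (\<pi> j) \<omega>))"
    have "0 \<le> discounted r \<delta> n ?y"
      by (intro discounted_nonneg r \<delta> grid_payout_nonneg)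
    moreover have "discounted r \<delta> n ?y \<le> discounted r \<delta> n (\<lambda>k. min (?y k) 1) + discounted r \<delta> n (\<lambda>k. (?y k)\<^sup>2) / 1"
      by (rule discounted_le_truncated[OF r \<delta>(1) zero_less_one grid_payout_nonneg])
    ultimately show "norm (permuted_value (\<lambda>y. y) r \<theta> \<delta> n \<pi> \<omega>)
      \<le> norm (permuted_value (\<lambda>y. min y 1) r \<theta> \<delta> n \<pi> \<omega> + permuted_value (\<lambda>y. y\<^sup>2) r \<theta> \<delta> n \<pi> \<omega>)"
      by (simp add: permuted_value_def walk_value_def)
  qed
qed (simp add: permuted_value_measurable)

context
  fixes a :: nat and I :: "nat \<Rightarrow> 'a \<Rightarrow> nat \<Rightarrow> nat"
  assumes sample: "uniform_perm_sample X n a I" and a: "1 \<le> a"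
begin

lemma sample_mean_integrable: "integrable M (\<lambda>\<omega>. (\<Sum>k=1..a. permuted_value (\<lambda>y. y) r \<theta> \<delta> n (I k \<omega>) \<omega>) / a)"
  by (intro Bochner_Integration.integrable_divide Bochner_Integration.integrable_sum
      expectation_sample(1)[where Z="permuted_value (\<lambda>y. y) r \<theta> \<delta> n", OF sample a] permuted_value_path_measurable permuted_value_integrable) auto

text \<open>The capped functional stopped after m steps is a kernel of order m, whose sample mean
  has variance at most K^2 / a + K^2 / L. The replacement costs C / K plus a discount term twice: in
  the sample mean and in the centring constant.\<close>

lemma sample_mean_deviation:
  assumes K: "0 < K" and \<eta>: "0 < \<eta>" and m: "1 \<le> m" "m \<le> n" and L: "1 \<le> L" "L * m \<le> n"
  defines "C \<equiv> second_moment_bound r"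
  shows "expectation (\<lambda>\<omega>. \<bar>(\<Sum>k=1..a. permuted_value (\<lambda>y. y) r \<theta> \<delta> n (I k \<omega>) \<omega>) / a - expectation (grid_value r \<theta> \<delta> n)\<bar>)
    \<le> \<eta> + (K\<^sup>2 / a + K\<^sup>2 / L) / \<eta> + 2 * (C / K + K * exp (- r * (real m * \<delta>)))"
proof -
  let ?H = "permuted_value (\<lambda>y. y) r \<theta> \<delta> n" and ?G = "permuted_value (\<lambda>y. min y K) r \<theta> \<delta> m"
    and ?Q = "permuted_value (\<lambda>y. y\<^sup>2) r \<theta> \<delta> n"
  define B where "B = C / K + K * exp (- r * (real m * \<delta>))"
  define g where "g = expectation (?G id)"
  have G_bounds: "0 \<le> ?G \<pi> \<omega>" "?G \<pi> \<omega> \<le> K" for \<pi> \<omega>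
    using truncated_walk_value_bounds[OF r \<delta>(1), of K] K by (simp_all add: permuted_value_def)
  have G_meas: "?G \<pi> \<in> borel_measurable M" for \<pi> by (rule permuted_value_measurable) simp
  have G_int: "integrable M (?G \<pi>)" for \<pi>
    using G_bounds by (intro integrable_const_bound[where B=K] G_meas) auto
  have g: "0 \<le> g" "g \<le> K"
  proof -
    show "0 \<le> g" unfolding g_def using G_bounds by (intro Bochner_Integration.integral_nonneg) auto
    have "g \<le> expectation (\<lambda>_. K)" unfolding g_def using G_bounds by (intro integral_mono G_int) auto
    then show "g \<le> K" using prob_space by simp
  qed
  have diff: "\<bar>?H \<pi> \<omega> - ?G \<pi> \<omega>\<bar> \<le> ?Q \<pi> \<omega> / K + K * exp (- r * (real m * \<delta>))" for \<pi> \<omega>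
    unfolding permuted_value_def by (rule walk_value_truncation_error[OF r \<delta>(1) K m(2)])
  have diff_int: "integrable M (\<lambda>\<omega>. \<bar>?H \<pi> \<omega> - ?G \<pi> \<omega>\<bar>)"
    and diff_le: "expectation (\<lambda>\<omega>. \<bar>?H \<pi> \<omega> - ?G \<pi> \<omega>\<bar>) \<le> B" if \<pi>: "\<pi> \<in> perms n" for \<pi>
  proof -
    show int: "integrable M (\<lambda>\<omega>. \<bar>?H \<pi> \<omega> - ?G \<pi> \<omega>\<bar>)"
      by (intro integrable_abs Bochner_Integration.integrable_diff permuted_value_integrable \<pi> G_int)
    have "expectation (\<lambda>\<omega>. \<bar>?H \<pi> \<omega> - ?G \<pi> \<omega>\<bar>) \<le> expectation (\<lambda>\<omega>. ?Q \<pi> \<omega> / K + K * exp (- r * (real m * \<delta>)))"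
      by (intro integral_mono int diff Bochner_Integration.integrable_add integrable_divide_zero permuted_value_second_moment \<pi>) auto
    also have "\<dots> = expectation (?Q \<pi>) / K + K * exp (- r * (real m * \<delta>))"
      using permuted_value_second_moment(1)[OF \<pi>] prob_space by simp
    also have "\<dots> \<le> B"
      unfolding B_def C_def using permuted_value_second_moment(2)[OF \<pi>] K by (intro add_right_mono divide_right_mono) auto
    finally show "expectation (\<lambda>\<omega>. \<bar>?H \<pi> \<omega> - ?G \<pi> \<omega>\<bar>) \<le> B" .
  qed
  have bias: "\<bar>g - expectation (grid_value r \<theta> \<delta> n)\<bar> \<le> B"
  proof -
    have "g - expectation (grid_value r \<theta> \<delta> n) = - expectation (\<lambda>\<omega>. ?H id \<omega> - ?G id \<omega>)"
      unfolding g_def grid_value_eq_permuted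
      by (simp add: Bochner_Integration.integral_diff permuted_value_integrable[OF id_in_perms] G_int)
    then show ?thesis
      using order_trans[OF integral_abs_bound diff_le[OF id_in_perms]] by (simp only: abs_minus_cancel)
  qed
  \<comment> \<open>\<open>PG\<close> carries the fluctuation and is controlled in L^2;
    \<open>PD\<close> carries the replacement error and is controlled in L^1.\<close>
  define PG where "PG \<omega> = (\<Sum>k=1..a. ?G (I k \<omega>) \<omega>) / a" for \<omega>
  define PD where "PD \<omega> = (\<Sum>k=1..a. \<bar>?H (I k \<omega>) \<omega> - ?G (I k \<omega>) \<omega>\<bar>) / a" for \<omega>
  have fluct: "integrable M (\<lambda>\<omega>. (PG \<omega> - g)\<^sup>2)" "expectation (\<lambda>\<omega>. (PG \<omega> - g)\<^sup>2) \<le> K\<^sup>2 / a + K\<^sup>2 / L"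
  proof -
    have path: "?G \<pi> \<in> borel_measurable (path_algebra X)" for \<pi> by (rule permuted_value_path_measurable) simp
    show "integrable M (\<lambda>\<omega>. (PG \<omega> - g)\<^sup>2)"
      unfolding PG_def by (rule variance_sample_average(2)[OF sample a path G_meas G_bounds g])
    have "expectation (\<lambda>\<omega>. ((\<Sum>\<pi>\<in>perms n. ?G \<pi> \<omega>) / fact n - g)\<^sup>2) \<le> K\<^sup>2 / L"
      unfolding g_def permuted_value_apply_selected
    proof (rule variance_permutation_average[OF indep_grid_increments[OF \<delta>(1)] grid_increment_X_distr[OF \<delta>(1)] m _ _ _ L])
      show "walk_value (\<lambda>y. min y K) r u \<theta> \<delta> m \<in> borel_measurable (PiM {1..m} (\<lambda>_. borel))"
        by (rule walk_value_measurable_PiM[OF r \<delta>(1)]) simp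
    qed (use truncated_walk_value_bounds[OF r \<delta>(1)] K in auto)
    moreover have "expectation (\<lambda>\<omega>. (PG \<omega> - g)\<^sup>2)
        \<le> K\<^sup>2 / a + expectation (\<lambda>\<omega>. ((\<Sum>\<pi>\<in>perms n. ?G \<pi> \<omega>) / fact n - g)\<^sup>2)"
      unfolding PG_def by (rule variance_sample_average(1)[OF sample a path G_meas G_bounds g])
    ultimately show "expectation (\<lambda>\<omega>. (PG \<omega> - g)\<^sup>2) \<le> K\<^sup>2 / a + K\<^sup>2 / L" by linarith
  qed
  have PD: "integrable M PD" "expectation PD \<le> B"
  proof -
    have path: "(\<lambda>\<omega>. \<bar>?H \<pi> \<omega> - ?G \<pi> \<omega>\<bar>) \<in> borel_measurable (path_algebra X)" for \<pi>
      by (intro borel_measurable_abs borel_measurable_diff permuted_value_path_measurable) auto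
    note e = expectation_sample[where Z="\<lambda>\<pi> \<omega>. \<bar>?H \<pi> \<omega> - ?G \<pi> \<omega>\<bar>", OF sample a _ path diff_int]
    show "integrable M PD" unfolding PD_def[abs_def]
      by (intro Bochner_Integration.integrable_divide Bochner_Integration.integrable_sum e(1)) auto
    have "expectation PD = (\<Sum>k=1..a. expectation (\<lambda>\<omega>. \<bar>?H (I k \<omega>) \<omega> - ?G (I k \<omega>) \<omega>\<bar>)) / a"
      unfolding PD_def[abs_def] integral_divide_zero
      by (intro arg_cong2[of _ _ _ _ "(/)"] refl Bochner_Integration.integral_sum e(1)) auto
    also have "\<dots> \<le> (\<Sum>k=1..a. B) / a"
    proof (intro divide_right_mono sum_mono)
      fix k assume k: "k \<in> {1..a}"
      have "(\<Sum>\<pi>\<in>perms n. expectation (\<lambda>\<omega>. \<bar>?H \<pi> \<omega> - ?G \<pi> \<omega>\<bar>)) / fact n \<le> (\<Sum>\<pi>\<in>perms n. B) / fact n"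
        by (intro divide_right_mono sum_mono diff_le) auto
      then show "expectation (\<lambda>\<omega>. \<bar>?H (I k \<omega>) \<omega> - ?G (I k \<omega>) \<omega>\<bar>) \<le> B"
        using e(2)[OF k] by (simp add: card_perms)
    qed simp
    also have "\<dots> = B" using a by simp
    finally show "expectation PD \<le> B" .
  qed
  have pointwise: "\<bar>(\<Sum>k=1..a. ?H (I k \<omega>) \<omega>) / a - expectation (grid_value r \<theta> \<delta> n)\<bar>
      \<le> (\<eta> + (PG \<omega> - g)\<^sup>2 / \<eta>) + PD \<omega> + B" for \<omega>
  proof -
    \<comment> \<open>This turns the L^2 bound into an L^1 bound without a square root; \<eta> is
      chosen at the end.\<close>
    have "\<bar>PG \<omega> - g\<bar> \<le> \<eta> + (PG \<omega> - g)\<^sup>2 / \<eta>"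
    proof -
      have "\<bar>PG \<omega> - g\<bar> * \<eta> \<le> \<eta> * \<eta> + \<bar>PG \<omega> - g\<bar> * \<bar>PG \<omega> - g\<bar>"
      proof (cases "\<bar>PG \<omega> - g\<bar> \<le> \<eta>")
        case True
        then have "\<bar>PG \<omega> - g\<bar> * \<eta> \<le> \<eta> * \<eta>" using \<eta> by (intro mult_right_mono) auto
        then show ?thesis by (simp add: add_increasing2)
      next
        case False
        then have "\<bar>PG \<omega> - g\<bar> * \<eta> \<le> \<bar>PG \<omega> - g\<bar> * \<bar>PG \<omega> - g\<bar>" by (intro mult_left_mono) auto
        then show ?thesis using \<eta> by (simp add: add_increasing)
      qed
      then have "\<bar>PG \<omega> - g\<bar> \<le> (\<eta> * \<eta> + \<bar>PG \<omega> - g\<bar> * \<bar>PG \<omega> - g\<bar>) / \<eta>"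
        using \<eta> by (simp only: pos_le_divide_eq)
      then show ?thesis using \<eta> by (simp add: add_divide_distrib power2_eq_square)
    qed
    moreover have "\<bar>(\<Sum>k=1..a. ?H (I k \<omega>) \<omega>) / a - PG \<omega>\<bar> \<le> PD \<omega>"
    proof -
      have "\<bar>(\<Sum>k=1..a. ?H (I k \<omega>) \<omega>) / a - PG \<omega>\<bar> = \<bar>\<Sum>k=1..a. ?H (I k \<omega>) \<omega> - ?G (I k \<omega>) \<omega>\<bar> / a"
        by (simp add: PG_def sum_subtractf diff_divide_distrib[symmetric])
      then show ?thesis unfolding PD_def by (simp add: divide_right_mono sum_abs)
    qed
    ultimately show ?thesis using bias by linarith
  qed
  have "expectation (\<lambda>\<omega>. \<bar>(\<Sum>k=1..a. ?H (I k \<omega>) \<omega>) / a - expectation (grid_value r \<theta> \<delta> n)\<bar>)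
      \<le> expectation (\<lambda>\<omega>. (\<eta> + (PG \<omega> - g)\<^sup>2 / \<eta>) + PD \<omega> + B)"
    by (intro integral_mono pointwise integrable_abs Bochner_Integration.integrable_diff sample_mean_integrable
        Bochner_Integration.integrable_add integrable_divide_zero fluct PD) auto
  also have "\<dots> = \<eta> + expectation (\<lambda>\<omega>. (PG \<omega> - g)\<^sup>2) / \<eta> + expectation PD + B"
    using fluct(1) PD(1) prob_space by simp
  also have "\<dots> \<le> \<eta> + (K\<^sup>2 / a + K\<^sup>2 / L) / \<eta> + B + B"
    using \<eta> by (intro add_mono divide_right_mono fluct PD) auto
  finally show ?thesis by (simp add: B_def)
qed

end

end

end

text \<open>Every point is rounded upwards, the direction in which the change of the dividends is
  controlled. For the same reason the left endpoint \<open>u\<close> can be left out of the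
  net.\<close>

lemma finite_upper_net:
  fixes u v \<eta> :: real
  assumes "u < v" "0 < \<eta>"
  obtains B where "finite B" "B \<subseteq> {u<..v}" "\<And>\<theta>. \<theta> \<in> {u..v} \<Longrightarrow> \<exists>b\<in>B. \<theta> \<le> b \<and> b \<le> \<theta> + \<eta>"
proof
  define N where "N = nat \<lfloor>(v - u) / \<eta>\<rfloor>"
  let ?B = "(\<lambda>j. min v (u + real (Suc j) * \<eta>)) ` {..N}"
  show "finite ?B" by simp
  show "?B \<subseteq> {u<..v}" using assms by (auto simp: add_pos_nonneg intro!: mult_pos_pos)
  fix \<theta> assume \<theta>: "\<theta> \<in> {u..v}"
  \<comment> \<open>The node j is the last one at or below \<theta>, so the next node lies above
    \<theta> by at most \<eta>; the minimum with \<open>v\<close> keeps it inside the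
    interval.\<close>
  define j where "j = nat \<lfloor>(\<theta> - u) / \<eta>\<rfloor>"
  have jN: "j \<le> N" unfolding j_def N_def using \<theta> assms by (intro nat_mono floor_mono divide_right_mono) auto
  have "real j * \<eta> \<le> \<theta> - u" "\<not> real (Suc j) * \<eta> \<le> \<theta> - u"
    using le_nat_floor_iff[OF assms(2), of "\<theta> - u" j] le_nat_floor_iff[OF assms(2), of "\<theta> - u" "Suc j"] \<theta>
    by (auto simp: j_def)
  then have "\<theta> \<le> min v (u + real (Suc j) * \<eta>) \<and> min v (u + real (Suc j) * \<eta>) \<le> \<theta> + \<eta>"
    using \<theta> by (auto simp: algebra_simps min_def)
  then show "\<exists>b\<in>?B. \<theta> \<le> b \<and> b \<le> \<theta> + \<eta>"
    by (rule bexI) (use jN in blast)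
qed

section \<open>Dependence on the barrier and the L^1 limit\<close>

context risk_model
begin

lemma permuted_value_barrier_diff:
  assumes "0 < r" "0 < \<delta>" "a \<le> b"
  shows "permuted_value (\<lambda>y. y) r a \<delta> n \<pi> \<omega> \<le> permuted_value (\<lambda>y. y) r b \<delta> n \<pi> \<omega> + (b - a)"
proof -
  let ?p = "walk u (\<lambda>j. grid_increment X \<delta> (\<pi> j) \<omega>)"
  have "discounted r \<delta> n (grid_payout a ?p) \<le> discounted r \<delta> n (\<lambda>k. grid_payout b ?p k + (b - a))"
    by (intro discounted_mono assms grid_payout_barrier_diff)
  also have "\<dots> = discounted r \<delta> n (grid_payout b ?p) + (b - a)"
    using discounted_add[OF assms(1,2), of n "grid_payout b ?p" "\<lambda>_. b - a"] discounted_const[OF assms(1,2)] by simp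
  finally show ?thesis by (simp add: permuted_value_def walk_value_def)
qed

definition sample_mean :: "real \<Rightarrow> real \<Rightarrow> real \<Rightarrow> nat \<Rightarrow> nat \<Rightarrow> (nat \<Rightarrow> 'a \<Rightarrow> nat \<Rightarrow> nat) \<Rightarrow> 'a \<Rightarrow> real" where
  "sample_mean r \<theta> \<delta> n a I \<omega> = (\<Sum>k=1..a. permuted_value (\<lambda>y. y) r \<theta> \<delta> n (I k \<omega>) \<omega>) / a"

lemma sample_mean_barrier_diff:
  assumes "0 < r" "0 < \<delta>" "\<theta> \<le> b" "1 \<le> a"
  shows "sample_mean r \<theta> \<delta> n a I \<omega> \<le> sample_mean r b \<delta> n a I \<omega> + (b - \<theta>)"
proof -
  have "sample_mean r \<theta> \<delta> n a I \<omega> \<le> (\<Sum>k=1..a. permuted_value (\<lambda>y. y) r b \<delta> n (I k \<omega>) \<omega> + (b - \<theta>)) / a"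
    unfolding sample_mean_def by (intro divide_right_mono sum_mono permuted_value_barrier_diff assms) auto
  then show ?thesis using assms(4) by (simp add: sample_mean_def sum.distrib add_divide_distrib)
qed

lemma sample_mean_eq_h_quasi:
  assumes "0 < r" "0 < \<delta>" "0 \<le> \<theta>"
  shows "(\<Sum>k=1..a. h_quasi (real n * \<delta>) r \<theta> (quasi_process u n \<delta> (\<lambda>t. X t \<omega>) (I k \<omega>))) / real a
    = sample_mean r \<theta> \<delta> n a I \<omega>"
  unfolding sample_mean_def h_quasi_quasi_process[OF assms(2,1,3) u_nonneg] permuted_value_def walk_value_def grid_increment_def ..

lemma sample_mean_L1_limit:
  fixes h :: "nat \<Rightarrow> real" and \<alpha> :: "nat \<Rightarrow> nat"
  assumes r: "0 < r" and \<theta>: "u \<le> \<theta>" "0 < \<theta>"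
    and mesh: "\<And>n. 1 \<le> n \<Longrightarrow> 0 < h n" and mesh_0: "h \<longlonglongrightarrow> 0"
    and horizon: "filterlim (\<lambda>n. real n * h n) at_top sequentially"
    and \<alpha>: "\<And>n. 1 \<le> n \<Longrightarrow> 1 \<le> \<alpha> n" and \<alpha>_top: "filterlim (\<lambda>n. real (\<alpha> n)) at_top sequentially"
    and sample: "\<And>n. 1 \<le> n \<Longrightarrow> uniform_perm_sample X n (\<alpha> n) (I n)"
  shows "(\<lambda>n. expectation (\<lambda>\<omega>. \<bar>sample_mean r \<theta> (h n) n (\<alpha> n) (I n) \<omega> - (LINT \<omega>|M. h_path r \<theta> (\<lambda>t. X t \<omega>))\<bar>)) \<longlonglongrightarrow> 0"
proof (rule tendstoI)
  fix e :: real assume e: "0 < e"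
  define P where "P = (LINT \<omega>|M. h_path r \<theta> (\<lambda>t. X t \<omega>))"
  define C where "C = second_moment_bound r"
  \<comment> \<open>Six errors of size \<eta> are added up below: one from the mean, one from the
    passage from L^2 to L^1, two from the variance, two from the cap and the horizon.\<close>
  define \<eta> where "\<eta> = e / 8"
  have \<eta>: "0 < \<eta>" using e by (simp add: \<eta>_def)
  define K where "K = 2 * \<bar>C\<bar> / \<eta> + 1"
  have K: "0 < K" using \<eta> by (simp add: K_def add_nonneg_pos)
  have CK: "2 * (C / K) \<le> \<eta>"
  proof -
    have "2 * C \<le> 2 * \<bar>C\<bar> + \<eta>" using \<eta> by simp
    also have "\<dots> = \<eta> * K" using \<eta> by (simp add: K_def field_simps)
    finally show ?thesis using K by (simp add: pos_divide_le_eq mult.commute)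
  qed
  obtain T where T: "0 < T" "2 * K * exp (- r * T) < \<eta>"
  proof -
    have "((\<lambda>T. 2 * K * exp (- r * T)) \<longlongrightarrow> 0) at_top" using r by real_asymp
    from eventually_conj[OF eventually_gt_at_top[of 0] order_tendstoD(2)[OF this \<eta>]]
    show ?thesis using that by (auto simp: eventually_at_top_linorder)
  qed
  \<comment> \<open>A common threshold: it makes the variance term small for the number of sampled
    permutations as well as for the number of blocks.\<close>
  define L0 where "L0 = K\<^sup>2 / (\<eta> * \<eta>) + 1"
  have L0: "1 \<le> L0" using \<eta> by (simp add: L0_def)
  have KL: "K\<^sup>2 / l / \<eta> \<le> \<eta>" if "L0 \<le> l" for l
  proof -
    have "K\<^sup>2 = (L0 - 1) * (\<eta> * \<eta>)" using \<eta> by (simp add: L0_def)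
    also have "\<dots> \<le> l * (\<eta> * \<eta>)" using that \<eta> by (intro mult_right_mono) auto
    finally show ?thesis using that L0 \<eta> by (simp add: pos_divide_le_eq mult_ac)
  qed
  have "\<forall>\<^sub>F n in sequentially. 1 \<le> n" by (rule eventually_ge_at_top)
  moreover have "\<forall>\<^sub>F n in sequentially. h n < 1" using order_tendstoD(2)[OF mesh_0, of 1] by simp
  moreover have "\<forall>\<^sub>F n in sequentially. (L0 + 1) * (T + 1) \<le> real n * h n"
    using horizon by (simp add: filterlim_at_top)
  moreover have "\<forall>\<^sub>F n in sequentially. L0 \<le> real (\<alpha> n)"
    using \<alpha>_top by (simp add: filterlim_at_top)
  moreover have "\<forall>\<^sub>F n in sequentially. dist (expectation (grid_value r \<theta> (h n) n)) P < \<eta>"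
    unfolding P_def by (rule tendstoD[OF grid_value_expectation_limit[OF r \<theta> mesh mesh_0 horizon] \<eta>])
  ultimately show "\<forall>\<^sub>F n in sequentially.
      dist (expectation (\<lambda>\<omega>. \<bar>sample_mean r \<theta> (h n) n (\<alpha> n) (I n) \<omega> - (LINT \<omega>|M. h_path r \<theta> (\<lambda>t. X t \<omega>))\<bar>)) 0 < e"
    unfolding P_def[symmetric]
  proof eventually_elim
    case (elim n)
    let ?Y = "sample_mean r \<theta> (h n) n (\<alpha> n) (I n)"
    have \<delta>: "0 < h n" "h n \<le> 1" using mesh elim by auto
    \<comment> \<open>\<open>m\<close> grows with n, but its time span stays below T + 1. As
      \<open>real n * h n\<close> eventually exceeds (L0 + 1) (T + 1), more than L0 full blocks of
      \<open>m\<close> steps fit into n.\<close>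
    define m where "m = grid_index (h n) T"
    have m_up: "real m * h n < T + 1" using grid_index_upper[OF \<delta>(1), of T] T \<delta> by (simp add: m_def)
    have m_low: "T \<le> real m * h n" unfolding m_def by (rule grid_index_lower[OF \<delta>(1)])
    have m1: "1 \<le> m" using m_low T by (cases m) auto
    define L where "L = n div m"
    have "(L0 + 1) * (real m * h n) \<le> (L0 + 1) * (T + 1)" using m_up L0 by (intro mult_left_mono) auto
    then have "((L0 + 1) * real m) * h n \<le> real n * h n" using elim by (simp add: mult.assoc)
    then have L0m: "(L0 + 1) * real m \<le> real n" using \<delta> by simp
    have "real n < (real L + 1) * real m"
    proof -
      have "n < Suc L * m" using m1 dividend_less_div_times[of m n] by (simp add: L_def)
      then have "real n < real (Suc L * m)" by (simp only: of_nat_less_iff)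
      then show ?thesis by (simp add: algebra_simps)
    qed
    with L0m have "(L0 + 1) * real m < (real L + 1) * real m" by linarith
    then have L: "L0 < real L" using m1 by simp
    then have L1: "1 \<le> L" using L0 by linarith
    have Lmn: "L * m \<le> n" by (simp add: L_def)
    have "1 * m \<le> L * m" by (rule mult_le_mono1[OF L1])
    then have mn: "m \<le> n" using Lmn by linarith
    have smi: "integrable M ?Y"
      unfolding sample_mean_def[abs_def]
      by (rule sample_mean_integrable[OF r \<theta>(1) \<delta> elim(1) sample \<alpha>]) (use elim in auto)
    have "expectation (\<lambda>\<omega>. \<bar>?Y \<omega> - P\<bar>)
        \<le> expectation (\<lambda>\<omega>. \<bar>?Y \<omega> - expectation (grid_value r \<theta> (h n) n)\<bar> + \<eta>)"
      using elim(5) by (intro integral_mono integrable_abs Bochner_Integration.integrable_diff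
          Bochner_Integration.integrable_add smi) (auto simp: dist_real_def)
    also have "\<dots> = expectation (\<lambda>\<omega>. \<bar>?Y \<omega> - expectation (grid_value r \<theta> (h n) n)\<bar>) + \<eta>"
      using smi prob_space by simp
    also have "expectation (\<lambda>\<omega>. \<bar>?Y \<omega> - expectation (grid_value r \<theta> (h n) n)\<bar>)
        \<le> \<eta> + (K\<^sup>2 / \<alpha> n + K\<^sup>2 / L) / \<eta> + 2 * (C / K + K * exp (- r * (real m * h n)))"
      unfolding C_def sample_mean_def
      by (rule sample_mean_deviation[OF r \<theta>(1) \<delta> elim(1) sample \<alpha> K \<eta> m1 mn L1 Lmn]) (use elim in auto)
    also have "(K\<^sup>2 / \<alpha> n + K\<^sup>2 / L) / \<eta> \<le> \<eta> + \<eta>"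
      unfolding add_divide_distrib using elim(4) L by (intro add_mono KL) auto
    also have "2 * (C / K + K * exp (- r * (real m * h n))) \<le> \<eta> + \<eta>"
    proof -
      have "exp (- r * (real m * h n)) \<le> exp (- r * T)" using m_low r by simp
      then have "2 * K * exp (- r * (real m * h n)) \<le> 2 * K * exp (- r * T)" using K by (intro mult_left_mono) auto
      then show ?thesis using CK T(2) by (simp add: distrib_left mult.assoc)
    qed
    finally have "expectation (\<lambda>\<omega>. \<bar>?Y \<omega> - P\<bar>) \<le> 6 * \<eta>" by simp
    moreover have "0 \<le> expectation (\<lambda>\<omega>. \<bar>?Y \<omega> - P\<bar>)"
      by (intro Bochner_Integration.integral_nonneg) auto
    ultimately show ?case using e by (simp add: \<eta>_def)
  qed
qed

end

section \<open>Consistency of the maximiser\<close>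

theorem theorem2:
  fixes M :: "'a measure" and F :: "real \<Rightarrow> 'a measure"
    and W S X :: "real \<Rightarrow> 'a \<Rightarrow> real" and \<nu> :: "real measure"
    and u c \<sigma> r \<theta>_bar \<theta>\<^sub>0 :: real
    and h :: "nat \<Rightarrow> real" and \<alpha> :: "nat \<Rightarrow> nat"
    and I :: "nat \<Rightarrow> nat \<Rightarrow> 'a \<Rightarrow> nat \<Rightarrow> nat"
    and \<theta>_hat :: "nat \<Rightarrow> 'a \<Rightarrow> real"
  assumes model: "risk_model M F u c \<sigma> W S \<nu>"
    and X: "X = risk_process u c \<sigma> W S"
    and r: "0 < r" and \<theta>_bar: "0 < \<theta>_bar"
    and mesh: "\<And>n. 1 \<le> n \<Longrightarrow> 0 < h n"
    and \<alpha>: "\<And>n. 1 \<le> n \<Longrightarrow> 1 \<le> \<alpha> n \<and> \<alpha> n \<le> fact n"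
    and sample: "\<And>n. 1 \<le> n \<Longrightarrow> prob_space.uniform_perm_sample M X n (\<alpha> n) (I n)"
    and mesh_0: "h \<longlonglongrightarrow> 0"
    and horizon: "filterlim (\<lambda>n. real n * h n) at_top sequentially"
    and \<alpha>_growth: "(\<lambda>n. real n / real (\<alpha> n)) \<longlonglongrightarrow> 0"
    and \<theta>\<^sub>0: "\<theta>\<^sub>0 \<in> {u<..<\<theta>_bar}"
    and identifiable: "\<And>\<epsilon>. 0 < \<epsilon> \<Longrightarrow>
      (SUP \<theta> \<in> {\<theta> \<in> closure {u<..<\<theta>_bar}. \<epsilon> < \<bar>\<theta> - \<theta>\<^sub>0\<bar>}.
          ereal (LINT \<omega>|M. h_path r \<theta> (\<lambda>t. X t \<omega>)))
        < ereal (LINT \<omega>|M. h_path r \<theta>\<^sub>0 (\<lambda>t. X t \<omega>))"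
    and \<theta>_hat_measurable: "\<And>n. 1 \<le> n \<Longrightarrow> \<theta>_hat n \<in> borel_measurable M"
    and \<theta>_hat: "\<And>n \<omega>. 1 \<le> n \<Longrightarrow> \<omega> \<in> space M \<Longrightarrow>
      is_arg_max
        (\<lambda>\<theta>. (\<Sum>k=1..\<alpha> n. h_quasi (real n * h n) r \<theta>
                 (quasi_process u n (h n) (\<lambda>t. X t \<omega>) (I n k \<omega>))) / real (\<alpha> n))
        (\<lambda>\<theta>. \<theta> \<in> closure {u<..<\<theta>_bar})
        (\<theta>_hat n \<omega>)"
  shows "\<forall>\<epsilon>>0. (\<lambda>n. measure M {\<omega> \<in> space M. \<epsilon> < \<bar>\<theta>_hat n \<omega> - \<theta>\<^sub>0\<bar>}) \<longlonglongrightarrow> 0"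
proof (intro allI impI)
  fix \<epsilon> :: real assume \<epsilon>: "0 < \<epsilon>"
  interpret risk_model M F u c \<sigma> W S \<nu> by (rule model)
  have \<Theta>: "closure {u<..<\<theta>_bar} = {u..\<theta>_bar}" using \<theta>\<^sub>0 by (intro closure_greaterThanLessThan) auto
  define P where "P \<theta> = (LINT \<omega>|M. h_path r \<theta> (\<lambda>t. X t \<omega>))" for \<theta>
  define Pn where "Pn n \<theta> = sample_mean r \<theta> (h n) n (\<alpha> n) (I n)" for n \<theta>
  have \<alpha>_top: "filterlim (\<lambda>n. real (\<alpha> n)) at_top sequentially"
  proof (rule filterlim_at_top_mono[OF filterlim_real_sequentially])
    show "\<forall>\<^sub>F n in sequentially. real n \<le> real (\<alpha> n)"
      using order_tendstoD(2)[OF \<alpha>_growth zero_less_one] eventually_ge_at_top[of 1]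
    proof eventually_elim
      case (elim n)
      then show ?case using \<alpha>[of n] by (simp add: divide_less_eq_1)
    qed
  qed
  note sample = sample[unfolded X]
  have L1: "(\<lambda>n. expectation (\<lambda>\<omega>. \<bar>Pn n \<theta> \<omega> - P \<theta>\<bar>)) \<longlonglongrightarrow> 0" if "\<theta> \<in> {u<..\<theta>_bar}" for \<theta>
    unfolding Pn_def P_def X using that u_nonneg \<alpha>
    by (intro sample_mean_L1_limit r mesh mesh_0 horizon \<alpha>_top sample) auto
  \<comment> \<open>Half the distance, since rounding up to the net moves a barrier by at most
    \<epsilon> / 2 and must leave it away from \<open>\<theta>\<^sub>0\<close>.\<close>
  have "0 < \<epsilon> / 2" using \<epsilon> by simp
  from ereal_dense2[OF identifiable[OF this]] obtain q
    where q: "(SUP \<theta> \<in> {\<theta> \<in> {u..\<theta>_bar}. \<epsilon> / 2 < \<bar>\<theta> - \<theta>\<^sub>0\<bar>}. ereal (P \<theta>)) < ereal q" "ereal q < ereal (P \<theta>\<^sub>0)"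
    unfolding \<Theta> P_def by blast
  \<comment> \<open>A quarter of the gap: above q there is one \<gamma> for the sampling error at
    the net point and one for the rounding; below \<open>P \<theta>\<^sub>0\<close> there is one for
    the sampling error at \<open>\<theta>\<^sub>0\<close>. One is left to make the inequality
    strict.\<close>
  define \<gamma> where "\<gamma> = (P \<theta>\<^sub>0 - q) / 4"
  have \<gamma>: "0 < \<gamma>" "q + 2 * \<gamma> < P \<theta>\<^sub>0 - \<gamma>" using q(2) by (auto simp: \<gamma>_def field_simps)
  obtain B where B: "finite B" "B \<subseteq> {u<..\<theta>_bar}"
    "\<And>\<theta>. \<theta> \<in> {u..\<theta>_bar} \<Longrightarrow> \<exists>b\<in>B. \<theta> \<le> b \<and> b \<le> \<theta> + min \<gamma> (\<epsilon> / 2)"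
  proof (rule finite_upper_net[of u \<theta>_bar "min \<gamma> (\<epsilon> / 2)"])
    show "u < \<theta>_bar" using \<theta>\<^sub>0 by simp
    show "0 < min \<gamma> (\<epsilon> / 2)" using \<gamma>(1) \<epsilon> by simp
  qed (rule that)
  \<comment> \<open>The finitely many barriers at which a law of large numbers is needed: the
    competitor \<open>\<theta>\<^sub>0\<close> and the net points that a maximiser far from it can
    be rounded to.\<close>
  define B' where "B' = insert \<theta>\<^sub>0 {b\<in>B. \<epsilon> / 2 < \<bar>b - \<theta>\<^sub>0\<bar>}"
  have B': "finite B'" "B' \<subseteq> {u<..\<theta>_bar}" using B \<theta>\<^sub>0 by (auto simp: B'_def)
  let ?bad = "\<lambda>n. {\<omega> \<in> space M. \<epsilon> < \<bar>\<theta>_hat n \<omega> - \<theta>\<^sub>0\<bar>}"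
    and ?far = "\<lambda>n b. {\<omega> \<in> space M. \<gamma> \<le> \<bar>Pn n b \<omega> - P b\<bar>}"
    and ?err = "\<lambda>n b. expectation (\<lambda>\<omega>. \<bar>Pn n b \<omega> - P b\<bar>)"
  have bound: "prob (?bad n) \<le> (\<Sum>b\<in>B'. ?err n b / \<gamma>)"
    if n: "1 \<le> n" and hn: "h n \<le> 1" for n
  proof -
    have int: "integrable M (\<lambda>\<omega>. \<bar>Pn n b \<omega> - P b\<bar>)" if "b \<in> B'" for b
      unfolding Pn_def sample_mean_def[abs_def] using that B' \<alpha>[OF n]
      by (intro integrable_abs Bochner_Integration.integrable_diff sample_mean_integrable[OF r _ mesh[OF n] hn n sample[OF n]]) auto
    have meas: "?far n b \<in> events" if "b \<in> B'" for b
      using borel_measurable_integrable[OF int[OF that]] by measurable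
    have "?bad n \<subseteq> (\<Union>b\<in>B'. ?far n b)"
    proof (rule subsetI, rule ccontr)
      fix \<omega> assume \<omega>: "\<omega> \<in> ?bad n"
        and "\<omega> \<notin> (\<Union>b\<in>B'. ?far n b)"
      then have near: "\<bar>Pn n b \<omega> - P b\<bar> < \<gamma>" if "b \<in> B'" for b using that by auto
      define \<theta> where "\<theta> = \<theta>_hat n \<omega>"
      have Pn_eq: "(\<Sum>k=1..\<alpha> n. h_quasi (real n * h n) r \<theta> (quasi_process u n (h n) (\<lambda>t. X t \<omega>) (I n k \<omega>))) / real (\<alpha> n)
          = Pn n \<theta> \<omega>" if "\<theta> \<in> {u..\<theta>_bar}" for \<theta>
        unfolding Pn_def X using that u_nonneg by (intro sample_mean_eq_h_quasi r mesh n) auto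
      have \<theta>: "\<theta> \<in> {u..\<theta>_bar}" "\<epsilon> < \<bar>\<theta> - \<theta>\<^sub>0\<bar>"
        using \<theta>_hat[OF n] \<omega> by (auto simp: is_arg_max_def \<Theta> \<theta>_def)
      \<comment> \<open>\<open>\<theta>\<^sub>0\<close> is itself admissible, so the maximiser does
        at least as well; by the estimates below it cannot, if all sampling errors on B' are below
        \<gamma>.\<close>
      have opt: "Pn n \<theta>\<^sub>0 \<omega> \<le> Pn n \<theta> \<omega>"
        using \<theta>_hat[OF n, of \<omega>] \<omega> \<theta>\<^sub>0 \<theta>(1) Pn_eq unfolding is_arg_max_def \<Theta> \<theta>_def[symmetric]
        by (metis (no_types, lifting) atLeastAtMost_iff greaterThanLessThan_iff less_imp_le mem_Collect_eq not_less)
      obtain b where b: "b \<in> B" "\<theta> \<le> b" "b \<le> \<theta> + min \<gamma> (\<epsilon> / 2)" using B(3)[OF \<theta>(1)] by blast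
      then have "b \<le> \<theta> + \<gamma>" "b \<le> \<theta> + \<epsilon> / 2" by auto
      then have far: "\<epsilon> / 2 < \<bar>b - \<theta>\<^sub>0\<bar>" using \<theta>(2) b(2) \<epsilon> by (auto simp: abs_if split: if_splits)
      then have "b \<in> B'" using b by (simp add: B'_def)
      have "b \<in> {\<theta> \<in> {u..\<theta>_bar}. \<epsilon> / 2 < \<bar>\<theta> - \<theta>\<^sub>0\<bar>}" using far b(1) B(2) by auto
      then have "ereal (P b) < ereal q" by (rule le_less_trans[OF SUP_upper q(1)])
      then have "P b < q" by simp
      \<comment> \<open>Only this upward comparison is used: the empirical value at \<theta> is
        bounded by the one at the larger barrier b, which was sampled accurately.\<close>
      have "Pn n \<theta> \<omega> \<le> Pn n b \<omega> + (b - \<theta>)"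
        unfolding Pn_def using \<alpha>[OF n] by (intro sample_mean_barrier_diff r mesh n b(2)) auto
      then have "Pn n \<theta> \<omega> < q + 2 * \<gamma>"
        using near[OF \<open>b \<in> B'\<close>] \<open>P b < q\<close> \<open>b \<le> \<theta> + \<gamma>\<close> by linarith
      moreover have "P \<theta>\<^sub>0 - \<gamma> < Pn n \<theta>\<^sub>0 \<omega>" using near[of \<theta>\<^sub>0] by (simp add: B'_def abs_less_iff)
      ultimately show False using opt \<gamma>(2) by linarith
    qed
    then have "prob (?bad n) \<le> prob (\<Union>b\<in>B'. ?far n b)"
      using meas B'(1) by (intro finite_measure_mono sets.finite_UN) auto
    also have "\<dots> \<le> (\<Sum>b\<in>B'. prob (?far n b))"
      using meas B'(1) by (intro finite_measure_subadditive_finite) auto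
    also have "\<dots> \<le> (\<Sum>b\<in>B'. ?err n b / \<gamma>)"
      by (intro sum_mono integral_Markov_inequality_measure[where A="{}"] int) (use \<gamma> in auto)
    finally show ?thesis .
  qed
  show "(\<lambda>n. prob (?bad n)) \<longlonglongrightarrow> 0"
  proof (rule tendsto_sandwich[OF _ _ tendsto_const])
    show "\<forall>\<^sub>F n in sequentially. 0 \<le> prob (?bad n)" by simp
    show "\<forall>\<^sub>F n in sequentially. prob (?bad n)
        \<le> (\<Sum>b\<in>B'. ?err n b / \<gamma>)"
      using eventually_ge_at_top[of 1] order_tendstoD(2)[OF mesh_0 zero_less_one]
      by eventually_elim (intro bound; simp)
    have "(\<lambda>n. \<Sum>b\<in>B'. ?err n b / \<gamma>) \<longlonglongrightarrow> (\<Sum>b\<in>B'. 0 / \<gamma>)"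
      using B'(2) \<gamma> by (intro tendsto_sum tendsto_divide L1 tendsto_const) auto
    then show "(\<lambda>n. \<Sum>b\<in>B'. ?err n b / \<gamma>) \<longlonglongrightarrow> 0" by simp
  qed
qed

end
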